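(* Let $\varepsilon$ be a mean-zero sub-Gaussian random variable, whose distribution does not depend on $n$. For each $n$, let $p=p_n$ and $k=k_n$ be integers, let $(\boldsymbol{x}_1,y_1),\ldots,(\boldsymbol{x}_n,y_n)$ be i.i.d. samples from Model 2 (in dimension $p$, with covariance $\Sigma$ and noise distributed as $\varepsilon$), and let $\boldsymbol{v}\in\mathbb{S}^{p-1}$ be deterministic. Assume that as $n\to\infty$, $k/n\to\alpha\in(0,1/2)$ and $p/(n-k)\to\gamma\in[0,1)$. Then $$\lim_{n\to\infty}\mathbb{P}\bigg(\Delta_k(\boldsymbol{v})\ge\frac{1}{1-\alpha}\cdot\big\|\Sigma^{-1/2}\boldsymbol{v}\big\|\cdot\mathbb{E}\big[\varepsilon z\,\mathbf{1}(\varepsilon z>q_{1-\alpha})\big]\bigg)=1,$$ where $z\sim\mathcal{N}(0,1)$ is independent of $\varepsilon$, and $q_{1-\alpha}$ is the $(1-\alpha)$-quantile of $\varepsilon z$.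
   Context: Model 2: $y=\boldsymbol\beta^\top\boldsymbol{x}+\varepsilon$, where $\boldsymbol\beta\in\mathbb{R}^p$ is deterministic, $\boldsymbol{x}\sim\mathcal{N}(0,\Sigma)$ with $\Sigma\in\mathbb{R}^{p\times p}$ positive definite, and $\varepsilon$ is sub-Gaussian, mean zero, and independent of $\boldsymbol{x}$. (Sub-Gaussian means $\inf\{t>0:\mathbb{E}[\exp(\varepsilon^2/t^2)]\le e\}<\infty$.) OLS: $X\in\mathbb{R}^{n\times p}$ has rows $\boldsymbol{x}_1,\ldots,\boldsymbol{x}_n$ and $\boldsymbol{y}=(y_1,\ldots,y_n)^\top$. For $\mathcal{S}\subseteq[n]=\{1,\ldots,n\}$, $X_{\mathcal{S}}$ and $\boldsymbol{y}_{\mathcal{S}}$ are the restrictions to the rows/entries indexed by $\mathcal{S}$. $\widehat{\boldsymbol\beta}=(X^\top X)^{-1}X^\top\boldsymbol{y}$ and $\widehat{\boldsymbol\beta}_{\mathcal{S}}=(X_{\mathcal{S}}^\top X_{\mathcal{S}})^{-1}X_{\mathcal{S}}^\top\boldsymbol{y}_{\mathcal{S}}$ (almost surely well-defined when $|\mathcal{S}|\ge p$). For $\boldsymbol{v}\in\mathbb{S}^{p-1}$, $$\Delta_k(\boldsymbol{v})=\max_{\mathcal{S}\subset[n],\,|\mathcal{S}|=n-k}\langle\widehat{\boldsymbol\beta}-\widehat{\boldsymbol\beta}_{\mathcal{S}},\boldsymbol{v}\rangle .$$ $\mathbf{1}(\cdot)$ is the indicator function and $\|\cdot\|$ is the Euclidean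 norm. *)

theory Defs
  imports
    "HOL-Probability.Probability"
    "Jordan_Normal_Form.Gauss_Jordan_Elimination"
    "Jordan_Normal_Form.DL_Submatrix"
begin

unbundle no vec_syntax
unbundle no inner_syntax

section \<open>Linear algebra in varying dimension\<close>

definition vec_l2norm :: "real vec \<Rightarrow> real" where
  "vec_l2norm v = sqrt (v \<bullet> v)"

definition pos_def_mat :: "nat \<Rightarrow> real mat \<Rightarrow> bool" where
  "pos_def_mat p A \<longleftrightarrow> A \<in> carrier_mat p p \<and> transpose_mat A = A \<and>
     (\<forall>u\<in>carrier_vec p. u \<noteq> 0\<^sub>v p \<longrightarrow> 0 < u \<bullet> (A *\<^sub>v u))"

(* For non-invertible matrices the value is irrelevant; the zero matrix is a total (and
   measurable) convention. *)
definition mat_inv :: "real mat \<Rightarrow> real mat" where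
  "mat_inv A = (case mat_inverse A of Some B \<Rightarrow> B | None \<Rightarrow> 0\<^sub>m (dim_row A) (dim_row A))"

(* The principal square root: a positive definite matrix has exactly one positive definite
   square root, so the choice operator makes no actual choice. *)
definition mat_sqrt :: "real mat \<Rightarrow> real mat" where
  "mat_sqrt A = (SOME B. pos_def_mat (dim_row A) B \<and> B * B = A)"

definition mat_inv_sqrt :: "real mat \<Rightarrow> real mat" where
  "mat_inv_sqrt A = mat_inv (mat_sqrt A)"

section \<open>Ordinary least squares and the effect of deletions\<close>

(* Observations are indexed by {0..<n} instead of {1..n}. *)

definition ols :: "real mat \<Rightarrow> real vec \<Rightarrow> real vec" where
  "ols X y = (mat_inv (transpose_mat X * X) * transpose_mat X) *\<^sub>v y"

definition restrict_rows :: "real mat \<Rightarrow> nat set \<Rightarrow> real mat" where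
  "restrict_rows X S = submatrix X S UNIV"

(* As in submatrix, pick S i is the i-th smallest element of S, so entries keep their order. *)
definition restrict_entries :: "real vec \<Rightarrow> nat set \<Rightarrow> real vec" where
  "restrict_entries y S = vec (card {i. i < dim_vec y \<and> i \<in> S}) (\<lambda>i. y $ pick S i)"

definition max_deletion_effect :: "nat \<Rightarrow> real mat \<Rightarrow> real vec \<Rightarrow> real vec \<Rightarrow> real" where
  "max_deletion_effect k X y v =
     Max ((\<lambda>S. (ols X y - ols (restrict_rows X S) (restrict_entries y S)) \<bullet> v) `
          {S. S \<subseteq> {..<dim_row X} \<and> card S = dim_row X - k})"

section \<open>Probabilistic notions\<close>

(* Infimum over the empty set is infinite. The expectation is a nonnegative Lebesgue integral,
   because the Bochner integral of a non-integrable function is 0. *)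
definition subgaussian_norm :: "'a measure \<Rightarrow> ('a \<Rightarrow> real) \<Rightarrow> ereal" where
  "subgaussian_norm M f =
     (INF t\<in>{t::real. 0 < t \<and>
        (\<integral>\<^sup>+\<omega>. ennreal (exp ((f \<omega>)\<^sup>2 / t\<^sup>2)) \<partial>M) \<le> ennreal (exp 1)}. ereal t)"

definition subgaussian :: "'a measure \<Rightarrow> ('a \<Rightarrow> real) \<Rightarrow> bool" where
  "subgaussian M f \<longleftrightarrow> f \<in> borel_measurable M \<and> subgaussian_norm M f < \<infinity>"

definition quantile :: "real measure \<Rightarrow> real \<Rightarrow> real" where
  "quantile D u = Inf {t. u \<le> cdf D t}"

(* Random vectors in dimension p take values in the product space over the index set {..<p}:
   functions whose values outside the index set are undefined. *)
abbreviation borel_vec :: "nat \<Rightarrow> (nat \<Rightarrow> real) measure" where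
  "borel_vec p \<equiv> PiM {..<p} (\<lambda>_. borel)"

(* N(0, Sigma) as the law of Sigma^(1/2) g, where g has i.i.d. standard normal coordinates. *)
definition gaussian_measure :: "nat \<Rightarrow> real mat \<Rightarrow> (nat \<Rightarrow> real) measure" where
  "gaussian_measure p \<Sigma> =
     distr (PiM {..<p} (\<lambda>_. std_normal_distribution)) (borel_vec p)
       (\<lambda>g. \<lambda>j\<in>{..<p}. (mat_sqrt \<Sigma> *\<^sub>v vec p g) $ j)"

(* Joint law of (x, y) with y = <beta, x> + e, where x is N(0, Sigma) and e, independent of x,
   has law D. *)
definition linear_model_law ::
  "nat \<Rightarrow> real mat \<Rightarrow> real vec \<Rightarrow> real measure \<Rightarrow> ((nat \<Rightarrow> real) \<times> real) measure" where
  "linear_model_law p \<Sigma> \<beta> D =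
     distr (gaussian_measure p \<Sigma> \<Otimes>\<^sub>M D) (borel_vec p \<Otimes>\<^sub>M borel)
       (\<lambda>(x, e). (x, \<beta> \<bullet> vec p x + e))"

definition iid_samples :: "'a measure \<Rightarrow> nat \<Rightarrow> 'b measure \<Rightarrow> (nat \<Rightarrow> 'a \<Rightarrow> 'b) \<Rightarrow> bool" where
  "iid_samples M n L Z \<longleftrightarrow>
     prob_space.indep_vars M (\<lambda>_. L) Z {..<n} \<and> (\<forall>i<n. distr M L (Z i) = L)"

definition design_mat :: "nat \<Rightarrow> nat \<Rightarrow> (nat \<Rightarrow> nat \<Rightarrow> real) \<Rightarrow> real mat" where
  "design_mat n p x = mat n p (\<lambda>(i, j). x i j)"

end

theory Submission
  imports Defs "Jordan_Normal_Form.Determinant"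
begin

text \<open>
  Let \<open>B = \<Sigma>\<^sup>1\<^sup>/\<^sup>2\<close>, \<open>s = \<parallel>B\<^sup>-\<^sup>1 v\<parallel>\<close> and \<open>u = B\<^sup>-\<^sup>1 v / s\<close>. The rows are \<open>x\<^sub>i = B g\<^sub>i\<close> with standard
  Gaussian \<open>g\<^sub>i\<close>, and the estimation error along \<open>v\<close> is \<open>s \<langle>u, d\<rangle>\<close>, where \<open>d\<close> solves the regression
  of the noise \<open>e\<^sub>i\<close> on the \<open>g\<^sub>i\<close>. The deletion effect is a maximum, so one good set \<open>S\<close> of retained
  rows is enough. By the Frisch--Waugh--Lovell formula (\<open>frisch_waugh_lovell\<close>),
  \<open>\<langle>u, d\<^sub>S\<rangle> = Q\<^sub>S(z, e) / Q\<^sub>S(z, z)\<close>, where \<open>z\<^sub>i = \<langle>u, g\<^sub>i\<rangle>\<close> and \<open>Q\<^sub>S\<close> is the form of the projection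
  off the \<open>p - 1\<close> nuisance directions, those orthogonal to \<open>u\<close>.

  The set \<open>S\<close> is chosen from the pairs \<open>(e\<^sub>i, z\<^sub>i)\<close> alone. The nuisance parts of the rows are independent
  of these pairs (\<open>distr_recombine\<close>), hence of \<open>S\<close>. Permuting the nuisance rows or reversing the sign of
  one of them preserves their law, which suffices to compute second moments, and
  \<open>Q\<^sub>S(z, b)\<close> concentrates at \<open>(1 - (p - 1) / |S|) \<Sum>\<^sub>S z\<^sub>i b\<^sub>i\<close> (\<open>form_deviation_tail\<close>). The factor is
  bounded away from \<open>0\<close> and cancels in the quotient; this is why the bound does not depend on \<open>\<gamma>\<close>.
  So, up to small errors, \<open>\<langle>u, d\<^sub>S\<rangle> \<le> - L\<close> as soon as \<open>\<Sum>\<^sub>S z\<^sub>i (e\<^sub>i + L z\<^sub>i) \<le> 0\<close>, whereas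
  \<open>\<langle>u, d\<rangle>\<close> for the full sample is close to \<open>0\<close> because \<open>E[\<epsilon> z] = 0\<close> (\<open>deletion_effect_ge\<close>).

  It remains to keep \<open>n - k\<close> indices with \<open>\<Sum>\<^sub>S z\<^sub>i (e\<^sub>i + L z\<^sub>i)\<close> negative, where
  \<open>L = E[\<epsilon> z 1(\<epsilon> z > q)] / (1 - \<alpha>)\<close>. Keeping the fraction \<open>1 - \<alpha>\<close> with the smallest \<open>\<epsilon> z\<close> contributes
  \<open>E[\<epsilon> z] - (1 - \<alpha>) L = - (1 - \<alpha>) L\<close> from the first term and at most \<open>L (1 - \<alpha>)\<close> from the second,
  since this truncation favours small \<open>|z|\<close> (\<open>integral_truncation_times_square\<close>). The sum of the two
  is at most \<open>0\<close>, and ranking by \<open>z (\<epsilon> + L z)\<close> instead of \<open>\<epsilon> z\<close> does strictly better unless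
  \<open>\<epsilon> = 0\<close> almost surely (\<open>population_weights\<close>). This strict slack absorbs every fluctuation: those of the
  law of large numbers, of \<open>k / n\<close> and of \<open>Q\<^sub>S\<close>; it is why the probability of the sharp inequality, with
  no error term, tends to \<open>1\<close>. If \<open>\<epsilon> = 0\<close>, the bound is \<open>0\<close> and all estimates equal \<open>\<beta>\<close>.

  The argument rests on the existence of \<open>\<Sigma>\<^sup>1\<^sup>/\<^sup>2\<close> (by the spectral theorem), the almost sure
  invertibility of all relevant Gram matrices (\<open>AE_rows_injective\<close>) and the measurability of the deletion
  effect (by the cofactor formula for the inverse). Vectors are functions on \<open>nat\<close> restricted to the
  indices below \<open>p\<close>, because the dimension varies with the sample size.
\<close>


section \<open>Dot products in coordinates\<close>

definition dotp :: "nat \<Rightarrow> (nat \<Rightarrow> real) \<Rightarrow> (nat \<Rightarrow> real) \<Rightarrow> real" where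
  "dotp p a b = (\<Sum>i<p. a i * b i)"

lemma dotp_commute: "dotp p a b = dotp p b a"
  by (simp add: dotp_def mult.commute)

lemma dotp_cong: "(\<And>i. i < p \<Longrightarrow> a i = a' i) \<Longrightarrow> (\<And>i. i < p \<Longrightarrow> b i = b' i) \<Longrightarrow> dotp p a b = dotp p a' b'"
  by (simp add: dotp_def)

lemma dotp_add_left: "dotp p (\<lambda>i. a i + b i) c = dotp p a c + dotp p b c"
  and dotp_diff_left: "dotp p (\<lambda>i. a i - b i) c = dotp p a c - dotp p b c"
  and dotp_scale_left: "dotp p (\<lambda>i. s * a i) c = s * dotp p a c"
  and dotp_add_right: "dotp p c (\<lambda>i. a i + b i) = dotp p c a + dotp p c b"
  and dotp_diff_right: "dotp p c (\<lambda>i. a i - b i) = dotp p c a - dotp p c b"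
  and dotp_scale_right: "dotp p c (\<lambda>i. s * a i) = s * dotp p c a"
  by (simp_all add: dotp_def algebra_simps sum.distrib sum_subtractf sum_distrib_left)

lemmas dotp_linear = dotp_add_left dotp_diff_left dotp_scale_left
  dotp_add_right dotp_diff_right dotp_scale_right

lemma dotp_sum_left: "dotp p (\<lambda>i. \<Sum>k\<in>A. f k i) c = (\<Sum>k\<in>A. dotp p (f k) c)"
  unfolding dotp_def by (simp add: sum_distrib_right) (rule sum.swap)

lemma dotp_sum_right: "dotp p c (\<lambda>i. \<Sum>k\<in>A. f k i) = (\<Sum>k\<in>A. dotp p c (f k))"
  using dotp_sum_left[of p f A c] by (simp add: dotp_commute)

lemma dotp_self_nonneg: "0 \<le> dotp p a a"
  by (simp add: dotp_def sum_nonneg)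

lemma dotp_self_eq_0: "dotp p a a = 0 \<longleftrightarrow> (\<forall>i<p. a i = 0)"
  unfolding dotp_def by (subst sum_nonneg_eq_0_iff) auto

section \<open>The principal square root\<close>

lemma compact_unit_sphere_Int_complement:
  fixes W :: "(nat \<Rightarrow> real) set"
  shows "compact {x::nat\<Rightarrow>real. (\<forall>i\<ge>p. x i = 0) \<and> dotp p x x = 1 \<and> (\<forall>w\<in>W. dotp p w x = 0)}"
    (is "compact ?K")
proof -
  have cont: "continuous_on UNIV (\<lambda>x::nat\<Rightarrow>real. x i)" for i
    by simp
  have "compactin (product_topology (\<lambda>_. euclidean) UNIV) (PiE UNIV (\<lambda>i::nat. {-1..1::real}))"
    by (subst compactin_PiE) auto
  hence box: "compact (PiE UNIV (\<lambda>i::nat. {-1..1::real}))"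
    by (simp add: euclidean_product_topology)
  have "?K = (\<Inter>i\<in>{p..}. {x. x i = 0}) \<inter> {x. dotp p x x = 1} \<inter> (\<Inter>w\<in>W. {x. dotp p w x = 0})"
    by auto
  moreover have "closed ((\<Inter>i\<in>{p..}. {x::nat\<Rightarrow>real. x i = 0}) \<inter> {x. dotp p x x = 1} \<inter> (\<Inter>w\<in>W. {x. dotp p w x = 0}))"
    unfolding dotp_def
    by (intro closed_Int closed_INT ballI closed_Collect_eq continuous_intros cont)
  ultimately have cl: "closed ?K" by simp
  have "?K \<subseteq> PiE UNIV (\<lambda>i::nat. {-1..1::real})"
  proof
    fix x assume x: "x \<in> ?K"
    have "\<bar>x i\<bar> \<le> 1" for i
    proof (cases "i < p")
      case True
      have "(x i)\<^sup>2 \<le> dotp p x x"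
        unfolding dotp_def power2_eq_square using True by (intro member_le_sum) auto
      thus ?thesis using x by (simp add: abs_square_le_1)
    qed (use x in auto)
    thus "x \<in> PiE UNIV (\<lambda>i::nat. {-1..1::real})" by (auto simp: abs_le_iff minus_le_iff)
  qed
  thus ?thesis using compact_Int_closed[OF box cl] by (simp add: Int_absorb1)
qed

text \<open>A maximiser of the quadratic form on the unit sphere of an invariant subspace is an
  eigenvector: the form \<open>\<mu>|y|\<^sup>2 - y\<^sup>TAy\<close> is nonnegative there and vanishes at the maximiser, hence is
  stationary at it.\<close>

lemma eigenvector_in_complement:
  fixes A :: "nat \<Rightarrow> nat \<Rightarrow> real" and W :: "(nat \<Rightarrow> real) set"
  assumes sym: "\<And>i j. i < p \<Longrightarrow> j < p \<Longrightarrow> A i j = A j i"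
    and eig: "\<And>w. w \<in> W \<Longrightarrow> \<exists>l. \<forall>i<p. dotp p (A i) w = l * w i"
    and ne: "\<exists>x. dotp p x x \<noteq> 0 \<and> (\<forall>w\<in>W. dotp p w x = 0)"
  shows "\<exists>x l. dotp p x x = 1 \<and> (\<forall>w\<in>W. dotp p w x = 0) \<and> (\<forall>i<p. dotp p (A i) x = l * x i)"
proof -
  define K where "K = {x::nat\<Rightarrow>real. (\<forall>i\<ge>p. x i = 0) \<and> dotp p x x = 1 \<and> (\<forall>w\<in>W. dotp p w x = 0)}"
  define Ax where "Ax = (\<lambda>x i. dotp p (A i) x)"
  define q where "q = (\<lambda>x. dotp p x (Ax x))"
  obtain x0 where x0: "dotp p x0 x0 \<noteq> 0" "\<And>w. w \<in> W \<Longrightarrow> dotp p w x0 = 0" using ne by blast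
  have adj: "dotp p y (Ax x) = dotp p (Ax y) x" for x y
  proof -
    have "dotp p y (Ax x) = (\<Sum>i<p. \<Sum>j<p. y i * A i j * x j)"
      by (simp add: dotp_def Ax_def sum_distrib_left mult.assoc)
    also have "\<dots> = (\<Sum>j<p. \<Sum>i<p. A j i * y i * x j)"
      by (subst sum.swap) (intro sum.cong refl, simp add: sym mult.commute)
    finally show ?thesis by (simp add: dotp_def Ax_def sum_distrib_right)
  qed
  have normalise: "\<exists>s>0. (\<lambda>i. if i < p then s * y i else 0) \<in> K \<and> s\<^sup>2 * dotp p y y = 1"
    if "dotp p y y \<noteq> 0" "\<And>w. w \<in> W \<Longrightarrow> dotp p w y = 0" for y
  proof -
    define s where "s = 1 / sqrt (dotp p y y)"
    have pos: "dotp p y y > 0" using that(1) dotp_self_nonneg[of p y] by simp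
    have s: "s > 0" "s\<^sup>2 * dotp p y y = 1" using pos by (auto simp: s_def power_divide)
    have eq: "dotp p c (\<lambda>i. if i < p then s * y i else 0) = s * dotp p c y" for c
      by (subst dotp_scale_right[symmetric]) (auto intro: dotp_cong)
    have "dotp p (\<lambda>i. if i < p then s * y i else 0) (\<lambda>i. if i < p then s * y i else 0) = s * (s * dotp p y y)"
      unfolding eq by (subst dotp_commute) (simp only: eq)
    thus ?thesis using s that(2) by (intro exI[of _ s]) (auto simp: K_def eq power2_eq_square mult.assoc)
  qed
  have "K \<noteq> {}" using normalise[OF x0] by blast
  moreover have "compact K" unfolding K_def by (rule compact_unit_sphere_Int_complement)
  moreover have "continuous_on K q"
    unfolding q_def Ax_def dotp_def
    by (intro continuous_intros) (auto intro: continuous_on_subset[OF continuous_on_product_coordinates])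
  ultimately obtain x where x: "x \<in> K" "\<And>y. y \<in> K \<Longrightarrow> q y \<le> q x"
    using continuous_attains_sup[of K q] by blast
  have xK: "dotp p x x = 1" "\<And>w. w \<in> W \<Longrightarrow> dotp p w x = 0" using x(1) by (auto simp: K_def)
  define d where "d = (\<lambda>i. Ax x i - q x * x i)"
  have dW: "dotp p w d = 0" if w: "w \<in> W" for w
  proof -
    obtain l where l: "\<And>i. i < p \<Longrightarrow> Ax w i = l * w i" using eig[OF w] by (auto simp: Ax_def)
    have "dotp p w (Ax x) = dotp p (\<lambda>i. l * w i) x"
      unfolding adj by (intro dotp_cong l) auto
    thus ?thesis by (simp add: d_def dotp_linear xK(2)[OF w])
  qed
  have psd: "q y \<le> q x * dotp p y y" if y: "\<And>w. w \<in> W \<Longrightarrow> dotp p w y = 0" for y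
  proof (cases "dotp p y y = 0")
    case True
    hence "\<forall>i<p. y i = 0" by (simp add: dotp_self_eq_0)
    hence "q y = 0" by (simp add: q_def dotp_def)
    thus ?thesis using True by simp
  next
    case False
    obtain s where s: "s > 0" "(\<lambda>i. if i < p then s * y i else 0) \<in> K" "s\<^sup>2 * dotp p y y = 1"
      using normalise[OF False y] by blast
    have "q (\<lambda>i. if i < p then s * y i else 0) = q (\<lambda>i. s * y i)"
      unfolding q_def Ax_def by (auto intro!: dotp_cong)
    also have "\<dots> = s\<^sup>2 * q y" by (simp add: q_def Ax_def dotp_linear power2_eq_square)
    finally have "s\<^sup>2 * q y \<le> s\<^sup>2 * (q x * dotp p y y)"
      using x(2)[OF s(2)] s(3) by (simp add: algebra_simps)
    thus ?thesis using s(1) by simp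
  qed
  have qexp: "q (\<lambda>i. x i + t * d i) = q x + 2 * t * dotp p d (Ax x) + t\<^sup>2 * q d" for t
  proof -
    have "Ax (\<lambda>i. x i + t * d i) = (\<lambda>i. Ax x i + t * Ax d i)"
      by (simp add: Ax_def dotp_linear)
    moreover have "dotp p x (Ax d) = dotp p d (Ax x)"
      by (metis adj dotp_commute)
    ultimately show ?thesis by (simp add: q_def dotp_linear algebra_simps power2_eq_square)
  qed
  have ineq: "2 * t * dotp p d d \<le> t\<^sup>2 * (q x * dotp p d d - q d)" for t
  proof -
    have "q (\<lambda>i. x i + t * d i) \<le> q x * dotp p (\<lambda>i. x i + t * d i) (\<lambda>i. x i + t * d i)"
      by (rule psd) (simp add: dotp_linear xK dW)
    also have "dotp p (\<lambda>i. x i + t * d i) (\<lambda>i. x i + t * d i) = 1 + 2 * t * dotp p x d + t\<^sup>2 * dotp p d d"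
      using dotp_commute[of p d x] by (simp add: dotp_linear xK algebra_simps power2_eq_square)
    finally have "2 * t * (dotp p d (Ax x) - q x * dotp p d x) \<le> t\<^sup>2 * (q x * dotp p d d - q d)"
      unfolding qexp using dotp_commute[of p d x] by (simp add: algebra_simps)
    moreover have "dotp p d (Ax x) - q x * dotp p d x = dotp p d d"
      by (subst (4) d_def) (simp add: dotp_linear)
    ultimately show ?thesis by simp
  qed
  have "dotp p d d = 0"
  proof (rule ccontr)
    assume "dotp p d d \<noteq> 0"
    hence pos: "dotp p d d > 0" using dotp_self_nonneg[of p d] by simp
    define c where "c = q x * dotp p d d - q d"
    define t where "t = dotp p d d / (\<bar>c\<bar> + 1)"
    have t: "t > 0" using pos by (simp add: t_def add_nonneg_pos)
    have "t * (2 * dotp p d d) \<le> t * (t * c)" using ineq[of t] by (simp add: c_def power2_eq_square mult_ac)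
    hence "2 * dotp p d d \<le> t * c" using t by simp
    also have "\<dots> \<le> t * (\<bar>c\<bar> + 1)" using t by (intro mult_left_mono) auto
    also have "\<dots> = dotp p d d" by (simp add: t_def)
    finally show False using pos by simp
  qed
  hence "\<forall>i<p. dotp p (A i) x = q x * x i" by (auto simp: dotp_self_eq_0 d_def Ax_def)
  thus ?thesis using xK by blast
qed

text \<open>Summing Bessel's identity over the standard basis shows that \<open>k\<close> orthonormal vectors leave a
  total defect \<open>p - k\<close>; so there is room for another eigenvector while \<open>k < p\<close>, and \<open>p\<close> of them
  resolve the identity.\<close>

lemma bessel_residual:
  fixes k :: nat
  assumes on: "\<And>i j. i < k \<Longrightarrow> j < k \<Longrightarrow> dotp p (w i) (w j) = (if i = j then 1 else 0)" and a: "a < p"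
  defines "r \<equiv> (\<lambda>b. (if b = a then 1 else 0) - (\<Sum>i<k. w i a * w i b))"
  shows "dotp p r r = 1 - (\<Sum>i<k. (w i a)\<^sup>2)" and "\<And>j. j < k \<Longrightarrow> dotp p (w j) r = 0"
proof -
  have e: "dotp p c (\<lambda>b. if b = a then 1 else 0) = c a" for c
    using a by (simp add: dotp_def if_distrib[of "\<lambda>x. _ * x"] cong: if_cong)
  have wr: "dotp p (w j) r = 0" if j: "j < k" for j
  proof -
    have "dotp p (w j) r = w j a - (\<Sum>i<k. w i a * dotp p (w j) (w i))"
      by (simp add: r_def dotp_diff_right e dotp_sum_right dotp_scale_right)
    also have "(\<Sum>i<k. w i a * dotp p (w j) (w i)) = (\<Sum>i<k. if i = j then w j a else 0)"
      by (intro sum.cong refl) (use on j in auto)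
    also have "\<dots> = w j a" using j by (subst sum.delta) auto
    finally show ?thesis by simp
  qed
  thus "\<And>j. j < k \<Longrightarrow> dotp p (w j) r = 0" .
  have "dotp p r r = r a - (\<Sum>i<k. w i a * dotp p (w i) r)"
    by (subst r_def) (simp add: dotp_diff_left dotp_commute[of p "\<lambda>b. if b = a then 1 else 0"] e dotp_sum_left dotp_scale_left)
  hence "dotp p r r = r a" by (simp add: wr)
  thus "dotp p r r = 1 - (\<Sum>i<k. (w i a)\<^sup>2)" by (simp add: r_def power2_eq_square)
qed

lemma sum_orthonormal_squares:
  fixes k :: nat
  assumes on: "\<And>i j. i < k \<Longrightarrow> j < k \<Longrightarrow> dotp p (w i) (w j) = (if i = j then 1 else (0::real))"
  shows "(\<Sum>a<p. 1 - (\<Sum>i<k. (w i a)\<^sup>2)) = real p - real k"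
proof -
  have "(\<Sum>a<p. \<Sum>i<k. (w i a)\<^sup>2) = (\<Sum>i<k. dotp p (w i) (w i))"
    by (subst sum.swap) (simp add: dotp_def power2_eq_square)
  thus ?thesis using on by (simp add: sum_subtractf)
qed

text \<open>Eigenvectors are added one at a time, each orthogonal to the previous ones. The last conclusion,
  that an orthonormal basis of eigenvectors resolves the identity, is what turns spectral data back into
  matrix entries.\<close>

lemma spectral_theorem:
  fixes A :: "nat \<Rightarrow> nat \<Rightarrow> real"
  assumes sym: "\<And>i j. i < p \<Longrightarrow> j < p \<Longrightarrow> A i j = A j i"
  shows "\<exists>w l. (\<forall>i<p. \<forall>j<p. dotp p (w i) (w j) = (if i = j then 1 else 0)) \<and>
    (\<forall>i<p. \<forall>a<p. dotp p (A a) (w i) = l i * w i a) \<and>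
    (\<forall>a<p. \<forall>b<p. (\<Sum>i<p. w i a * w i b) = (if a = b then 1 else 0))"
proof -
  have "\<exists>w l. (\<forall>i<k. \<forall>j<k. dotp p (w i) (w j) = (if i = j then 1 else 0)) \<and>
          (\<forall>i<k. \<forall>a<p. dotp p (A a) (w i) = l i * w i a)" if "k \<le> p" for k
    using that
  proof (induction k)
    case (Suc k)
    then obtain w l where on: "\<And>i j. i < k \<Longrightarrow> j < k \<Longrightarrow> dotp p (w i) (w j) = (if i = j then 1 else 0)"
      and ev: "\<And>i a. i < k \<Longrightarrow> a < p \<Longrightarrow> dotp p (A a) (w i) = l i * w i a" by fastforce
    have "\<exists>a<p. 1 - (\<Sum>i<k. (w i a)\<^sup>2) \<noteq> 0"
    proof (rule ccontr)
      assume "\<not> ?thesis"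
      hence "(\<Sum>a<p. 1 - (\<Sum>i<k. (w i a)\<^sup>2)) = 0" by simp
      thus False using sum_orthonormal_squares[OF on] Suc.prems by simp
    qed
    then obtain a where a: "a < p" "1 - (\<Sum>i<k. (w i a)\<^sup>2) \<noteq> 0" by blast
    have "\<exists>x. dotp p x x \<noteq> 0 \<and> (\<forall>v\<in>w ` {..<k}. dotp p v x = 0)"
      using bessel_residual[OF on a(1)] a(2) by (intro exI conjI) auto
    hence "\<exists>x m. dotp p x x = 1 \<and> (\<forall>v\<in>w ` {..<k}. dotp p v x = 0) \<and> (\<forall>i<p. dotp p (A i) x = m * x i)"
    proof (rule eigenvector_in_complement[where W = "w ` {..<k}" and A = A, rotated 2])
      show "\<exists>m. \<forall>i<p. dotp p (A i) v = m * v i" if "v \<in> w ` {..<k}" for v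
        using ev that by auto
    qed (rule sym)
    then obtain x m where
      X: "dotp p x x = 1" "\<forall>v\<in>w ` {..<k}. dotp p v x = 0" "\<forall>i<p. dotp p (A i) x = m * x i"
      by (elim exE conjE)
    have x: "dotp p x x = 1" "\<And>i. i < k \<Longrightarrow> dotp p (w i) x = 0" "\<And>i. i < p \<Longrightarrow> dotp p (A i) x = m * x i"
      using X by auto
    have x2: "dotp p x (w i) = 0" if "i < k" for i using x(2)[OF that] by (simp add: dotp_commute)
    show ?case
      by (intro exI[of _ "w(k := x)"] exI[of _ "l(k := m)"]) (auto simp: less_Suc_eq on ev x x2)
  qed simp
  from this[of p] obtain w l where on: "\<And>i j. i < p \<Longrightarrow> j < p \<Longrightarrow> dotp p (w i) (w j) = (if i = j then 1 else 0)"
    and ev: "\<And>i a. i < p \<Longrightarrow> a < p \<Longrightarrow> dotp p (A a) (w i) = l i * w i a" by fastforce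
  have nn: "0 \<le> 1 - (\<Sum>i<p. (w i a)\<^sup>2)" if "a < p" for a
    by (subst bessel_residual(1)[where w = w, OF on that, symmetric]) (auto intro: dotp_self_nonneg)
  have full: "1 - (\<Sum>i<p. (w i a)\<^sup>2) = 0" if "a < p" for a
    using sum_nonneg_eq_0_iff[of "{..<p}" "\<lambda>a. 1 - (\<Sum>i<p. (w i a)\<^sup>2)"] nn sum_orthonormal_squares[OF on] that
    by auto
  have res: "(\<Sum>i<p. w i a * w i b) = (if a = b then 1 else 0)" if "a < p" "b < p" for a b
  proof -
    have "dotp p (\<lambda>c. (if c = a then 1 else 0) - (\<Sum>i<p. w i a * w i c))
        (\<lambda>c. (if c = a then 1 else 0) - (\<Sum>i<p. w i a * w i c)) = 0"
      by (subst bessel_residual(1)) (use that on full in auto)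
    thus ?thesis using that by (auto simp: dotp_self_eq_0)
  qed
  show ?thesis by (intro exI[of _ w] exI[of _ l] conjI allI impI on ev res)
qed

lemma dotp_scalar_prod: "u \<in> carrier_vec p \<Longrightarrow> v \<in> carrier_vec p \<Longrightarrow> u \<bullet> v = dotp p (($) u) (($) v)"
  by (auto simp: scalar_prod_def dotp_def atLeast0LessThan)

text \<open>In an orthonormal eigenbasis \<open>w\<^sub>i\<close> with eigenvalues \<open>l\<^sub>i\<close>, a square root is
  \<open>\<Sum>\<^sub>i \<surd>l\<^sub>i w\<^sub>i w\<^sub>i\<^sup>T\<close>; its definiteness follows from \<open>l\<^sub>i > 0\<close> and the resolution of the identity.\<close>

lemma pos_def_mat_sqrt_exists:
  assumes "pos_def_mat p A"
  shows "\<exists>B. pos_def_mat p B \<and> B * B = A"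
proof -
  have A: "A \<in> carrier_mat p p" "transpose_mat A = A"
    "\<And>u. u \<in> carrier_vec p \<Longrightarrow> u \<noteq> 0\<^sub>v p \<Longrightarrow> 0 < u \<bullet> (A *\<^sub>v u)" using assms by (auto simp: pos_def_mat_def)
  define a where "a = (\<lambda>i j. A $$ (i,j))"
  have sym: "a i j = a j i" if "i < p" "j < p" for i j
    using A(1,2) that by (metis a_def carrier_matD index_transpose_mat(1))
  have "\<exists>w l. (\<forall>i<p. \<forall>j<p. dotp p (w i) (w j) = (if i = j then 1 else 0)) \<and>
    (\<forall>i<p. \<forall>b<p. dotp p (a b) (w i) = l i * w i b) \<and>
    (\<forall>b<p. \<forall>c<p. (\<Sum>i<p. w i b * w i c) = (if b = c then 1 else 0))"
    by (rule spectral_theorem) (rule sym)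
  then obtain w l where
    S: "\<forall>i<p. \<forall>j<p. dotp p (w i) (w j) = (if i = j then 1 else 0)"
       "\<forall>i<p. \<forall>b<p. dotp p (a b) (w i) = l i * w i b"
       "\<forall>b<p. \<forall>c<p. (\<Sum>i<p. w i b * w i c) = (if b = c then 1 else 0)"
    by (elim exE conjE)
  have on: "dotp p (w i) (w j) = (if i = j then 1 else 0)" if "i < p" "j < p" for i j
    using S(1) that by blast
  have ev: "dotp p (a b) (w i) = l i * w i b" if "i < p" "b < p" for i b
    using S(2) that by blast
  have res: "(\<Sum>i<p. w i b * w i c) = (if b = c then 1 else 0)" if "b < p" "c < p" for b c
    using S(3) that by blast
  have mv: "(A *\<^sub>v vec p f) $ i = dotp p (a i) f" if "i < p" for f i
    using A(1) that by (auto simp: scalar_prod_def dotp_def a_def atLeast0LessThan)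
  have lpos: "l i > 0" if i: "i < p" for i
  proof -
    have nz: "vec p (w i) \<noteq> 0\<^sub>v p"
    proof
      assume "vec p (w i) = 0\<^sub>v p"
      hence "\<forall>j<p. w i j = 0" by (metis index_vec index_zero_vec(1))
      thus False using on[OF i i] dotp_self_eq_0[of p "w i"] by auto
    qed
    have "vec p (w i) \<bullet> (A *\<^sub>v vec p (w i)) = dotp p (w i) (\<lambda>b. dotp p (a b) (w i))"
      using A(1) by (subst dotp_scalar_prod[of _ p]) (auto intro!: dotp_cong simp: mv simp del: index_mult_mat_vec)
    also have "\<dots> = dotp p (w i) (\<lambda>b. l i * w i b)" by (intro dotp_cong) (auto simp: ev i)
    also have "\<dots> = l i" using on[OF i i] by (simp add: dotp_linear)
    finally show ?thesis using A(3)[OF _ nz] by simp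
  qed
  define b where "b = (\<lambda>x y. \<Sum>i<p. sqrt (l i) * w i x * w i y)"
  define B where "B = mat p p (\<lambda>(x,y). b x y)"
  have Bc: "B \<in> carrier_mat p p" by (simp add: B_def)
  have "B * B = A"
  proof (rule eq_matI)
    fix x y assume "x < dim_row A" "y < dim_col A"
    hence xy: "x < p" "y < p" using A(1) by auto
    have "(B * B) $$ (x, y) = dotp p (b x) (\<lambda>z. b z y)"
      using xy by (auto simp: B_def scalar_prod_def dotp_def atLeast0LessThan)
    also have "\<dots> = (\<Sum>i<p. \<Sum>j<p. sqrt (l i) * w i x * (sqrt (l j) * w j y * dotp p (w i) (w j)))"
      unfolding b_def by (simp add: dotp_sum_left dotp_sum_right dotp_scale_left dotp_scale_right
         mult.commute[of "sqrt _ * w _ _" "w _ y"] mult.assoc[symmetric])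
        (simp add: dotp_linear mult_ac)
    also have "\<dots> = (\<Sum>i<p. \<Sum>j<p. if j = i then l i * w i x * w i y else 0)"
      by (intro sum.cong refl) (use on lpos in \<open>auto simp: less_imp_le mult_ac\<close>)
    also have "\<dots> = (\<Sum>i<p. (l i * w i x) * w i y)" by simp
    also have "\<dots> = (\<Sum>i<p. dotp p (a x) (w i) * w i y)" using ev xy by simp
    also have "\<dots> = (\<Sum>z<p. a x z * (\<Sum>i<p. w i z * w i y))"
      unfolding dotp_def sum_distrib_right sum_distrib_left by (subst sum.swap) (simp add: mult.assoc)
    also have "\<dots> = (\<Sum>z<p. if z = y then a x z else 0)"
      by (intro sum.cong refl) (use res xy in auto)
    also have "\<dots> = a x y" using xy by simp
    finally show "(B * B) $$ (x, y) = A $$ (x, y)" by (simp add: a_def)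
  qed (use A(1) in \<open>auto simp: B_def\<close>)
  moreover have "pos_def_mat p B"
    unfolding pos_def_mat_def
  proof (intro conjI ballI impI Bc)
    show "transpose_mat B = B" by (rule eq_matI) (auto simp: B_def b_def mult_ac)
    fix u :: "real Matrix.vec" assume u: "u \<in> carrier_vec p" "u \<noteq> 0\<^sub>v p"
    let ?u = "($) u"
    have Bu: "(B *\<^sub>v u) $ x = (\<Sum>i<p. sqrt (l i) * dotp p (w i) ?u * w i x)" if "x < p" for x
    proof -
      have "(B *\<^sub>v u) $ x = dotp p (b x) ?u"
        using that u by (auto simp: B_def scalar_prod_def dotp_def atLeast0LessThan)
      also have "\<dots> = (\<Sum>i<p. sqrt (l i) * w i x * dotp p (w i) ?u)"
        unfolding b_def by (simp only: dotp_sum_left dotp_scale_left)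
      finally show ?thesis by (simp add: mult_ac)
    qed
    have "u \<bullet> (B *\<^sub>v u) = dotp p ?u (\<lambda>x. \<Sum>i<p. sqrt (l i) * dotp p (w i) ?u * w i x)"
      using u Bc by (subst dotp_scalar_prod[of _ p]) (auto intro!: dotp_cong simp: Bu simp del: index_mult_mat_vec)
    also have "\<dots> = (\<Sum>i<p. sqrt (l i) * (dotp p (w i) ?u)\<^sup>2)"
      by (simp add: dotp_sum_right dotp_scale_right dotp_commute[of p ?u] power2_eq_square mult.assoc)
    finally have quad: "u \<bullet> (B *\<^sub>v u) = (\<Sum>i<p. sqrt (l i) * (dotp p (w i) ?u)\<^sup>2)" .
    have "\<exists>i<p. dotp p (w i) ?u \<noteq> 0"
    proof (rule ccontr)
      assume "\<not> ?thesis"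
      hence z: "dotp p (w i) ?u = 0" if "i < p" for i using that by blast
      have "?u x = 0" if x: "x < p" for x
      proof -
        have "?u x = (\<Sum>z<p. (if x = z then 1 else 0) * ?u z)" using x by (simp add: if_distrib[of "\<lambda>t. t * _"] cong: if_cong)
        also have "\<dots> = (\<Sum>z<p. (\<Sum>i<p. w i x * w i z) * ?u z)" using res x by (intro sum.cong refl) auto
        also have "\<dots> = (\<Sum>i<p. w i x * dotp p (w i) ?u)"
          unfolding dotp_def sum_distrib_right sum_distrib_left by (subst sum.swap) (simp add: mult.assoc)
        finally show ?thesis using z by simp
      qed
      thus False using u by auto
    qed
    then obtain i where i: "i < p" "dotp p (w i) ?u \<noteq> 0" by blast
    show "0 < u \<bullet> (B *\<^sub>v u)" unfolding quad
    proof (rule sum_pos2[of _ i])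
      show "0 < sqrt (l i) * (dotp p (w i) ?u)\<^sup>2" using i lpos[of i] by simp
      show "0 \<le> sqrt (l j) * (dotp p (w j) ?u)\<^sup>2" if "j \<in> {..<p}" for j
        using lpos[of j] that by simp
    qed (use i in auto)
  qed
  ultimately show ?thesis by blast
qed

lemma mat_sqrt_pos_def:
  assumes "pos_def_mat p A"
  shows "pos_def_mat p (mat_sqrt A)"
proof -
  have "dim_row A = p" using assms by (auto simp: pos_def_mat_def)
  thus ?thesis
    using someI_ex[OF pos_def_mat_sqrt_exists[OF assms]] by (simp add: mat_sqrt_def)
qed

section \<open>The standard normal distribution\<close>

lemma prob_space_std_normal: "prob_space std_normal_distribution"
  by (rule prob_space_normal_density) simp

lemma std_normal_uminus: "distr std_normal_distribution borel uminus = std_normal_distribution"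
proof (rule measure_eqI)
  fix A assume "A \<in> sets (distr std_normal_distribution borel uminus)"
  hence A[measurable]: "A \<in> sets borel" by simp
  have "emeasure (distr std_normal_distribution borel uminus) A =
      (\<integral>\<^sup>+x. indicator A x \<partial>distr std_normal_distribution borel uminus)" by simp
  also have "\<dots> = (\<integral>\<^sup>+x. indicator A (- x) \<partial>std_normal_distribution)" by (rule nn_integral_distr) auto
  also have "\<dots> = (\<integral>\<^sup>+x. ennreal (std_normal_density x) * indicator A (- x) \<partial>lborel)"
    by (subst nn_integral_density) auto
  also have "\<dots> = (\<integral>\<^sup>+x. ennreal (std_normal_density x) * indicator A x \<partial>lborel)"
    by (subst nn_integral_real_affine[where c = "-1" and t = 0]) (auto simp: std_normal_density_def)
  also have "\<dots> = emeasure std_normal_distribution A"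
    by (simp add: emeasure_density)
  finally show "emeasure (distr std_normal_distribution borel uminus) A = emeasure std_normal_distribution A" .
qed simp

text \<open>Almost-sure statements hold somewhere on every ray, since the density is positive.\<close>

lemma std_normal_AE_ray:
  assumes ae: "AE z in std_normal_distribution. Q z"
  shows "\<exists>z\<ge>c. Q z" and "\<exists>z\<le>c. Q z"
proof -
  have ae': "AE z in lborel. Q z"
    using ae by (subst (asm) AE_density) (auto simp: normal_density_pos)
  have key: "\<exists>z\<in>{a..a+1}. Q z" for a :: real
  proof (rule ccontr)
    assume neg: "\<not> ?thesis"
    have "AE z in lborel. z \<notin> {a..a+1}" using ae' by eventually_elim (use neg in auto)
    hence "emeasure lborel {a..a+1} = 0" by (subst (asm) AE_iff_measurable[of "{a..a+1}"]) auto
    thus False by simp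
  qed
  show "\<exists>z\<ge>c. Q z" using key[of c] by auto
  show "\<exists>z\<le>c. Q z" using key[of "c - 1"] by auto
qed

section \<open>Finite products of probability spaces\<close>

lemma product_prob_space_const: "prob_space M \<Longrightarrow> product_prob_space (\<lambda>_. M)"
  by (rule product_prob_spaceI)

lemma distr_PiM_componentwise:
  assumes I: "finite I" and M: "\<And>i. prob_space (M i)"
    and f: "\<And>i. i \<in> I \<Longrightarrow> f i \<in> measurable (M i) (M' i)"
  shows "distr (PiM I M) (PiM I M') (\<lambda>\<omega>. \<lambda>i\<in>I. f i (\<omega> i)) = PiM I (\<lambda>i. distr (M i) (M' i) (f i))"
proof -
  interpret M: product_prob_space M by (rule product_prob_spaceI) (rule M)
  define N where "N = (\<lambda>i. if i \<in> I then distr (M i) (M' i) (f i) else return (count_space UNIV) undefined)"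
  have N: "prob_space (N i)" for i
    using M f by (auto simp: N_def intro!: prob_space.prob_space_distr prob_space_return)
  interpret N: product_prob_space N by (rule product_prob_spaceI) (rule N)
  note f[measurable]
  have "distr (PiM I M) (PiM I M') (\<lambda>\<omega>. \<lambda>i\<in>I. f i (\<omega> i)) = PiM I N"
  proof (rule N.PiM_eqI[OF I])
    show "sets (distr (PiM I M) (PiM I M') (\<lambda>\<omega>. \<lambda>i\<in>I. f i (\<omega> i))) = sets (PiM I N)"
      by (simp add: N_def cong: sets_PiM_cong)
    fix A assume A: "\<And>i. i \<in> I \<Longrightarrow> A i \<in> sets (N i)"
    have A': "A i \<in> sets (M' i)" if "i \<in> I" for i using A[OF that] that by (simp add: N_def)
    have "emeasure (distr (PiM I M) (PiM I M') (\<lambda>\<omega>. \<lambda>i\<in>I. f i (\<omega> i))) (PiE I A) =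
        emeasure (PiM I M) ((\<lambda>\<omega>. \<lambda>i\<in>I. f i (\<omega> i)) -` PiE I A \<inter> space (PiM I M))"
      using A' I by (intro emeasure_distr) (auto intro!: sets_PiM_I_finite)
    also have "(\<lambda>\<omega>. \<lambda>i\<in>I. f i (\<omega> i)) -` PiE I A \<inter> space (PiM I M) = PiE I (\<lambda>i. f i -` A i \<inter> space (M i))"
      by (auto simp: space_PiM PiE_iff)
    also have "emeasure (PiM I M) \<dots> = (\<Prod>i\<in>I. emeasure (M i) (f i -` A i \<inter> space (M i)))"
      using A' f I by (intro M.emeasure_PiM) auto
    also have "\<dots> = (\<Prod>i\<in>I. emeasure (N i) (A i))"
      using A' f by (intro prod.cong refl) (simp add: N_def emeasure_distr)
    finally show "emeasure (distr (PiM I M) (PiM I M') (\<lambda>\<omega>. \<lambda>i\<in>I. f i (\<omega> i))) (PiE I A) =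
      (\<Prod>i\<in>I. emeasure (N i) (A i))" .
  qed
  also have "PiM I N = PiM I (\<lambda>i. distr (M i) (M' i) (f i))"
    by (intro PiM_cong) (auto simp: N_def)
  finally show ?thesis .
qed

text \<open>Sampling rows \<open>(a\<^sub>i, b\<^sub>i)\<close> independently with independent entries is the same as sampling the
  family \<open>a\<close> and the family \<open>b\<close> independently.\<close>

lemma distr_zip_PiM:
  fixes A :: "'a measure" and B :: "'b measure"
  assumes I: "finite I" and "prob_space A" "prob_space B"
  shows "distr (PiM I (\<lambda>_. A) \<Otimes>\<^sub>M PiM I (\<lambda>_. B)) (PiM I (\<lambda>_. A \<Otimes>\<^sub>M B))
           (\<lambda>\<omega>. \<lambda>i\<in>I. (fst \<omega> i, snd \<omega> i)) = PiM I (\<lambda>_. A \<Otimes>\<^sub>M B)"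
    (is "distr ?P _ ?f = _")
proof -
  interpret A: product_prob_space "\<lambda>_. A" by (intro product_prob_space_const assms)
  interpret B: product_prob_space "\<lambda>_. B" by (intro product_prob_space_const assms)
  interpret AI: prob_space "PiM I (\<lambda>_. A)" by (intro prob_space_PiM assms)
  interpret BI: prob_space "PiM I (\<lambda>_. B)" by (intro prob_space_PiM assms)
  interpret a: prob_space A by fact
  interpret b: prob_space B by fact
  interpret ab: pair_prob_space A B by standard
  interpret AB: product_prob_space "\<lambda>_. A \<Otimes>\<^sub>M B" by (intro product_prob_space_const ab.prob_space_axioms)
  have [measurable]: "(\<lambda>\<omega>. \<lambda>i\<in>I. (fst \<omega> i, snd \<omega> i)) \<in> measurable ?P (PiM I (\<lambda>_. A \<Otimes>\<^sub>M B))"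
    by measurable
  show ?thesis
  proof (rule AB.PiM_eqI[OF I])
    fix E assume E: "\<And>i. i \<in> I \<Longrightarrow> E i \<in> sets (A \<Otimes>\<^sub>M B)"
    define g where "g = (\<lambda>i x y. indicator (E i) (x, y) :: ennreal)"
    have g[measurable]: "(\<lambda>w. g i (fst w) (snd w)) \<in> borel_measurable (A \<Otimes>\<^sub>M B)" if "i \<in> I" for i
      using E[OF that] unfolding g_def by simp
    have gb: "g i x \<in> borel_measurable B" if "i \<in> I" "x \<in> space A" for i x
      using measurable_compose[OF measurable_Pair1'[OF that(2)] g[OF that(1)]] by simp
    have gP: "(\<lambda>\<omega>. \<Prod>i\<in>I. g i (fst \<omega> i) (snd \<omega> i)) \<in> borel_measurable ?P"
    proof (rule borel_measurable_prod_ennreal)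
      fix i assume i: "i \<in> I"
      have "(\<lambda>\<omega>. (fst \<omega> i, snd \<omega> i)) \<in> measurable ?P (A \<Otimes>\<^sub>M B)" using i by measurable
      from measurable_compose[OF this g[OF i]]
      show "(\<lambda>\<omega>. g i (fst \<omega> i) (snd \<omega> i)) \<in> borel_measurable ?P" by simp
    qed
    have EI: "PiE I E \<in> sets (PiM I (\<lambda>_. A \<Otimes>\<^sub>M B))" using E I by (intro sets_PiM_I_finite) auto
    have "emeasure (distr ?P (PiM I (\<lambda>_. A \<Otimes>\<^sub>M B)) ?f) (PiE I E) =
        (\<integral>\<^sup>+\<omega>. indicator (PiE I E) \<omega> \<partial>distr ?P (PiM I (\<lambda>_. A \<Otimes>\<^sub>M B)) ?f)"
      using EI by simp
    also have "\<dots> = (\<integral>\<^sup>+\<omega>. indicator (PiE I E) (?f \<omega>) \<partial>?P)"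
      using EI by (intro nn_integral_distr) auto
    also have "\<dots> = (\<integral>\<^sup>+\<omega>. (\<Prod>i\<in>I. g i (fst \<omega> i) (snd \<omega> i)) \<partial>?P)"
    proof (rule nn_integral_cong)
      fix \<omega>
      show "indicator (PiE I E) (?f \<omega>) = (\<Prod>i\<in>I. g i (fst \<omega> i) (snd \<omega> i))"
        using I by (auto simp: g_def indicator_def PiE_iff prod_eq_1_iff intro!: prod_zero)
    qed
    also have "\<dots> = (\<integral>\<^sup>+a. \<integral>\<^sup>+b. (\<Prod>i\<in>I. g i (a i) (b i)) \<partial>PiM I (\<lambda>_. B) \<partial>PiM I (\<lambda>_. A))"
      using sigma_finite_measure.nn_integral_fst[OF prob_space_imp_sigma_finite[OF prob_space_PiM] gP] assms
      by simp
    also have "\<dots> = (\<integral>\<^sup>+a. (\<Prod>i\<in>I. \<integral>\<^sup>+y. g i (a i) y \<partial>B) \<partial>PiM I (\<lambda>_. A))"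
      using I gb by (intro nn_integral_cong B.product_nn_integral_prod) (auto simp: space_PiM)
    also have "\<dots> = (\<Prod>i\<in>I. \<integral>\<^sup>+x. \<integral>\<^sup>+y. g i x y \<partial>B \<partial>A)"
      using I g by (intro A.product_nn_integral_prod sigma_finite_measure.borel_measurable_nn_integral_fst
          [OF prob_space_imp_sigma_finite[OF \<open>prob_space B\<close>]]) auto
    also have "\<dots> = (\<Prod>i\<in>I. emeasure (A \<Otimes>\<^sub>M B) (E i))"
      using E by (intro prod.cong refl)
        (simp add: g_def sigma_finite_measure.emeasure_pair_measure[OF prob_space_imp_sigma_finite[OF \<open>prob_space B\<close>]])
    finally show "emeasure (distr ?P (PiM I (\<lambda>_. A \<Otimes>\<^sub>M B)) ?f) (PiE I E) = (\<Prod>i\<in>I. emeasure (A \<Otimes>\<^sub>M B) (E i))" .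
  qed simp
qed

text \<open>Replacing one coordinate of a product sample by an independent copy; this lets the rows of a random
  matrix be exposed one at a time.\<close>

lemma distr_resample_PiM:
  assumes I: "finite I" "i \<in> I" and \<rho>: "prob_space \<rho>"
  shows "distr (PiM I (\<lambda>_. \<rho>) \<Otimes>\<^sub>M \<rho>) (PiM I (\<lambda>_. \<rho>)) (\<lambda>x. (fst x)(i := snd x)) = PiM I (\<lambda>_. \<rho>)"
    (is "distr ?P _ ?f = _")
proof -
  interpret R: product_prob_space "\<lambda>_. \<rho>" by (intro product_prob_space_const assms)
  interpret r: prob_space \<rho> by fact
  interpret RI: prob_space "PiM I (\<lambda>_. \<rho>)" by (intro prob_space_PiM assms)
  have [measurable]: "?f \<in> measurable ?P (PiM I (\<lambda>_. \<rho>))"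
  proof (rule measurable_PiM_single')
    fix j assume "j \<in> I"
    thus "(\<lambda>x. (?f x) j) \<in> measurable ?P \<rho>" by (cases "j = i") (auto intro: measurable_compose[OF measurable_fst])
  qed (use I in \<open>auto simp: space_pair_measure space_PiM PiE_iff extensional_def\<close>)
  show ?thesis
  proof (rule R.PiM_eqI[OF I(1)])
    fix A assume A: "\<And>j. j \<in> I \<Longrightarrow> A j \<in> sets \<rho>"
    define A' where "A' = A(i := space \<rho>)"
    have A': "A' j \<in> sets \<rho>" if "j \<in> I" for j using A that by (auto simp: A'_def)
    have "emeasure (distr ?P (PiM I (\<lambda>_. \<rho>)) ?f) (PiE I A) = emeasure ?P (?f -` PiE I A \<inter> space ?P)"
      using A I by (intro emeasure_distr sets_PiM_I_finite) auto
    also have "?f -` PiE I A \<inter> space ?P = PiE I A' \<times> A i"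
    proof (rule Set.set_eqI)
      fix x
      have "A j \<subseteq> space \<rho>" if "j \<in> I" for j using A[OF that] sets.sets_into_space by blast
      thus "x \<in> ?f -` PiE I A \<inter> space ?P \<longleftrightarrow> x \<in> PiE I A' \<times> A i"
        using I(2) by (cases x) (auto simp: space_pair_measure space_PiM PiE_iff A'_def extensional_def subset_iff split: if_splits)
    qed
    also have "emeasure ?P \<dots> = (\<Prod>j\<in>I. emeasure \<rho> (A' j)) * emeasure \<rho> (A i)"
      using A A' I by (subst sigma_finite_measure.emeasure_pair_measure_Times[OF prob_space_imp_sigma_finite[OF \<rho>]]) (auto intro!: sets_PiM_I_finite simp: R.emeasure_PiM)
    also have "\<dots> = (\<Prod>j\<in>I. emeasure \<rho> (A j))"
      using I by (simp add: prod.remove[of I i] A'_def prob_space.emeasure_space_1[OF \<rho>] mult.commute)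
    finally show "emeasure (distr ?P (PiM I (\<lambda>_. \<rho>)) ?f) (PiE I A) = (\<Prod>j\<in>I. emeasure \<rho> (A j))" .
  qed simp
qed

section \<open>Standard Gaussian vectors\<close>

abbreviation std_gauss :: "nat \<Rightarrow> (nat \<Rightarrow> real) measure" where
  "std_gauss p \<equiv> PiM {..<p} (\<lambda>_. std_normal_distribution)"

lemma sets_std_gauss: "sets (std_gauss p) = sets (borel_vec p)"
  by (intro sets_PiM_cong) auto

lemma prob_space_std_gauss: "prob_space (std_gauss p)"
  by (intro prob_space_PiM prob_space_std_normal)

lemma measurable_dotp [measurable]:
  assumes [measurable]: "\<And>i. i < p \<Longrightarrow> (\<lambda>x. f x i) \<in> borel_measurable M" "\<And>i. i < p \<Longrightarrow> (\<lambda>x. g x i) \<in> borel_measurable M"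
  shows "(\<lambda>x. dotp p (f x) (g x)) \<in> borel_measurable M"
  unfolding dotp_def by measurable

lemma distr_std_normal_shift:
  "distr std_normal_distribution borel (\<lambda>x. x + c) =
   density std_normal_distribution (\<lambda>x. ennreal (exp (c * x - c\<^sup>2 / 2)))"
proof (rule measure_eqI)
  fix A assume "A \<in> sets (distr std_normal_distribution borel (\<lambda>x. x + c))"
  hence A[measurable]: "A \<in> sets borel" by simp
  have "emeasure (distr std_normal_distribution borel (\<lambda>x. x + c)) A
      = (\<integral>\<^sup>+x. indicator A x \<partial>distr std_normal_distribution borel (\<lambda>x. x + c))" by simp
  also have "\<dots> = (\<integral>\<^sup>+x. indicator A (x + c) \<partial>std_normal_distribution)"
    by (rule nn_integral_distr) auto
  also have "\<dots> = (\<integral>\<^sup>+x. ennreal (std_normal_density x) * indicator A (x + c) \<partial>lborel)"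
    by (subst nn_integral_density) auto
  also have "\<dots> = (\<integral>\<^sup>+x. ennreal (std_normal_density (x - c)) * indicator A x \<partial>lborel)"
    by (subst nn_integral_real_affine[where c = 1 and t = "-c"]) auto
  also have "\<dots> = (\<integral>\<^sup>+x. ennreal (std_normal_density x) * (ennreal (exp (c * x - c\<^sup>2 / 2)) * indicator A x) \<partial>lborel)"
  proof (rule nn_integral_cong)
    fix x
    have "std_normal_density (x - c) = std_normal_density x * exp (c * x - c\<^sup>2 / 2)"
      by (simp add: std_normal_density_def exp_add[symmetric] power2_diff field_simps)
    thus "ennreal (std_normal_density (x - c)) * indicator A x =
       ennreal (std_normal_density x) * (ennreal (exp (c * x - c\<^sup>2 / 2)) * indicator A x)"
      by (simp add: ennreal_mult mult.assoc)
  qed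
  also have "\<dots> = emeasure (density std_normal_distribution (\<lambda>x. ennreal (exp (c * x - c\<^sup>2 / 2)))) A"
    by (simp add: emeasure_density nn_integral_density)
  finally show "emeasure (distr std_normal_distribution borel (\<lambda>x. x + c)) A =
    emeasure (density std_normal_distribution (\<lambda>x. ennreal (exp (c * x - c\<^sup>2 / 2)))) A" .
qed simp

lemma nn_integral_std_normal_shift:
  assumes [measurable]: "f \<in> borel_measurable borel"
  shows "(\<integral>\<^sup>+x. f (x + c) \<partial>std_normal_distribution) =
    (\<integral>\<^sup>+x. f x * ennreal (exp (c * x - c\<^sup>2 / 2)) \<partial>std_normal_distribution)"
proof -
  have "(\<integral>\<^sup>+x. f (x + c) \<partial>std_normal_distribution) = (\<integral>\<^sup>+x. f x \<partial>distr std_normal_distribution borel (\<lambda>x. x + c))"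
    by (subst nn_integral_distr) auto
  also have "\<dots> = (\<integral>\<^sup>+x. f x * ennreal (exp (c * x - c\<^sup>2 / 2)) \<partial>std_normal_distribution)"
    unfolding distr_std_normal_shift by (subst nn_integral_density) (auto simp: mult.commute)
  finally show ?thesis .
qed

text \<open>The Cameron--Martin formula in finite dimension.\<close>

lemma distr_std_gauss_shift:
  "distr (std_gauss p) (borel_vec p) (\<lambda>h. \<lambda>i\<in>{..<p}. h i + a i) =
   density (std_gauss p) (\<lambda>h. ennreal (exp (dotp p a h - dotp p a a / 2)))"
proof -
  interpret S: product_prob_space "\<lambda>_::nat. std_normal_distribution"
    by (rule product_prob_space_const[OF prob_space_std_normal])
  define N where "N = (\<lambda>i::nat. distr std_normal_distribution borel (\<lambda>x. x + a i))"
  interpret N: product_prob_space N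
    by (rule product_prob_spaceI) (auto simp: N_def intro!: prob_space.prob_space_distr prob_space_std_normal)
  have "distr (std_gauss p) (borel_vec p) (\<lambda>h. \<lambda>i\<in>{..<p}. h i + a i) = PiM {..<p} N"
    unfolding N_def by (rule distr_PiM_componentwise) (auto intro: prob_space_std_normal)
  moreover have "density (std_gauss p) (\<lambda>h. ennreal (exp (dotp p a h - dotp p a a / 2))) = PiM {..<p} N"
  proof (rule N.PiM_eqI)
    show "sets (density (std_gauss p) (\<lambda>h. ennreal (exp (dotp p a h - dotp p a a / 2)))) = sets (PiM {..<p} N)"
      by (simp add: N_def sets_std_gauss cong: sets_PiM_cong)
    fix A assume "\<And>i. i \<in> {..<p} \<Longrightarrow> A i \<in> sets (N i)"
    hence A: "\<And>i. i < p \<Longrightarrow> A i \<in> sets borel" by (simp add: N_def)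
    have "emeasure (density (std_gauss p) (\<lambda>h. ennreal (exp (dotp p a h - dotp p a a / 2)))) (PiE {..<p} A) =
      (\<integral>\<^sup>+h. ennreal (exp (dotp p a h - dotp p a a / 2)) * indicator (PiE {..<p} A) h \<partial>std_gauss p)"
      using A by (subst emeasure_density) (auto intro!: sets_PiM_I_finite)
    also have "\<dots> = (\<integral>\<^sup>+h. (\<Prod>i<p. ennreal (exp (a i * h i - (a i)\<^sup>2 / 2)) * indicator (A i) (h i)) \<partial>std_gauss p)"
    proof (rule nn_integral_cong)
      fix h assume h: "h \<in> space (std_gauss p)"
      have "dotp p a h - dotp p a a / 2 = (\<Sum>i<p. a i * h i - (a i)\<^sup>2 / 2)"
        by (simp add: dotp_def sum_subtractf sum_divide_distrib power2_eq_square)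
      hence "ennreal (exp (dotp p a h - dotp p a a / 2)) = (\<Prod>i<p. ennreal (exp (a i * h i - (a i)\<^sup>2 / 2)))"
        by (simp add: exp_sum prod_ennreal)
      moreover have "indicator (PiE {..<p} A) h = (\<Prod>i<p. indicator (A i) (h i) :: ennreal)"
        using h by (auto simp: indicator_def PiE_iff space_PiM prod_eq_1_iff intro!: prod_zero)
      ultimately show "ennreal (exp (dotp p a h - dotp p a a / 2)) * indicator (PiE {..<p} A) h =
          (\<Prod>i<p. ennreal (exp (a i * h i - (a i)\<^sup>2 / 2)) * indicator (A i) (h i))"
        by (simp add: prod.distrib)
    qed
    also have "\<dots> = (\<Prod>i<p. \<integral>\<^sup>+x. ennreal (exp (a i * x - (a i)\<^sup>2 / 2)) * indicator (A i) x \<partial>std_normal_distribution)"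
      using A by (intro S.product_nn_integral_prod) auto
    also have "\<dots> = (\<Prod>i<p. emeasure (N i) (A i))"
      using A by (intro prod.cong refl) (simp add: N_def distr_std_normal_shift emeasure_density)
    finally show "emeasure (density (std_gauss p) (\<lambda>h. ennreal (exp (dotp p a h - dotp p a a / 2)))) (PiE {..<p} A) =
      (\<Prod>i<p. emeasure (N i) (A i))" .
  qed simp
  ultimately show ?thesis by simp
qed

lemma nn_integral_std_gauss_shift:
  assumes [measurable]: "F \<in> borel_measurable (borel_vec p)"
  shows "(\<integral>\<^sup>+h. F (\<lambda>i\<in>{..<p}. h i + a i) \<partial>std_gauss p) =
    (\<integral>\<^sup>+h. F h * ennreal (exp (dotp p a h - dotp p a a / 2)) \<partial>std_gauss p)"
proof -
  have [measurable]: "F \<in> borel_measurable (std_gauss p)"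
    using assms by (simp add: measurable_cong_sets[OF sets_std_gauss refl])
  have "(\<integral>\<^sup>+h. F (\<lambda>i\<in>{..<p}. h i + a i) \<partial>std_gauss p) =
    (\<integral>\<^sup>+h. F h \<partial>distr (std_gauss p) (borel_vec p) (\<lambda>h. \<lambda>i\<in>{..<p}. h i + a i))"
    by (subst nn_integral_distr) (auto intro!: measurable_restrict)
  also have "\<dots> = (\<integral>\<^sup>+h. F h * ennreal (exp (dotp p a h - dotp p a a / 2)) \<partial>std_gauss p)"
    unfolding distr_std_gauss_shift by (subst nn_integral_density) (auto simp: mult.commute)
  finally show ?thesis .
qed

text \<open>A standard Gaussian vector splits into independent parts along and across a unit vector:
  replacing its component along \<open>u\<close> by a fresh standard normal variable does not change its law.
  Substituting \<open>z = s + \<langle>u, h\<rangle>\<close> and then \<open>g = h + s u\<close> with the Cameron--Martin formula turns the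
  law of the modified vector into the Gaussian law weighted by
  \<open>\<integral> exp (s \<langle>u, g\<rangle> - \<langle>u, g\<rangle>\<^sup>2 / 2) d\<nu>(s) = 1\<close>.\<close>

definition recombine :: "nat \<Rightarrow> (nat \<Rightarrow> real) \<Rightarrow> real \<Rightarrow> (nat \<Rightarrow> real) \<Rightarrow> nat \<Rightarrow> real" where
  "recombine p u z h = (\<lambda>i\<in>{..<p}. h i - u i * dotp p u h + u i * z)"

lemma measurable_recombine [measurable]:
  assumes [measurable]: "f \<in> borel_measurable M" "g \<in> measurable M (borel_vec p)"
  shows "(\<lambda>x. recombine p u (f x) (g x)) \<in> measurable M (borel_vec p)"
  unfolding recombine_def by measurable

lemma distr_recombine:
  assumes u: "dotp p u u = 1"
  shows "distr (std_normal_distribution \<Otimes>\<^sub>M std_gauss p) (borel_vec p)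
     (\<lambda>x. recombine p u (fst x) (snd x)) = std_gauss p"
proof (rule measure_eqI)
  interpret n: prob_space std_normal_distribution by (rule prob_space_std_normal)
  interpret g: prob_space "std_gauss p" by (rule prob_space_std_gauss)
  interpret ng: pair_prob_space std_normal_distribution "std_gauss p" ..
  let ?\<nu> = std_normal_distribution and ?\<gamma> = "std_gauss p"
  note [measurable_cong] = sets_std_gauss
  fix A assume "A \<in> sets (distr (?\<nu> \<Otimes>\<^sub>M ?\<gamma>) (borel_vec p) (\<lambda>x. recombine p u (fst x) (snd x)))"
  hence A[measurable]: "A \<in> sets (borel_vec p)" by simp
  define F where "F = (indicator A :: (nat \<Rightarrow> real) \<Rightarrow> ennreal)"
  have F[measurable]: "F \<in> borel_measurable (borel_vec p)" by (simp add: F_def)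
  define S where "S = (\<lambda>s h. \<lambda>i\<in>{..<p}. h i + s * u i)"
  have S[measurable]: "(\<lambda>x. S (f x) (g x)) \<in> measurable M (borel_vec p)"
    if [measurable]: "f \<in> borel_measurable M" "g \<in> measurable M (borel_vec p)" for f g and M :: "'b measure"
    unfolding S_def by measurable
  have recS: "recombine p u z h = S (z + - dotp p u h) h" for z h
    by (auto simp: recombine_def S_def algebra_simps fun_eq_iff)
  have FS[measurable]: "(\<lambda>s. F (S s h)) \<in> borel_measurable borel" if "h \<in> space ?\<gamma>" for h
  proof -
    have [measurable]: "(\<lambda>_. h) \<in> measurable borel (borel_vec p)" using that by (simp add: space_PiM)
    have "(\<lambda>s. S s h) \<in> measurable borel (borel_vec p)"
      unfolding S_def by measurable
    from measurable_compose[OF this F] show ?thesis .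
  qed
  have "emeasure (distr (?\<nu> \<Otimes>\<^sub>M ?\<gamma>) (borel_vec p) (\<lambda>x. recombine p u (fst x) (snd x))) A =
     (\<integral>\<^sup>+x. F x \<partial>distr (?\<nu> \<Otimes>\<^sub>M ?\<gamma>) (borel_vec p) (\<lambda>x. recombine p u (fst x) (snd x)))"
    by (simp add: F_def)
  also have "\<dots> = (\<integral>\<^sup>+x. F (recombine p u (fst x) (snd x)) \<partial>(?\<nu> \<Otimes>\<^sub>M ?\<gamma>))"
    by (rule nn_integral_distr) measurable
  also have "\<dots> = (\<integral>\<^sup>+h. \<integral>\<^sup>+z. F (recombine p u z h) \<partial>?\<nu> \<partial>?\<gamma>)"
    by (subst ng.nn_integral_snd[symmetric]) simp_all
  also have "\<dots> = (\<integral>\<^sup>+h. \<integral>\<^sup>+s. F (S s h) * ennreal (exp (- dotp p u h * s - (dotp p u h)\<^sup>2 / 2)) \<partial>?\<nu> \<partial>?\<gamma>)"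
  proof (rule nn_integral_cong)
    fix h assume h: "h \<in> space ?\<gamma>"
    show "(\<integral>\<^sup>+z. F (recombine p u z h) \<partial>?\<nu>) =
       (\<integral>\<^sup>+s. F (S s h) * ennreal (exp (- dotp p u h * s - (dotp p u h)\<^sup>2 / 2)) \<partial>?\<nu>)"
      unfolding recS using nn_integral_std_normal_shift[OF FS[OF h], of "- dotp p u h"] by simp
  qed
  also have "\<dots> = (\<integral>\<^sup>+s. \<integral>\<^sup>+h. F (S s h) * ennreal (exp (- dotp p u h * s - (dotp p u h)\<^sup>2 / 2)) \<partial>?\<gamma> \<partial>?\<nu>)"
    by (rule ng.Fubini') measurable
  also have "\<dots> = (\<integral>\<^sup>+s. \<integral>\<^sup>+g. F g * ennreal (exp (s * dotp p u g - (dotp p u g)\<^sup>2 / 2)) \<partial>?\<gamma> \<partial>?\<nu>)"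
  proof (rule nn_integral_cong)
    fix s
    define H where "H = (\<lambda>g. F g * ennreal (exp (- (dotp p u g - s) * s - (dotp p u g - s)\<^sup>2 / 2)))"
    have H[measurable]: "H \<in> borel_measurable (borel_vec p)" unfolding H_def by measurable
    have uS: "dotp p u (S s h) = dotp p u h + s" for h
    proof -
      have "dotp p u (S s h) = dotp p u (\<lambda>i. h i + s * u i)" by (rule dotp_cong) (auto simp: S_def)
      thus ?thesis by (simp add: dotp_linear u)
    qed
    have "(\<integral>\<^sup>+h. F (S s h) * ennreal (exp (- dotp p u h * s - (dotp p u h)\<^sup>2 / 2)) \<partial>?\<gamma>)
        = (\<integral>\<^sup>+h. H (\<lambda>i\<in>{..<p}. h i + s * u i) \<partial>?\<gamma>)"
    proof (rule nn_integral_cong)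
      fix h
      have "H (S s h) = F (S s h) * ennreal (exp (- dotp p u h * s - (dotp p u h)\<^sup>2 / 2))"
        by (simp add: H_def uS)
      thus "F (S s h) * ennreal (exp (- dotp p u h * s - (dotp p u h)\<^sup>2 / 2)) = H (\<lambda>i\<in>{..<p}. h i + s * u i)"
        by (simp add: S_def)
    qed
    also have "\<dots> = (\<integral>\<^sup>+g. H g * ennreal (exp (dotp p (\<lambda>i. s * u i) g - dotp p (\<lambda>i. s * u i) (\<lambda>i. s * u i) / 2)) \<partial>?\<gamma>)"
      by (rule nn_integral_std_gauss_shift[OF H])
    also have "\<dots> = (\<integral>\<^sup>+g. F g * ennreal (exp (s * dotp p u g - (dotp p u g)\<^sup>2 / 2)) \<partial>?\<gamma>)"
    proof (rule nn_integral_cong)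
      fix g
      have "exp (- (dotp p u g - s) * s - (dotp p u g - s)\<^sup>2 / 2) * exp (s * dotp p u g - s\<^sup>2 / 2) =
          exp (s * dotp p u g - (dotp p u g)\<^sup>2 / 2)"
        unfolding exp_add[symmetric] by (rule arg_cong[of _ _ exp]) (simp add: power2_eq_square field_simps)
      thus "H g * ennreal (exp (dotp p (\<lambda>i. s * u i) g - dotp p (\<lambda>i. s * u i) (\<lambda>i. s * u i) / 2)) =
          F g * ennreal (exp (s * dotp p u g - (dotp p u g)\<^sup>2 / 2))"
        by (simp add: H_def dotp_linear u mult.assoc ennreal_mult[symmetric] power2_eq_square)
    qed
    finally show "(\<integral>\<^sup>+h. F (S s h) * ennreal (exp (- dotp p u h * s - (dotp p u h)\<^sup>2 / 2)) \<partial>?\<gamma>) =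
       (\<integral>\<^sup>+g. F g * ennreal (exp (s * dotp p u g - (dotp p u g)\<^sup>2 / 2)) \<partial>?\<gamma>)" .
  qed
  also have "\<dots> = (\<integral>\<^sup>+g. \<integral>\<^sup>+s. F g * ennreal (exp (s * dotp p u g - (dotp p u g)\<^sup>2 / 2)) \<partial>?\<nu> \<partial>?\<gamma>)"
    by (rule ng.Fubini'[symmetric]) measurable
  also have "\<dots> = (\<integral>\<^sup>+g. F g \<partial>?\<gamma>)"
  proof (rule nn_integral_cong)
    fix g
    define c where "c = dotp p u g"
    have "(\<integral>\<^sup>+s. ennreal (exp (c * s - c\<^sup>2 / 2)) \<partial>?\<nu>) = 1"
      using nn_integral_std_normal_shift[of "\<lambda>_. 1" c] n.emeasure_space_1 by simp
    thus "(\<integral>\<^sup>+s. F g * ennreal (exp (s * dotp p u g - (dotp p u g)\<^sup>2 / 2)) \<partial>?\<nu>) = F g"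
      by (subst nn_integral_cmult) (auto simp: c_def mult.commute)
  qed
  also have "\<dots> = emeasure ?\<gamma> A" by (simp add: F_def)
  finally show "emeasure (distr (?\<nu> \<Otimes>\<^sub>M ?\<gamma>) (borel_vec p) (\<lambda>x. recombine p u (fst x) (snd x))) A = emeasure ?\<gamma> A" .
qed (simp add: sets_std_gauss)

lemma dotp_recombine:
  assumes "dotp p u u = 1"
  shows "dotp p u (recombine p u z h) = z"
proof -
  have "dotp p u (recombine p u z h) = dotp p u (\<lambda>i. h i - dotp p u h * u i + z * u i)"
    by (rule dotp_cong) (auto simp: recombine_def)
  thus ?thesis by (simp add: dotp_linear assms)
qed

text \<open>After rescaling, \<open>c\<close> is a unit vector, and \<open>\<langle>c, h\<rangle>\<close> may be replaced by a fresh normal variable,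
  which has no atom at \<open>0\<close>.\<close>

lemma AE_std_gauss_hyperplane:
  assumes c: "j < p" "c j \<noteq> 0"
  shows "AE h in std_gauss p. dotp p c h \<noteq> 0"
proof -
  interpret n: prob_space std_normal_distribution by (rule prob_space_std_normal)
  interpret g: prob_space "std_gauss p" by (rule prob_space_std_gauss)
  interpret ng: pair_prob_space std_normal_distribution "std_gauss p" ..
  note [measurable_cong] = sets_std_gauss
  define r where "r = sqrt (dotp p c c)"
  have "dotp p c c \<noteq> 0" using c by (auto simp: dotp_self_eq_0)
  hence r: "r > 0" "r\<^sup>2 = dotp p c c" using dotp_self_nonneg[of p c] by (auto simp: r_def)
  define u where "u = (\<lambda>i. (1 / r) * c i)"
  have u: "dotp p u u = 1" unfolding u_def dotp_linear r(2)[symmetric] using r(1) by (simp add: power2_eq_square)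
  have cu: "c = (\<lambda>i. r * u i)" using r by (auto simp: u_def)
  have "AE x in lborel. (x::real) \<noteq> 0" by (rule AE_lborel_singleton)
  hence "AE z in std_normal_distribution. z \<noteq> 0" by (subst AE_density) auto
  hence "AE x in std_normal_distribution \<Otimes>\<^sub>M std_gauss p. fst x \<noteq> 0"
  proof (intro ng.AE_pair_measure)
    show "{x \<in> space (std_normal_distribution \<Otimes>\<^sub>M std_gauss p). fst x \<noteq> 0}
      \<in> sets (std_normal_distribution \<Otimes>\<^sub>M std_gauss p)" by measurable
  qed auto
  hence "AE x in std_normal_distribution \<Otimes>\<^sub>M std_gauss p. dotp p c (recombine p u (fst x) (snd x)) \<noteq> 0"
    using r by (subst cu) (simp add: dotp_linear dotp_recombine[OF u])
  hence "AE h in distr (std_normal_distribution \<Otimes>\<^sub>M std_gauss p) (borel_vec p)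
     (\<lambda>x. recombine p u (fst x) (snd x)). dotp p c h \<noteq> 0"
    by (subst AE_distr_iff) auto
  thus ?thesis unfolding distr_recombine[OF u] .
qed

section \<open>Almost sure nonsingularity of random matrices\<close>

lemma measurable_det:
  assumes "\<And>i j. i < p \<Longrightarrow> j < p \<Longrightarrow> (\<lambda>\<omega>. A \<omega> i j) \<in> borel_measurable M"
  shows "(\<lambda>\<omega>. Determinant.det (mat p p (\<lambda>(i,j). A \<omega> i j)) :: real) \<in> borel_measurable M"
proof -
  have "(\<lambda>\<omega>. \<Sum>q\<in>{q. q permutes {0..<p}}. signof q * (\<Prod>i = 0..<p. A \<omega> i (q i))) \<in> borel_measurable M"
    using assms by (intro borel_measurable_sum borel_measurable_times borel_measurable_prod)
      (auto dest!: permutes_in_image)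
  also have "(\<lambda>\<omega>. \<Sum>q\<in>{q. q permutes {0..<p}}. signof q * (\<Prod>i = 0..<p. A \<omega> i (q i))) =
      (\<lambda>\<omega>. Determinant.det (mat p p (\<lambda>(i,j). A \<omega> i j)))"
  proof
    fix \<omega>
    have "q i < p" if "q permutes {0..<p}" "i < p" for q i
      using permutes_in_image[OF that(1), of i] that(2) by simp
    thus "(\<Sum>q\<in>{q. q permutes {0..<p}}. signof q * (\<Prod>i = 0..<p. A \<omega> i (q i))) =
      Determinant.det (mat p p (\<lambda>(i,j). A \<omega> i j))"
      by (subst det_def'[of _ p]) (auto intro!: sum.cong prod.cong)
  qed
  finally show ?thesis .
qed

text \<open>Rows whose law charges no hyperplane through the origin replace the rows of the identity
  matrix one at a time. By Laplace expansion along the row being replaced, the determinant is a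
  linear functional of the new row; it is nonzero because it did not vanish on the old row.\<close>

lemma AE_det_nonzero:
  fixes V :: "'b \<Rightarrow> nat \<Rightarrow> real" and s :: "nat \<Rightarrow> 'i"
  assumes I: "finite I" and \<rho>: "prob_space \<rho>"
    and V: "\<And>j. j < p \<Longrightarrow> (\<lambda>b. V b j) \<in> borel_measurable \<rho>"
    and hyp: "\<And>c j. j < p \<Longrightarrow> c j \<noteq> 0 \<Longrightarrow> AE b in \<rho>. dotp p c (V b) \<noteq> 0"
    and s: "inj_on s {..<p}" "s ` {..<p} \<subseteq> I"
  shows "AE \<omega> in PiM I (\<lambda>_. \<rho>). Determinant.det (mat p p (\<lambda>(i,j). V (\<omega> (s i)) j)) \<noteq> 0"
proof -
  define D where "D = (\<lambda>k \<omega>. mat p p (\<lambda>(i,j). if i < k then V (\<omega> (s i)) j else if i = j then 1 else (0::real)))"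
  interpret r: prob_space \<rho> by fact
  interpret RI: prob_space "PiM I (\<lambda>_. \<rho>)" by (intro prob_space_PiM \<rho>)
  interpret P: pair_prob_space "PiM I (\<lambda>_. \<rho>)" \<rho> ..
  have sI: "s i \<in> I" if "i < p" for i using s(2) that by auto
  have meas: "(\<lambda>\<omega>. Determinant.det (D k \<omega>)) \<in> borel_measurable (PiM I (\<lambda>_. \<rho>))" for k
    unfolding D_def
  proof (rule measurable_det)
    fix i j assume ij: "i < p" "j < p"
    have "(\<lambda>\<omega>. V (\<omega> (s i)) j) \<in> borel_measurable (PiM I (\<lambda>_. \<rho>))"
      by (rule measurable_compose[OF measurable_component_singleton[OF sI[OF ij(1)]] V[OF ij(2)]])
    thus "(\<lambda>\<omega>. if i < k then V (\<omega> (s i)) j else if i = j then 1 else 0) \<in> borel_measurable (PiM I (\<lambda>_. \<rho>))"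
      by (cases "i < k") auto
  qed
  have "AE \<omega> in PiM I (\<lambda>_. \<rho>). Determinant.det (D k \<omega>) \<noteq> 0" if "k \<le> p" for k
    using that
  proof (induction k)
    case 0
    have "D 0 \<omega> = 1\<^sub>m p" for \<omega> by (rule eq_matI) (auto simp: D_def)
    thus ?case by simp
  next
    case (Suc k)
    hence k: "k < p" by simp
    define f where "f = (\<lambda>x. (fst x)(s k := snd x) :: 'i \<Rightarrow> 'b)"
    have f: "f \<in> measurable (PiM I (\<lambda>_. \<rho>) \<Otimes>\<^sub>M \<rho>) (PiM I (\<lambda>_. \<rho>))"
    proof (rule measurable_PiM_single')
      fix j assume "j \<in> I"
      thus "(\<lambda>x. (f x) j) \<in> measurable (PiM I (\<lambda>_. \<rho>) \<Otimes>\<^sub>M \<rho>) \<rho>"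
        unfolding f_def by (cases "j = s k") (auto intro: measurable_compose[OF measurable_fst])
    qed (use sI[OF k] in \<open>auto simp: f_def space_pair_measure space_PiM PiE_iff extensional_def\<close>)
    define c where "c = (\<lambda>\<omega> j. cofactor (D k \<omega>) k j)"
    have D: "D i \<omega> \<in> carrier_mat p p" for i \<omega> by (simp add: D_def)
    have del: "mat_delete (D (Suc k) (fun_upd \<omega> (s k) b)) k j = mat_delete (D k \<omega>) k j" for \<omega> b j
    proof (rule eq_matI)
      fix i' j' assume "i' < dim_row (mat_delete (D k \<omega>) k j)" "j' < dim_col (mat_delete (D k \<omega>) k j)"
      moreover have "s i \<noteq> s k" if "i < k" for i
        using s(1) that k by (auto simp: inj_on_def)
      ultimately show "mat_delete (D (Suc k) (fun_upd \<omega> (s k) b)) k j $$ (i', j') = mat_delete (D k \<omega>) k j $$ (i', j')"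
        by (auto simp: mat_delete_def D_def)
    qed (auto simp: D_def mat_delete_def)
    have exp: "Determinant.det (D (Suc k) (fun_upd \<omega> (s k) b)) = dotp p (c \<omega>) (V b)" for \<omega> b
    proof -
      have "Determinant.det (D (Suc k) (fun_upd \<omega> (s k) b)) = (\<Sum>j<p. D (Suc k) (fun_upd \<omega> (s k) b) $$ (k,j) * cofactor (D (Suc k) (fun_upd \<omega> (s k) b)) k j)"
        by (rule laplace_expansion_row[OF D k])
      also have "\<dots> = (\<Sum>j<p. V b j * c \<omega> j)"
        by (intro sum.cong refl) (use k in \<open>simp add: c_def cofactor_def del, simp add: D_def\<close>)
      finally show ?thesis by (simp add: dotp_def mult.commute)
    qed
    have "Determinant.det (D k \<omega>) = c \<omega> k" for \<omega>
    proof -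
      have "Determinant.det (D k \<omega>) = (\<Sum>j<p. D k \<omega> $$ (k,j) * cofactor (D k \<omega>) k j)"
        by (rule laplace_expansion_row[OF D k])
      also have "\<dots> = (\<Sum>j<p. if j = k then c \<omega> k else 0)"
        by (intro sum.cong refl) (use k in \<open>auto simp: c_def D_def\<close>)
      finally show ?thesis using k by simp
    qed
    with Suc have "AE \<omega> in PiM I (\<lambda>_. \<rho>). c \<omega> k \<noteq> 0" by simp
    hence "AE \<omega> in PiM I (\<lambda>_. \<rho>). AE b in \<rho>. Determinant.det (D (Suc k) (f (\<omega>, b))) \<noteq> 0"
    proof eventually_elim
      case (elim \<omega>)
      thus ?case unfolding f_def fst_conv snd_conv exp by (rule hyp[OF k])
    qed
    hence "AE x in PiM I (\<lambda>_. \<rho>) \<Otimes>\<^sub>M \<rho>. Determinant.det (D (Suc k) (f x)) \<noteq> 0"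
      using measurable_compose[OF f meas[of "Suc k"]] by (intro P.AE_pair_measure) measurable
    hence "AE \<omega> in distr (PiM I (\<lambda>_. \<rho>) \<Otimes>\<^sub>M \<rho>) (PiM I (\<lambda>_. \<rho>)) f. Determinant.det (D (Suc k) \<omega>) \<noteq> 0"
      using meas[of "Suc k"] by (subst AE_distr_iff[OF f]) measurable
    thus ?case unfolding f_def distr_resample_PiM[OF I sI[OF k] \<rho>] .
  qed
  from this[of p] have "AE \<omega> in PiM I (\<lambda>_. \<rho>). Determinant.det (D p \<omega>) \<noteq> 0" by simp
  moreover have "D p \<omega> = mat p p (\<lambda>(i,j). V (\<omega> (s i)) j)" for \<omega>
    by (rule eq_matI) (auto simp: D_def)
  ultimately show ?thesis by simp
qed

text \<open>Any \<open>p\<close> of the rows indexed by \<open>S\<close> already form a nonsingular matrix; there are finitely many \<open>S\<close>,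
  so one null set serves them all, and \<open>S\<close> may later depend on the sample.\<close>

lemma AE_rows_injective:
  fixes V :: "'b \<Rightarrow> nat \<Rightarrow> real"
  assumes I: "finite I" and \<rho>: "prob_space \<rho>"
    and V: "\<And>j. j < p \<Longrightarrow> (\<lambda>b. V b j) \<in> borel_measurable \<rho>"
    and hyp: "\<And>c j. j < p \<Longrightarrow> c j \<noteq> 0 \<Longrightarrow> AE b in \<rho>. dotp p c (V b) \<noteq> 0"
  shows "AE \<omega> in PiM I (\<lambda>_. \<rho>). \<forall>S\<subseteq>I. p \<le> card S \<longrightarrow>
     (\<forall>c. (\<forall>i\<in>S. dotp p (V (\<omega> i)) c = 0) \<longrightarrow> (\<forall>j<p. c j = 0))"
proof -
  have one: "AE \<omega> in PiM I (\<lambda>_. \<rho>). \<forall>c. (\<forall>i\<in>S. dotp p (V (\<omega> i)) c = 0) \<longrightarrow> (\<forall>j<p. c j = 0)"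
    if S: "S \<subseteq> I" "p \<le> card S" for S
  proof -
    have "finite S" using S I finite_subset by blast
    then obtain s where s: "inj_on s {..<p}" "s ` {..<p} \<subseteq> S"
      using card_le_inj[of "{..<p}" S] S(2) by auto
    have "AE \<omega> in PiM I (\<lambda>_. \<rho>). Determinant.det (mat p p (\<lambda>(i,j). V (\<omega> (s i)) j)) \<noteq> 0"
      using s S by (intro AE_det_nonzero[OF I \<rho> V hyp]) auto
    thus ?thesis
    proof eventually_elim
      case (elim \<omega>)
      show ?case
      proof (intro allI impI)
        fix c j assume c: "\<forall>i\<in>S. dotp p (V (\<omega> i)) c = 0" and j: "j < p"
        define A where "A = mat p p (\<lambda>(i,j). V (\<omega> (s i)) j)"
        have A: "A \<in> carrier_mat p p" by (simp add: A_def)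
        have "A *\<^sub>v Matrix.vec p c = 0\<^sub>v p"
        proof (rule eq_vecI)
          fix i assume "i < dim_vec (0\<^sub>v p :: real Matrix.vec)"
          hence i: "i < p" by simp
          have "(A *\<^sub>v Matrix.vec p c) $ i = dotp p (V (\<omega> (s i))) c"
            using i by (simp add: A_def scalar_prod_def dotp_def atLeast0LessThan)
          also have "\<dots> = 0" using c s(2) i by auto
          finally show "(A *\<^sub>v Matrix.vec p c) $ i = (0\<^sub>v p :: real Matrix.vec) $ i" using i by simp
        qed (simp add: A_def)
        moreover have "\<not> (\<exists>v. v \<in> carrier_vec p \<and> v \<noteq> 0\<^sub>v p \<and> A *\<^sub>v v = 0\<^sub>v p)"
          using elim det_0_iff_vec_prod_zero_field[OF A] by (simp add: A_def)
        ultimately have "Matrix.vec p c = 0\<^sub>v p" by (metis vec_carrier)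
        thus "c j = 0" using j by (metis index_vec index_zero_vec(1))
      qed
    qed
  qed
  have "AE \<omega> in PiM I (\<lambda>_. \<rho>). \<forall>S\<in>{S. S \<subseteq> I \<and> p \<le> card S}.
     \<forall>c. (\<forall>i\<in>S. dotp p (V (\<omega> i)) c = 0) \<longrightarrow> (\<forall>j<p. c j = 0)"
    using I one by (intro AE_finite_allI) auto
  thus ?thesis by eventually_elim blast
qed

section \<open>Inverse matrices in coordinates\<close>

lemma mat_inv_carrier:
  assumes "A \<in> carrier_mat p p"
  shows "mat_inv A \<in> carrier_mat p p"
  using assms mat_inverse(2)[OF assms] by (auto simp: mat_inv_def split: option.split)

lemma mat_inv_inverse:
  assumes A: "A \<in> carrier_mat p p" and d: "Determinant.det A \<noteq> 0"
  shows "A * mat_inv A = 1\<^sub>m p" "mat_inv A * A = 1\<^sub>m p"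
proof -
  have "mat_inverse A \<noteq> None"
    using mat_inverse(1)[OF A, where b = "()"] det_non_zero_imp_unit[OF A d, of "()"] by blast
  then obtain B where B: "mat_inverse A = Some B" by blast
  from mat_inverse(2)[OF A B] B show "A * mat_inv A = 1\<^sub>m p" "mat_inv A * A = 1\<^sub>m p"
    by (auto simp: mat_inv_def)
qed

lemma mat_inv_singular:
  assumes A: "A \<in> carrier_mat p p" and d: "Determinant.det A = 0"
  shows "mat_inv A = 0\<^sub>m p p"
proof -
  have "mat_inverse A = None"
  proof (rule ccontr)
    assume "mat_inverse A \<noteq> None"
    then obtain B where "mat_inverse A = Some B" by blast
    hence B: "A * B = 1\<^sub>m p" "B \<in> carrier_mat p p" using mat_inverse(2)[OF A] by blast+
    have "Determinant.det A * Determinant.det B = 1"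
      using det_mult[OF A B(2)] B(1) by simp
    thus False using d by simp
  qed
  thus ?thesis using A by (simp add: mat_inv_def)
qed

text \<open>The formula also holds for singular matrices, where both sides are \<open>0\<close>: division by \<open>0\<close> yields \<open>0\<close>
  and the inverse of a singular matrix is the zero matrix. Hence the entries of the inverse are measurable
  functions of the matrix.\<close>

lemma mat_inv_cofactor:
  fixes A :: "real mat"
  assumes A: "A \<in> carrier_mat p p" and ij: "i < p" "j < p"
  shows "mat_inv A $$ (i,j) = cofactor A j i / Determinant.det A"
proof (cases "Determinant.det A = 0")
  case True
  thus ?thesis using mat_inv_singular[OF A True] ij by simp
next
  case False
  note inv = mat_inv_inverse[OF A False] and Ac = mat_inv_carrier[OF A] and adj = adj_mat[OF A]
  have "adj_mat A = mat_inv A * A * adj_mat A" using adj(1) by (simp add: inv)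
  also have "\<dots> = mat_inv A * (Determinant.det A \<cdot>\<^sub>m 1\<^sub>m p)"
    using assoc_mult_mat[OF Ac A adj(1)] adj(2) by simp
  also have "\<dots> = Determinant.det A \<cdot>\<^sub>m mat_inv A"
    using Ac by (simp add: mult_smult_distrib[OF Ac one_carrier_mat])
  finally have "adj_mat A $$ (i,j) = Determinant.det A * mat_inv A $$ (i,j)" using Ac ij by simp
  moreover have "adj_mat A $$ (i,j) = cofactor A j i" using A ij by (simp add: adj_mat_def)
  ultimately show ?thesis using False by (simp add: field_simps)
qed

text \<open>The solution of \<open>M c = x\<close>. For singular \<open>M\<close> it is \<open>0\<close>, which keeps the bounds on the projection
  kernel below unconditional.\<close>

definition msolve :: "nat \<Rightarrow> (nat \<Rightarrow> nat \<Rightarrow> real) \<Rightarrow> (nat \<Rightarrow> real) \<Rightarrow> nat \<Rightarrow> real" where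
  "msolve p M x = (\<lambda>a. dotp p (\<lambda>b. mat_inv (mat p p (\<lambda>(a,b). M a b)) $$ (a,b)) x)"

definition nonsing :: "nat \<Rightarrow> (nat \<Rightarrow> nat \<Rightarrow> real) \<Rightarrow> bool" where
  "nonsing p M \<longleftrightarrow> (\<forall>c. (\<forall>a<p. dotp p (M a) c = 0) \<longrightarrow> (\<forall>a<p. c a = 0))"

lemma mult_mat_vec_dotp:
  assumes "a < p"
  shows "(mat p p (\<lambda>(a,b). M a b) *\<^sub>v Matrix.vec p c) $ a = dotp p (M a) c"
  using assms by (simp add: scalar_prod_def dotp_def atLeast0LessThan)

lemma nonsing_iff_det: "nonsing p M \<longleftrightarrow> Determinant.det (mat p p (\<lambda>(a,b). M a b)) \<noteq> 0"
proof -
  let ?A = "mat p p (\<lambda>(a,b). M a b)"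
  have A: "?A \<in> carrier_mat p p" by simp
  have eq: "?A *\<^sub>v Matrix.vec p c = 0\<^sub>v p \<longleftrightarrow> (\<forall>a<p. dotp p (M a) c = 0)" for c
  proof
    assume "?A *\<^sub>v Matrix.vec p c = 0\<^sub>v p"
    thus "\<forall>a<p. dotp p (M a) c = 0" by (metis mult_mat_vec_dotp index_zero_vec(1))
  next
    assume "\<forall>a<p. dotp p (M a) c = 0"
    thus "?A *\<^sub>v Matrix.vec p c = 0\<^sub>v p"
      by (intro eq_vecI) (auto simp: mult_mat_vec_dotp simp del: index_mult_mat_vec)
  qed
  have z: "Matrix.vec p c = 0\<^sub>v p \<longleftrightarrow> (\<forall>a<p. c a = (0::real))" for c
    by (metis (no_types, lifting) eq_vecI dim_vec index_vec index_zero_vec)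
  have "Determinant.det ?A = 0 \<longleftrightarrow> (\<exists>v. v \<in> carrier_vec p \<and> v \<noteq> 0\<^sub>v p \<and> ?A *\<^sub>v v = 0\<^sub>v p)"
    by (rule det_0_iff_vec_prod_zero_field[OF A])
  also have "\<dots> \<longleftrightarrow> (\<exists>c. Matrix.vec p c \<noteq> 0\<^sub>v p \<and> ?A *\<^sub>v Matrix.vec p c = 0\<^sub>v p)"
  proof
    assume "\<exists>v. v \<in> carrier_vec p \<and> v \<noteq> 0\<^sub>v p \<and> ?A *\<^sub>v v = 0\<^sub>v p"
    then obtain v where v: "v \<in> carrier_vec p" "v \<noteq> 0\<^sub>v p" "?A *\<^sub>v v = 0\<^sub>v p" by blast
    have "v = Matrix.vec p (($) v)" using v(1) by auto
    thus "\<exists>c. Matrix.vec p c \<noteq> 0\<^sub>v p \<and> ?A *\<^sub>v Matrix.vec p c = 0\<^sub>v p" using v by metis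
  qed (use vec_carrier in blast)
  also have "\<dots> \<longleftrightarrow> \<not> nonsing p M" unfolding eq z nonsing_def by blast
  finally show ?thesis by blast
qed

lemma mat_inv_entry_sums:
  assumes ns: "nonsing p M" and ab: "a < p" "b < p"
  defines "N \<equiv> (\<lambda>a b. mat_inv (mat p p (\<lambda>(a,b). M a b)) $$ (a,b))"
  shows "(\<Sum>c<p. M a c * N c b) = (if a = b then 1 else 0)"
    and "(\<Sum>c<p. N a c * M c b) = (if a = b then 1 else 0)"
proof -
  let ?A = "mat p p (\<lambda>(a,b). M a b)"
  have A: "?A \<in> carrier_mat p p" by simp
  note inv = mat_inv_inverse[OF A ns[unfolded nonsing_iff_det]] and Ac = mat_inv_carrier[OF A]
  have "(?A * mat_inv ?A) $$ (a,b) = (\<Sum>c<p. M a c * N c b)"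
    using ab Ac by (simp add: N_def scalar_prod_def atLeast0LessThan)
  thus "(\<Sum>c<p. M a c * N c b) = (if a = b then 1 else 0)" using ab by (simp add: inv)
  have "(mat_inv ?A * ?A) $$ (a,b) = (\<Sum>c<p. N a c * M c b)"
    using ab Ac by (simp add: N_def scalar_prod_def atLeast0LessThan)
  thus "(\<Sum>c<p. N a c * M c b) = (if a = b then 1 else 0)" using ab by (simp add: inv)
qed

lemma dotp_matrix_swap:
  "dotp p x (\<lambda>c. dotp p (N c) y) = dotp p (\<lambda>d. \<Sum>c<p. x c * N c d) y"
  unfolding dotp_def sum_distrib_left sum_distrib_right by (subst sum.swap) (simp add: mult.assoc)

lemma dotp_delta: "a < p \<Longrightarrow> dotp p (\<lambda>b. if a = b then 1 else 0) y = y a"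
  by (simp add: dotp_def if_distrib[of "\<lambda>t. t * _"] cong: if_cong)

lemma dotp_mat_msolve:
  assumes ns: "nonsing p M" and a: "a < p"
  shows "dotp p (M a) (msolve p M x) = x a"
proof -
  have "dotp p (M a) (msolve p M x) = dotp p (\<lambda>b. if a = b then 1 else 0) x"
    unfolding msolve_def dotp_matrix_swap
    by (rule dotp_cong) (use mat_inv_entry_sums(1)[OF ns a] in auto)
  thus ?thesis using a by (simp add: dotp_delta)
qed

lemma msolve_mat_dotp:
  assumes ns: "nonsing p M" and a: "a < p"
  shows "msolve p M (\<lambda>b. dotp p (M b) y) a = y a"
proof -
  have "msolve p M (\<lambda>b. dotp p (M b) y) a = dotp p (\<lambda>b. if a = b then 1 else 0) y"
    unfolding msolve_def dotp_matrix_swap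
    by (rule dotp_cong) (use mat_inv_entry_sums(2)[OF ns a] in auto)
  thus ?thesis using a by (simp add: dotp_delta)
qed

lemma msolve_singular: "\<not> nonsing p M \<Longrightarrow> a < p \<Longrightarrow> msolve p M x a = 0"
  using mat_inv_singular[of "mat p p (\<lambda>(a,b). M a b)" p]
  by (simp add: nonsing_iff_det msolve_def dotp_def)

lemma msolve_cong: "(\<And>b. b < p \<Longrightarrow> x b = y b) \<Longrightarrow> msolve p M x = msolve p M y"
  unfolding msolve_def by (intro ext dotp_cong) auto

lemma msolve_sum: "msolve p M (\<lambda>b. \<Sum>j\<in>S. f j b) a = (\<Sum>j\<in>S. msolve p M (f j) a)"
  by (simp add: msolve_def dotp_sum_right)

lemma msolve_scale: "msolve p M (\<lambda>b. s * x b) a = s * msolve p M x a"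
  by (simp add: msolve_def dotp_linear)

lemma msolve_adjoint:
  assumes sym: "\<And>a b. a < p \<Longrightarrow> b < p \<Longrightarrow> M a b = M b a"
  shows "dotp p x (msolve p M y) = dotp p (msolve p M x) y"
proof (cases "nonsing p M")
  case True
  define x' where "x' = msolve p M x"
  define y' where "y' = msolve p M y"
  have "dotp p x (msolve p M y) = dotp p (\<lambda>a. dotp p (M a) x') y'"
    unfolding x'_def y'_def by (rule dotp_cong) (simp_all add: dotp_mat_msolve[OF True])
  also have "\<dots> = dotp p y' (\<lambda>a. dotp p (M a) x')" by (rule dotp_commute)
  also have "\<dots> = dotp p (\<lambda>d. dotp p (M d) y') x'"
    unfolding dotp_matrix_swap
    by (rule dotp_cong) (auto simp: dotp_def sym mult.commute intro!: sum.cong)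
  also have "\<dots> = dotp p (msolve p M x) y"
    unfolding x'_def y'_def by (subst dotp_commute, rule dotp_cong) (simp_all add: dotp_mat_msolve[OF True])
  finally show ?thesis .
qed (simp add: dotp_def msolve_singular)

section \<open>The projection onto the nuisance directions\<close>

text \<open>The rows \<open>r\<^sub>i\<close> lie in the orthogonal complement of a unit vector \<open>u\<close>. Adding \<open>u u\<^sup>T\<close> to their
  Gram matrix makes it invertible without a change of basis, and \<open>u\<close> is then a fixed vector.
  The entries \<open>r\<^sub>i\<^sup>T M\<^sup>-\<^sup>1 r\<^sub>j\<close> form the orthogonal projection onto the column space of \<open>r\<close>.\<close>

definition gram :: "'i set \<Rightarrow> ('i \<Rightarrow> nat \<Rightarrow> real) \<Rightarrow> (nat \<Rightarrow> real) \<Rightarrow> nat \<Rightarrow> nat \<Rightarrow> real" where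
  "gram S r u a b = (\<Sum>i\<in>S. r i a * r i b) + u a * u b"

definition pker :: "nat \<Rightarrow> 'i set \<Rightarrow> ('i \<Rightarrow> nat \<Rightarrow> real) \<Rightarrow> (nat \<Rightarrow> real) \<Rightarrow> 'i \<Rightarrow> 'i \<Rightarrow> real" where
  "pker p S r u i j = dotp p (r i) (msolve p (gram S r u) (r j))"

lemma gram_sym: "gram S r u a b = gram S r u b a"
  by (simp add: gram_def mult.commute)

lemma dotp_gram: "dotp p (gram S r u a) y = (\<Sum>i\<in>S. r i a * dotp p (r i) y) + u a * dotp p u y"
  unfolding gram_def by (simp add: dotp_add_left dotp_sum_left dotp_scale_left)

lemma pker_sym: "pker p S r u i j = pker p S r u j i"
  unfolding pker_def by (subst msolve_adjoint[OF gram_sym]) (rule dotp_commute)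

lemma pker_singular: "\<not> nonsing p (gram S r u) \<Longrightarrow> pker p S r u i j = 0"
  by (simp add: pker_def dotp_def msolve_singular)

lemma sum_pker:
  "(\<Sum>j\<in>S. pker p S r u i j * c j) = dotp p (r i) (msolve p (gram S r u) (\<lambda>b. \<Sum>j\<in>S. r j b * c j))"
proof -
  have "msolve p (gram S r u) (\<lambda>b. \<Sum>j\<in>S. r j b * c j) = (\<lambda>a. \<Sum>j\<in>S. c j * msolve p (gram S r u) (r j) a)"
    by (rule ext) (simp add: msolve_sum mult.commute[of _ "c _"] msolve_scale)
  thus ?thesis by (simp add: pker_def dotp_sum_right dotp_scale_right mult.commute)
qed

lemma msolve_gram_unit:
  assumes ns: "nonsing p (gram S r u)" and u: "dotp p u u = 1" "\<And>i. i \<in> S \<Longrightarrow> dotp p u (r i) = 0" and a: "a < p"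
  shows "msolve p (gram S r u) u a = u a"
proof -
  have "dotp p (gram S r u b) u = u b" for b
    using u by (simp add: dotp_gram dotp_commute[of p "r _"])
  thus ?thesis using msolve_mat_dotp[OF ns a, of u] by simp
qed

lemma pker_idempotent:
  assumes u: "dotp p u u = 1" "\<And>i. i \<in> S \<Longrightarrow> dotp p u (r i) = 0" and k: "k \<in> S"
  shows "(\<Sum>j\<in>S. pker p S r u i j * pker p S r u j k) = pker p S r u i k"
proof (cases "nonsing p (gram S r u)")
  case ns: True
  define y where "y = msolve p (gram S r u) (r k)"
  have "dotp p u y = dotp p (msolve p (gram S r u) u) (r k)"
    unfolding y_def by (rule msolve_adjoint[OF gram_sym])
  also have "\<dots> = dotp p u (r k)" by (rule dotp_cong) (simp_all add: msolve_gram_unit[OF ns u])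
  finally have uy: "dotp p u y = 0" using u(2)[OF k] by simp
  have "(\<Sum>j\<in>S. r j b * pker p S r u j k) = r k b" if "b < p" for b
    using dotp_gram[of p S r u b y] dotp_mat_msolve[OF ns that, of "r k"] uy
    by (simp add: pker_def y_def)
  hence "msolve p (gram S r u) (\<lambda>b. \<Sum>j\<in>S. r j b * pker p S r u j k) = msolve p (gram S r u) (r k)"
    by (intro msolve_cong) auto
  thus ?thesis unfolding sum_pker by (simp add: pker_def)
qed (simp add: pker_singular)

lemma pker_trace:
  assumes ns: "nonsing p (gram S r u)" and u: "dotp p u u = 1" "\<And>i. i \<in> S \<Longrightarrow> dotp p u (r i) = 0"
  shows "(\<Sum>i\<in>S. pker p S r u i i) = real p - 1"
proof -
  define N where "N = (\<lambda>a b. mat_inv (mat p p (\<lambda>(a,b). gram S r u a b)) $$ (a,b))"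
  have "(\<Sum>i\<in>S. pker p S r u i i) = (\<Sum>i\<in>S. \<Sum>a<p. \<Sum>b<p. N a b * (r i b * r i a))"
    by (simp add: pker_def msolve_def dotp_def N_def sum_distrib_left mult_ac)
  also have "\<dots> = (\<Sum>a<p. \<Sum>b<p. N a b * (\<Sum>i\<in>S. r i b * r i a))"
    by (simp add: sum.swap[of _ _ S] sum_distrib_left)
  also have "\<dots> = (\<Sum>a<p. \<Sum>b<p. N a b * gram S r u b a) - (\<Sum>a<p. \<Sum>b<p. N a b * (u b * u a))"
    by (simp add: gram_def sum_subtractf[symmetric] algebra_simps)
  also have "(\<Sum>a<p. \<Sum>b<p. N a b * gram S r u b a) = real p"
    using mat_inv_entry_sums(2)[OF ns] by (simp add: N_def)
  also have "(\<Sum>a<p. \<Sum>b<p. N a b * (u b * u a)) = dotp p u (msolve p (gram S r u) u)"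
    by (simp add: msolve_def dotp_def N_def sum_distrib_left mult_ac)
  also have "\<dots> = dotp p u u" by (rule dotp_cong) (simp_all add: msolve_gram_unit[OF ns u])
  finally show ?thesis using u(1) by simp
qed

lemma pker_squares:
  assumes u: "dotp p u u = 1" "\<And>i. i \<in> S \<Longrightarrow> dotp p u (r i) = 0" and i: "i \<in> S"
  shows "(\<Sum>j\<in>S. (pker p S r u i j)\<^sup>2) = pker p S r u i i"
proof -
  have "(\<Sum>j\<in>S. (pker p S r u i j)\<^sup>2) = (\<Sum>j\<in>S. pker p S r u i j * pker p S r u j i)"
    by (simp add: power2_eq_square pker_sym)
  thus ?thesis using pker_idempotent[where p=p and u=u and S=S and r=r, OF u i] by simp
qed

lemma pker_bounds:
  assumes S: "finite S" and u: "dotp p u u = 1" "\<And>i. i \<in> S \<Longrightarrow> dotp p u (r i) = 0" and ij: "i \<in> S" "j \<in> S"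
  shows "0 \<le> pker p S r u i i" "pker p S r u i i \<le> 1" "\<bar>pker p S r u i j\<bar> \<le> 1"
proof -
  note sq = pker_squares[where p=p and u=u and S=S and r=r, OF u ij(1)]
  have "0 \<le> (\<Sum>j\<in>S. (pker p S r u i j)\<^sup>2)" by (rule sum_nonneg) simp
  thus nn: "0 \<le> pker p S r u i i" by (simp only: sq)
  have le: "(pker p S r u i j)\<^sup>2 \<le> pker p S r u i i" if "j \<in> S" for j
  proof -
    have "(pker p S r u i j)\<^sup>2 \<le> (\<Sum>j\<in>S. (pker p S r u i j)\<^sup>2)"
      using S that by (intro member_le_sum) auto
    thus ?thesis by (simp only: sq)
  qed
  have xx: "pker p S r u i i * pker p S r u i i \<le> pker p S r u i i * 1"
    using le[OF ij(1)] by (simp add: power2_eq_square)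
  show le1: "pker p S r u i i \<le> 1"
  proof (rule ccontr)
    assume "\<not> pker p S r u i i \<le> 1"
    hence "pker p S r u i i * 1 < pker p S r u i i * pker p S r u i i"
      by (intro mult_strict_left_mono) auto
    thus False using xx by linarith
  qed
  have "(pker p S r u i j)\<^sup>2 \<le> 1" using le[OF ij(2)] le1 by linarith
  thus "\<bar>pker p S r u i j\<bar> \<le> 1" by (simp add: abs_square_le_1)
qed

lemma pker_sign_flip:
  assumes s: "\<And>i. i \<in> S \<Longrightarrow> s i * s i = (1::real)"
    and r': "\<And>i a. i \<in> S \<Longrightarrow> a < p \<Longrightarrow> r' i a = s i * r i a" and ij: "i \<in> S" "j \<in> S"
  shows "pker p S r' u i j = s i * s j * pker p S r u i j"
proof -
  have "gram S r' u a b = gram S r u a b" if "a < p" "b < p" for a b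
  proof -
    have "r' i a * r' i b = r i a * r i b" if i: "i \<in> S" for i
    proof -
      have "r' i a * r' i b = (s i * s i) * (r i a * r i b)"
        using r'[OF i] \<open>a < p\<close> \<open>b < p\<close> by simp
      thus ?thesis by (simp add: s[OF i])
    qed
    thus ?thesis by (simp add: gram_def)
  qed
  hence "mat p p (\<lambda>(a,b). gram S r' u a b) = mat p p (\<lambda>(a,b). gram S r u a b)"
    by (intro eq_matI) auto
  hence m: "msolve p (gram S r' u) x = msolve p (gram S r u) x" for x by (simp add: msolve_def)
  have "msolve p (gram S r u) (r' j) = msolve p (gram S r u) (\<lambda>a. s j * r j a)"
    by (rule msolve_cong) (simp add: r' ij)
  hence mj: "msolve p (gram S r u) (r' j) = (\<lambda>a. s j * msolve p (gram S r u) (r j) a)"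
    by (simp add: msolve_scale fun_eq_iff)
  have "pker p S r' u i j = dotp p (\<lambda>a. s i * r i a) (\<lambda>a. s j * msolve p (gram S r u) (r j) a)"
    unfolding pker_def m mj by (rule dotp_cong) (auto simp: r' ij)
  thus ?thesis unfolding pker_def dotp_linear by (simp only: mult.assoc)
qed

lemma pker_permute:
  assumes f: "bij_betw f S S"
    and r': "\<And>i a. i \<in> S \<Longrightarrow> a < p \<Longrightarrow> r' i a = r (f i) a" and ij: "i \<in> S" "j \<in> S"
  shows "pker p S r' u i j = pker p S r u (f i) (f j)"
proof -
  have "gram S r' u a b = gram S r u a b" if "a < p" "b < p" for a b
  proof -
    have "(\<Sum>i\<in>S. r' i a * r' i b) = (\<Sum>i\<in>S. r (f i) a * r (f i) b)" using r' that by simp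
    also have "\<dots> = (\<Sum>i\<in>S. r i a * r i b)" by (rule sum.reindex_bij_betw[OF f])
    finally show ?thesis by (simp add: gram_def)
  qed
  hence "mat p p (\<lambda>(a,b). gram S r' u a b) = mat p p (\<lambda>(a,b). gram S r u a b)"
    by (intro eq_matI) auto
  hence m: "msolve p (gram S r' u) x = msolve p (gram S r u) x" for x by (simp add: msolve_def)
  have "msolve p (gram S r u) (r' j) = msolve p (gram S r u) (r (f j))"
    by (rule msolve_cong) (simp add: r' ij)
  thus ?thesis
    unfolding pker_def m by (intro dotp_cong) (auto simp: r' ij)
qed

text \<open>With \<open>P\<close> the projection onto the nuisance directions, this is the bilinear form \<open>a\<^sup>T (1 - P) b\<close>.\<close>

definition resid_form :: "nat \<Rightarrow> 'i set \<Rightarrow> ('i \<Rightarrow> nat \<Rightarrow> real) \<Rightarrow> (nat \<Rightarrow> real) \<Rightarrow> ('i \<Rightarrow> real) \<Rightarrow> ('i \<Rightarrow> real) \<Rightarrow> real" where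
  "resid_form p S r u a b = (\<Sum>i\<in>S. a i * b i) - (\<Sum>i\<in>S. a i * (\<Sum>j\<in>S. pker p S r u i j * b j))"

text \<open>The Frisch--Waugh--Lovell formula: partialling the rows \<open>r\<close> out of the least-squares problem
  isolates the coordinate of its solution along \<open>u\<close>.\<close>

lemma frisch_waugh_lovell:
  fixes r :: "'i \<Rightarrow> nat \<Rightarrow> real"
  assumes S: "finite S" and u: "dotp p u u = 1" "\<And>i. i \<in> S \<Longrightarrow> dotp p u (r i) = 0"
    and g: "\<And>i a. i \<in> S \<Longrightarrow> a < p \<Longrightarrow> g i a = r i a + z i * u a"
    and inj: "\<forall>c. (\<forall>i\<in>S. dotp p (g i) c = 0) \<longrightarrow> (\<forall>j<p. c j = 0)"
    and normal: "\<And>a. a < p \<Longrightarrow> (\<Sum>i\<in>S. g i a * (e i - dotp p (g i) d)) = 0"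
  shows "nonsing p (gram S r u)"
    and "resid_form p S r u z (\<lambda>i. e i + l * z i) = (dotp p u d + l) * resid_form p S r u z z"
    and "0 < resid_form p S r u z z" and "resid_form p S r u z z \<le> (\<Sum>i\<in>S. (z i)\<^sup>2)"
proof -
  have ru: "dotp p (r i) u = 0" if "i \<in> S" for i using u(2)[OF that] by (simp add: dotp_commute)
  have gd: "dotp p (g i) c = dotp p (r i) c + z i * dotp p u c" if "i \<in> S" for i c
  proof -
    have "dotp p (g i) c = dotp p (\<lambda>a. r i a + z i * u a) c" by (rule dotp_cong) (auto simp: g that)
    thus ?thesis by (simp add: dotp_linear)
  qed
  show ns: "nonsing p (gram S r u)"
    unfolding nonsing_def
  proof (intro allI impI)
    fix c a assume c: "\<forall>a<p. dotp p (gram S r u a) c = 0" and a: "a < p"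
    have "0 = dotp p c (\<lambda>a. dotp p (gram S r u a) c)" using c by (simp add: dotp_def)
    also have "\<dots> = (\<Sum>i\<in>S. dotp p (r i) c * dotp p (r i) c) + dotp p u c * dotp p u c"
    proof -
      have "dotp p c (\<lambda>a. dotp p (gram S r u a) c) =
          dotp p c (\<lambda>a. (\<Sum>i\<in>S. dotp p (r i) c * r i a) + dotp p u c * u a)"
        unfolding dotp_gram by (simp only: mult.commute)
      also have "\<dots> = (\<Sum>i\<in>S. dotp p (r i) c * dotp p c (r i)) + dotp p u c * dotp p c u"
        by (simp only: dotp_add_right dotp_sum_right dotp_scale_right)
      finally show ?thesis by (simp only: dotp_commute)
    qed
    finally have z: "(\<Sum>i\<in>S. (dotp p (r i) c)\<^sup>2) + (dotp p u c)\<^sup>2 = 0" by (simp add: power2_eq_square)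
    have nn: "0 \<le> (\<Sum>i\<in>S. (dotp p (r i) c)\<^sup>2)" by (simp add: sum_nonneg)
    have "(dotp p u c)\<^sup>2 = 0" "(\<Sum>i\<in>S. (dotp p (r i) c)\<^sup>2) = 0"
      using z nn zero_le_power2[of "dotp p u c"] by linarith+
    hence "dotp p u c = 0" "\<forall>i\<in>S. dotp p (r i) c = 0"
      using S by (auto simp: sum_nonneg_eq_0_iff)
    hence "dotp p (g i) c = 0" if "i \<in> S" for i using that by (simp add: gd)
    with inj a show "c a = 0" by blast
  qed
  define K where "K = pker p S r u"
  define s where "s = (\<lambda>i. e i - dotp p (g i) d)"
  define \<theta> where "\<theta> = dotp p u d"
  define d' where "d' = (\<lambda>a. d a - \<theta> * u a)"
  have ud': "dotp p u d' = 0" by (simp add: d'_def dotp_linear u \<theta>_def)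
  have rd': "dotp p (r i) d' = dotp p (r i) d" if "i \<in> S" for i
    using ru[OF that] by (simp add: d'_def dotp_linear)
  have zs: "(\<Sum>i\<in>S. z i * s i) = 0"
  proof -
    have "(\<Sum>i\<in>S. z i * s i) = (\<Sum>i\<in>S. dotp p u (g i) * s i)"
      using u gd[of _ u] by (intro sum.cong refl) (simp add: dotp_commute[of p u "g _"] ru)
    also have "\<dots> = dotp p u (\<lambda>a. \<Sum>i\<in>S. g i a * s i)"
      by (simp add: dotp_sum_right mult.commute[of _ "s _"] dotp_scale_right)
    also have "\<dots> = dotp p u (\<lambda>a. 0)" by (rule dotp_cong) (use normal in \<open>auto simp: s_def\<close>)
    finally show ?thesis by (simp add: dotp_def)
  qed
  have rs: "(\<Sum>i\<in>S. r i a * s i) = 0" if a: "a < p" for a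
  proof -
    have "(\<Sum>i\<in>S. g i a * s i) = (\<Sum>i\<in>S. r i a * s i) + u a * (\<Sum>i\<in>S. z i * s i)"
      by (simp add: sum_distrib_left sum.distrib[symmetric])
        (intro sum.cong refl, simp add: g a algebra_simps)
    thus ?thesis using normal[OF a] zs by (simp add: s_def)
  qed
  define w where "w = (\<lambda>i. e i - \<theta> * z i)"
  have w: "w i = s i + dotp p (r i) d'" if "i \<in> S" for i
    using that by (simp add: w_def s_def gd rd' \<theta>_def mult.commute)
  have Kw: "(\<Sum>j\<in>S. K i j * w j) = w i - s i" if i: "i \<in> S" for i
  proof -
    have "(\<Sum>j\<in>S. r j b * w j) = dotp p (gram S r u b) d'" if b: "b < p" for b
    proof -
      have "(\<Sum>j\<in>S. r j b * w j) = (\<Sum>j\<in>S. r j b * s j) + (\<Sum>j\<in>S. r j b * dotp p (r j) d')"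
        by (simp add: sum.distrib[symmetric]) (intro sum.cong refl, simp add: w algebra_simps)
      thus ?thesis using rs[OF b] by (simp add: dotp_gram ud')
    qed
    hence "msolve p (gram S r u) (\<lambda>b. \<Sum>j\<in>S. r j b * w j) = msolve p (gram S r u) (\<lambda>b. dotp p (gram S r u b) d')"
      by (intro msolve_cong) auto
    hence "(\<Sum>j\<in>S. K i j * w j) = dotp p (r i) d'"
      unfolding K_def sum_pker by (auto intro!: dotp_cong simp: msolve_mat_dotp[OF ns])
    thus ?thesis using w[OF i] by simp
  qed
  let ?Q = "resid_form p S r u"
  have lin: "?Q z (\<lambda>i. b i + t * c i) = ?Q z b + t * ?Q z c" for b c t
    by (simp add: resid_form_def algebra_simps sum.distrib sum_distrib_left)
  have "?Q z w = (\<Sum>i\<in>S. z i * w i) - (\<Sum>i\<in>S. z i * (w i - s i))"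
    unfolding resid_form_def using Kw by (simp add: K_def)
  also have "\<dots> = 0" using zs by (simp add: right_diff_distrib sum_subtractf)
  finally have "?Q z w = 0" .
  moreover have "(\<lambda>i. e i + l * z i) = (\<lambda>i. w i + (\<theta> + l) * z i)"
    by (auto simp: w_def algebra_simps)
  ultimately show "resid_form p S r u z (\<lambda>i. e i + l * z i) = (dotp p u d + l) * resid_form p S r u z z"
    using lin[of w "\<theta> + l" z] by (simp add: \<theta>_def)
  \<comment> \<open>positivity: if the residual of \<open>z\<close> vanished, \<open>z\<close> would be a combination \<open>r c\<close> of the nuisance columns, and \<open>u\<close> minus the part of \<open>c\<close> across \<open>u\<close> would lie in the kernel of \<open>g\<close>\<close>
  define Kz where "Kz = (\<lambda>i. \<Sum>j\<in>S. K i j * z j)"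
  have KKz: "(\<Sum>i\<in>S. Kz i * Kz i) = (\<Sum>i\<in>S. z i * Kz i)"
  proof -
    have "(\<Sum>i\<in>S. Kz i * Kz i) = (\<Sum>i\<in>S. \<Sum>j\<in>S. \<Sum>k\<in>S. z j * (K j i * K i k) * z k)"
      by (simp add: Kz_def sum_distrib_left sum_distrib_right K_def pker_sym[of p S r u] mult_ac)
    also have "\<dots> = (\<Sum>j\<in>S. \<Sum>k\<in>S. \<Sum>i\<in>S. z j * (K j i * K i k) * z k)"
      by (subst sum.swap) (intro sum.cong refl sum.swap)
    also have "\<dots> = (\<Sum>j\<in>S. \<Sum>k\<in>S. z j * (\<Sum>i\<in>S. K j i * K i k) * z k)"
      by (simp add: sum_distrib_left sum_distrib_right)
    also have "\<dots> = (\<Sum>j\<in>S. \<Sum>k\<in>S. z j * K j k * z k)"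
      by (intro sum.cong refl) (simp add: K_def pker_idempotent[where p=p and u=u and S=S and r=r, OF u])
    finally show ?thesis by (simp add: Kz_def sum_distrib_left mult.assoc)
  qed
  have Qzz: "?Q z z = (\<Sum>i\<in>S. (z i - Kz i)\<^sup>2)" "?Q z z = (\<Sum>i\<in>S. (z i)\<^sup>2) - (\<Sum>i\<in>S. (Kz i)\<^sup>2)"
  proof -
    have Q: "?Q z z = (\<Sum>i\<in>S. z i * z i) - (\<Sum>i\<in>S. z i * Kz i)"
      by (simp add: resid_form_def Kz_def K_def)
    thus "?Q z z = (\<Sum>i\<in>S. (z i)\<^sup>2) - (\<Sum>i\<in>S. (Kz i)\<^sup>2)" using KKz by (simp add: power2_eq_square)
    have "(\<Sum>i\<in>S. (z i - Kz i)\<^sup>2) = (\<Sum>i\<in>S. z i * z i) - 2 * (\<Sum>i\<in>S. z i * Kz i) + (\<Sum>i\<in>S. Kz i * Kz i)"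
      by (simp add: power2_eq_square algebra_simps sum.distrib sum_subtractf sum_distrib_left)
    thus "?Q z z = (\<Sum>i\<in>S. (z i - Kz i)\<^sup>2)" using Q KKz by simp
  qed
  show "?Q z z \<le> (\<Sum>i\<in>S. (z i)\<^sup>2)" unfolding Qzz(2) by (simp add: sum_nonneg)
  show "0 < ?Q z z"
  proof (rule ccontr)
    assume "\<not> 0 < ?Q z z"
    hence "(\<Sum>i\<in>S. (z i - Kz i)\<^sup>2) = 0"
      using Qzz(1) sum_nonneg[of S "\<lambda>i. (z i - Kz i)\<^sup>2"] by auto
    hence zK: "z i = Kz i" if "i \<in> S" for i using S that by (auto simp: sum_nonneg_eq_0_iff)
    define c where "c = msolve p (gram S r u) (\<lambda>b. \<Sum>j\<in>S. r j b * z j)"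
    have zc: "z i = dotp p (r i) c" if "i \<in> S" for i
      using zK[OF that] by (simp add: Kz_def K_def sum_pker c_def)
    define k where "k = (\<lambda>a. u a - (c a - dotp p u c * u a))"
    have uk: "dotp p u k = 1" unfolding k_def dotp_linear u(1) by simp
    have "dotp p (g i) k = 0" if i: "i \<in> S" for i
    proof -
      have "dotp p (r i) k = - z i" unfolding k_def dotp_linear ru[OF i] zc[OF i] by simp
      thus ?thesis by (simp add: gd i uk)
    qed
    with inj have "\<forall>j<p. k j = 0" by blast
    hence "dotp p u k = 0" by (simp add: dotp_def)
    thus False using uk by simp
  qed
qed

section \<open>Normal equations for ordinary least squares\<close>

lemma ols_normal_equations:
  fixes X :: "real mat"
  assumes X: "X \<in> carrier_mat m p" and y: "y \<in> carrier_vec m"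
    and inj: "\<forall>c. (\<forall>i<m. dotp p (\<lambda>j. X $$ (i,j)) c = 0) \<longrightarrow> (\<forall>j<p. c j = 0)"
  shows "ols X y \<in> carrier_vec p"
    and "j < p \<Longrightarrow> (\<Sum>i<m. X $$ (i,j) * (y $ i - dotp p (\<lambda>j. X $$ (i,j)) (($) (ols X y)))) = 0"
proof -
  define G where "G = transpose_mat X * X"
  have G: "G \<in> carrier_mat p p" using X by (simp add: G_def)
  have Xt: "transpose_mat X \<in> carrier_mat p m" using X by simp
  have Gi: "mat_inv G \<in> carrier_mat p p" by (rule mat_inv_carrier[OF G])
  have h: "ols X y = mat_inv G *\<^sub>v (transpose_mat X *\<^sub>v y)"
    using assoc_mult_mat_vec[OF Gi Xt y] by (simp add: ols_def G_def)
  show hc: "ols X y \<in> carrier_vec p" using Gi Xt y unfolding h by (meson mult_mat_vec_carrier)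
  have Xv: "(X *\<^sub>v v) $ i = dotp p (\<lambda>j. X $$ (i,j)) (($) v)" if "i < m" "v \<in> carrier_vec p" for i v
    using X that by (auto simp: scalar_prod_def dotp_def atLeast0LessThan)
  have Xtv: "(transpose_mat X *\<^sub>v v) $ j = (\<Sum>i<m. X $$ (i,j) * v $ i)" if "j < p" "v \<in> carrier_vec m" for j v
    using X that by (auto simp: scalar_prod_def atLeast0LessThan)
  have "Determinant.det G \<noteq> 0"
  proof
    assume "Determinant.det G = 0"
    then obtain v where v: "v \<in> carrier_vec p" "v \<noteq> 0\<^sub>v p" "G *\<^sub>v v = 0\<^sub>v p"
      using det_0_iff_vec_prod_zero_field[OF G] by blast
    have Xvc: "X *\<^sub>v v \<in> carrier_vec m" using X v by simp
    have "0 = v \<bullet> (G *\<^sub>v v)" using v by simp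
    also have "G *\<^sub>v v = transpose_mat X *\<^sub>v (X *\<^sub>v v)"
      unfolding G_def by (rule assoc_mult_mat_vec[OF Xt X v(1)])
    also have "v \<bullet> \<dots> = (\<Sum>j<p. v $ j * (\<Sum>i<m. X $$ (i,j) * (X *\<^sub>v v) $ i))"
      using v X Xtv[OF _ Xvc] by (simp add: scalar_prod_def atLeast0LessThan del: index_mult_mat_vec)
    also have "\<dots> = (\<Sum>i<m. (X *\<^sub>v v) $ i * (X *\<^sub>v v) $ i)"
    proof -
      have "(\<Sum>j<p. v $ j * (\<Sum>i<m. X $$ (i,j) * (X *\<^sub>v v) $ i)) =
          (\<Sum>i<m. \<Sum>j<p. (X *\<^sub>v v) $ i * (X $$ (i,j) * v $ j))"
        unfolding sum_distrib_left by (subst sum.swap) (simp add: mult_ac del: index_mult_mat_vec)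
      also have "\<dots> = (\<Sum>i<m. (X *\<^sub>v v) $ i * (X *\<^sub>v v) $ i)"
        by (intro sum.cong refl) (use Xv[OF _ v(1)] in \<open>simp add: dotp_def sum_distrib_left del: index_mult_mat_vec\<close>)
      finally show ?thesis .
    qed
    finally have "(\<Sum>i<m. ((X *\<^sub>v v) $ i)\<^sup>2) = 0" by (simp add: power2_eq_square)
    hence "(X *\<^sub>v v) $ i = 0" if "i < m" for i using that by (simp add: sum_nonneg_eq_0_iff del: index_mult_mat_vec)
    hence "dotp p (\<lambda>j. X $$ (i,j)) (($) v) = 0" if "i < m" for i using Xv[OF that v(1)] that by simp
    hence "\<forall>j<p. v $ j = 0" using inj by blast
    thus False using v by auto
  qed
  note inv = mat_inv_inverse[OF G this]
  have Xh: "X *\<^sub>v ols X y \<in> carrier_vec m" using X hc by simp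
  have "G *\<^sub>v ols X y = transpose_mat X *\<^sub>v y"
    unfolding h using assoc_mult_mat_vec[OF G Gi, of "transpose_mat X *\<^sub>v y"] inv(1) Xt y by simp
  hence eq: "transpose_mat X *\<^sub>v (X *\<^sub>v ols X y) = transpose_mat X *\<^sub>v y"
    unfolding G_def using assoc_mult_mat_vec[OF Xt X hc] by simp
  assume j: "j < p"
  have "(\<Sum>i<m. X $$ (i,j) * (X *\<^sub>v ols X y) $ i) = (\<Sum>i<m. X $$ (i,j) * y $ i)"
    using Xtv[OF j Xh] Xtv[OF j y] eq by simp
  thus "(\<Sum>i<m. X $$ (i,j) * (y $ i - dotp p (\<lambda>j. X $$ (i,j)) (($) (ols X y)))) = 0"
    using Xv[OF _ hc] by (simp add: right_diff_distrib sum_subtractf del: index_mult_mat_vec)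
qed

text \<open>The restricted design lists the retained rows in increasing order; this converts sums over its rows
  into sums over \<open>S\<close>.\<close>

lemma bij_betw_pick:
  assumes "finite S"
  shows "bij_betw (pick S) {..<card S} S"
proof -
  have inj: "inj_on (pick S) {..<card S}"
  proof (rule inj_onI)
    fix i j assume "i \<in> {..<card S}" "j \<in> {..<card S}" "pick S i = pick S j"
    thus "i = j" using pick_mono_le[of i S j] pick_mono_le[of j S i] by (metis lessThan_iff less_irrefl nat_neq_iff)
  qed
  moreover have "pick S ` {..<card S} \<subseteq> S" using pick_in_set_le by auto
  ultimately show ?thesis
    using assms card_subset_eq[of S "pick S ` {..<card S}"] by (simp add: bij_betw_def card_image)
qed

lemma ols_restrict_normal_equations:
  fixes X :: "real mat"
  assumes X: "X \<in> carrier_mat n p" and y: "y \<in> carrier_vec n" and S: "S \<subseteq> {..<n}"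
    and inj: "\<forall>c. (\<forall>i\<in>S. dotp p (\<lambda>j. X $$ (i,j)) c = 0) \<longrightarrow> (\<forall>j<p. c j = 0)"
  defines "h \<equiv> ols (restrict_rows X S) (restrict_entries y S)"
  shows "h \<in> carrier_vec p"
    and "j < p \<Longrightarrow> (\<Sum>i\<in>S. X $$ (i,j) * (y $ i - dotp p (\<lambda>j. X $$ (i,j)) (($) h))) = 0"
proof -
  have fin: "finite S" using S finite_subset by blast
  note bij = bij_betw_pick[OF fin]
  have SS: "{i. i < n \<and> i \<in> S} = S" using S by auto
  define m where "m = card S"
  have R: "restrict_rows X S \<in> carrier_mat m p"
    using X by (auto simp: restrict_rows_def submatrix_def SS m_def)
  have Rij: "restrict_rows X S $$ (i,j) = X $$ (pick S i, j)" if "i < m" "j < p" for i j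
    using X that by (simp add: restrict_rows_def submatrix_def SS m_def pick_UNIV)
  have yc: "restrict_entries y S \<in> carrier_vec m" using y by (auto simp: restrict_entries_def SS m_def)
  have yi: "restrict_entries y S $ i = y $ pick S i" if "i < m" for i
    using y that by (simp add: restrict_entries_def SS m_def)
  have rd: "dotp p (\<lambda>j. restrict_rows X S $$ (i,j)) c = dotp p (\<lambda>j. X $$ (pick S i, j)) c" if "i < m" for i c
    by (rule dotp_cong) (auto simp: Rij that)
  have inj': "\<forall>c. (\<forall>i<m. dotp p (\<lambda>j. restrict_rows X S $$ (i,j)) c = 0) \<longrightarrow> (\<forall>j<p. c j = 0)"
  proof (rule allI, rule impI)
    fix c assume c: "\<forall>i<m. dotp p (\<lambda>j. restrict_rows X S $$ (i,j)) c = 0"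
    have "dotp p (\<lambda>j. X $$ (i,j)) c = 0" if i: "i \<in> S" for i
    proof -
      obtain i' where "i' < m" "i = pick S i'" using bij i by (auto simp: bij_betw_def m_def)
      thus ?thesis using c rd by simp
    qed
    thus "\<forall>j<p. c j = 0" using inj by blast
  qed
  show "h \<in> carrier_vec p" unfolding h_def by (rule ols_normal_equations(1)[OF R yc inj'])
  assume j: "j < p"
  have "(\<Sum>i\<in>S. X $$ (i,j) * (y $ i - dotp p (\<lambda>j. X $$ (i,j)) (($) h))) =
     (\<Sum>i<m. X $$ (pick S i,j) * (y $ pick S i - dotp p (\<lambda>j. X $$ (pick S i,j)) (($) h)))"
    unfolding m_def by (rule sum.reindex_bij_betw[OF bij, symmetric])
  also have "\<dots> = (\<Sum>i<m. restrict_rows X S $$ (i,j) *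
       (restrict_entries y S $ i - dotp p (\<lambda>j. restrict_rows X S $$ (i,j)) (($) h)))"
    by (intro sum.cong refl) (use j in \<open>simp add: Rij yi rd\<close>)
  also have "\<dots> = 0" unfolding h_def by (rule ols_normal_equations(2)[OF R yc inj' j])
  finally show "(\<Sum>i\<in>S. X $$ (i,j) * (y $ i - dotp p (\<lambda>j. X $$ (i,j)) (($) h))) = 0" .
qed

section \<open>Concentration of the residual form\<close>

lemma measurable_mat_inv:
  assumes A: "\<And>i j. i < p \<Longrightarrow> j < p \<Longrightarrow> (\<lambda>\<omega>. A \<omega> i j) \<in> borel_measurable M" and ij: "i < p" "j < p"
  shows "(\<lambda>\<omega>. mat_inv (mat p p (\<lambda>(i,j). A \<omega> i j)) $$ (i,j)) \<in> borel_measurable M"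
proof -
  have eq: "mat_inv (mat p p (\<lambda>(i,j). A \<omega> i j)) $$ (i,j) =
      (-1)^(j+i) * Determinant.det (mat (p-1) (p-1) (\<lambda>(i',j'). A \<omega> (if i' < j then i' else Suc i') (if j' < i then j' else Suc j')))
        / Determinant.det (mat p p (\<lambda>(i,j). A \<omega> i j))" for \<omega>
  proof -
    have "mat_delete (mat p p (\<lambda>(i,j). A \<omega> i j)) j i =
      mat (p-1) (p-1) (\<lambda>(i',j'). A \<omega> (if i' < j then i' else Suc i') (if j' < i then j' else Suc j'))"
      using ij by (intro eq_matI) (auto simp: mat_delete_def)
    thus ?thesis using ij by (subst mat_inv_cofactor[of _ p]) (auto simp: cofactor_def)
  qed
  have "(\<lambda>\<omega>. Determinant.det (mat (p-1) (p-1) (\<lambda>(i',j'). A \<omega> (if i' < j then i' else Suc i') (if j' < i then j' else Suc j')))) \<in> borel_measurable M"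
    by (rule measurable_det) (auto intro!: A)
  moreover have "(\<lambda>\<omega>. Determinant.det (mat p p (\<lambda>(i,j). A \<omega> i j))) \<in> borel_measurable M"
    by (rule measurable_det) (auto intro!: A)
  ultimately show ?thesis unfolding eq by (intro borel_measurable_divide borel_measurable_times) auto
qed

lemma measurable_pker:
  fixes r :: "'w \<Rightarrow> 'i \<Rightarrow> nat \<Rightarrow> real"
  assumes r: "\<And>i a. i \<in> S \<Longrightarrow> a < p \<Longrightarrow> (\<lambda>\<omega>. r \<omega> i a) \<in> borel_measurable M" and ij: "i \<in> S" "j \<in> S"
  shows "(\<lambda>\<omega>. pker p S (r \<omega>) u i j) \<in> borel_measurable M"
proof -
  have "(\<lambda>\<omega>. gram S (r \<omega>) u a b) \<in> borel_measurable M" if "a < p" "b < p" for a b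
    unfolding gram_def using r that by (intro borel_measurable_add borel_measurable_sum borel_measurable_times) auto
  note inv = measurable_mat_inv[of p "\<lambda>\<omega>. gram S (r \<omega>) u", OF this]
  show ?thesis
    unfolding pker_def msolve_def by (intro measurable_dotp r inv ij) auto
qed

definition perp :: "nat \<Rightarrow> (nat \<Rightarrow> real) \<Rightarrow> (nat \<Rightarrow> real) \<Rightarrow> nat \<Rightarrow> real" where
  "perp p u x = (\<lambda>a. x a - u a * dotp p u x)"

lemma dotp_perp:
  assumes "dotp p u u = 1"
  shows "dotp p u (perp p u x) = 0"
proof -
  have "perp p u x = (\<lambda>a. x a - dotp p u x * u a)" by (simp add: perp_def mult.commute)
  thus ?thesis by (simp add: dotp_linear assms)
qed

lemma distr_cong_sets:
  assumes "sets N = sets M"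
  shows "distr L N f = distr L M f"
  by (rule distr_cong) (auto simp: assms)

lemma std_gauss_uminus: "distr (std_gauss p) (std_gauss p) (\<lambda>h. \<lambda>a\<in>{..<p}. - h a) = std_gauss p"
proof -
  have "distr (std_gauss p) (std_gauss p) (\<lambda>h. \<lambda>a\<in>{..<p}. - h a) =
      distr (std_gauss p) (borel_vec p) (\<lambda>h. \<lambda>a\<in>{..<p}. - h a)"
    by (rule distr_cong_sets) (rule sets_std_gauss)
  also have "\<dots> = PiM {..<p} (\<lambda>_. distr std_normal_distribution borel uminus)"
    using distr_PiM_componentwise[of "{..<p}" "\<lambda>_. std_normal_distribution" "\<lambda>_. uminus" "\<lambda>_. borel"]
    by (simp add: prob_space_std_normal)
  finally show ?thesis by (simp only: std_normal_uminus)
qed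

lemma sum_pairs_split:
  fixes f :: "nat \<Rightarrow> nat \<Rightarrow> real"
  assumes S: "finite S"
  shows "(\<Sum>i\<in>S. \<Sum>j\<in>S. f i j) = (\<Sum>i\<in>S. f i i) + (\<Sum>e\<in>{e\<in>S\<times>S. fst e < snd e}. f (fst e) (snd e) + f (snd e) (fst e))"
proof -
  define U where "U = {e\<in>S\<times>S. fst e < snd e}"
  define F where "F = (\<lambda>e. f (fst e) (snd e))"
  let ?D = "(\<lambda>i. (i,i)) ` S"
  have fin: "finite ?D" "finite U" "finite (prod.swap ` U)" using S by (auto simp: U_def)
  have split: "S \<times> S = ?D \<union> (U \<union> prod.swap ` U)" by (auto simp: image_iff U_def)
  have d1: "?D \<inter> (U \<union> prod.swap ` U) = {}" and d2: "U \<inter> prod.swap ` U = {}" by (auto simp: U_def)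
  have "(\<Sum>i\<in>S. \<Sum>j\<in>S. f i j) = sum F (S \<times> S)"
    by (simp add: sum.cartesian_product case_prod_beta F_def)
  also have "\<dots> = sum F ?D + (sum F U + sum F (prod.swap ` U))"
    unfolding split sum.union_disjoint[OF fin(1) finite_UnI[OF fin(2,3)] d1] sum.union_disjoint[OF fin(2,3) d2] ..
  also have "sum F ?D = (\<Sum>i\<in>S. f i i)"
    by (subst sum.reindex) (auto simp: inj_on_def F_def)
  also have "sum F (prod.swap ` U) = (\<Sum>e\<in>U. f (snd e) (fst e))"
    by (subst sum.reindex) (auto simp: inj_on_def F_def)
  finally show ?thesis by (simp add: sum.distrib U_def F_def)
qed

text \<open>Independent Gaussian rows \<open>h\<^sub>i\<close> whose parts across the unit vector \<open>u\<close>, for \<open>i \<in> S\<close>, span the nuisance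
  directions; \<open>K h\<close> is the kernel of the projection onto their column space. Its law is invariant under
  permutations and sign changes of the rows, and only these symmetries enter the moment bounds.\<close>

locale gaussian_rows =
  fixes p n :: nat and S :: "nat set" and u :: "nat \<Rightarrow> real"
  assumes u: "dotp p u u = 1" and S: "S \<subseteq> {..<n}"
begin

abbreviation rows :: "(nat \<Rightarrow> nat \<Rightarrow> real) measure" where
  "rows \<equiv> PiM {..<n} (\<lambda>_. std_gauss p)"

definition K :: "(nat \<Rightarrow> nat \<Rightarrow> real) \<Rightarrow> nat \<Rightarrow> nat \<Rightarrow> real" where
  "K h = pker p S (\<lambda>i. perp p u (h i)) u"

lemma finite_S: "finite S" using S finite_subset by blast

sublocale P: prob_space rows
  by (intro prob_space_PiM prob_space_std_gauss)

lemma measurable_entry: "i < n \<Longrightarrow> a < p \<Longrightarrow> (\<lambda>h. h i a) \<in> borel_measurable rows"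
  by (rule measurable_compose[OF measurable_component_singleton[of i]])
     (auto intro: measurable_compose[OF measurable_component_singleton])

lemma measurable_K [measurable]: "i \<in> S \<Longrightarrow> j \<in> S \<Longrightarrow> (\<lambda>h. K h i j) \<in> borel_measurable rows"
  unfolding K_def perp_def using S
  by (intro measurable_pker borel_measurable_diff borel_measurable_times measurable_dotp measurable_entry) auto

lemma K_bounds:
  assumes "i \<in> S" "j \<in> S"
  shows "0 \<le> K h i i" "K h i i \<le> 1" "\<bar>K h i j\<bar> \<le> 1"
  unfolding K_def using assms by (intro pker_bounds[OF finite_S u] dotp_perp u; simp)+

lemma K_sym: "K h i j = K h j i"
  unfolding K_def by (rule pker_sym)

lemma K_squares: "i \<in> S \<Longrightarrow> (\<Sum>j\<in>S. (K h i j)\<^sup>2) = K h i i"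
  unfolding K_def by (intro pker_squares u dotp_perp)

lemma integrable_K2:
  assumes "i \<in> S" "j \<in> S" "k \<in> S" "l \<in> S"
  shows "integrable rows (\<lambda>h. K h i j * K h k l)"
proof (rule P.integrable_const_bound[where B = 1])
  have "\<bar>K h i j\<bar> * \<bar>K h k l\<bar> \<le> 1 * 1" for h by (intro mult_mono K_bounds assms) auto
  thus "AE h in rows. norm (K h i j * K h k l) \<le> 1" by (simp add: abs_mult)
  show "(\<lambda>h. K h i j * K h k l) \<in> borel_measurable rows" using assms by measurable
qed

definition flip :: "nat \<Rightarrow> (nat \<Rightarrow> nat \<Rightarrow> real) \<Rightarrow> nat \<Rightarrow> nat \<Rightarrow> real" where
  "flip l h = (\<lambda>i\<in>{..<n}. (if i = l then (\<lambda>x. \<lambda>a\<in>{..<p}. - x a) else (\<lambda>x. x)) (h i))"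

lemma measurable_neg: "(\<lambda>x. \<lambda>a\<in>{..<p}. - x a) \<in> measurable (std_gauss p) (std_gauss p)"
  by (rule measurable_restrict) measurable

lemma distr_flip: "distr rows rows (flip l) = rows"
proof -
  let ?f = "\<lambda>i. if i = l then (\<lambda>x. \<lambda>a\<in>{..<p}. - x a) else (\<lambda>x::nat\<Rightarrow>real. x)"
  have "distr rows rows (flip l) = PiM {..<n} (\<lambda>i. distr (std_gauss p) (std_gauss p) (?f i))"
    unfolding flip_def using measurable_neg
    by (intro distr_PiM_componentwise) (auto intro: prob_space_std_gauss)
  also have "\<dots> = rows" by (intro PiM_cong refl) (simp add: std_gauss_uminus)
  finally show ?thesis .
qed

lemma measurable_flip: "flip l \<in> measurable rows rows"
proof -
  have "(\<lambda>h. (if i = l then (\<lambda>x. \<lambda>a\<in>{..<p}. - x a) else (\<lambda>x. x)) (h i)) \<in> measurable rows (std_gauss p)"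
    if "i \<in> {..<n}" for i
    using measurable_compose[OF measurable_component_singleton[OF that] measurable_neg]
      measurable_component_singleton[OF that] by (cases "i = l") auto
  thus ?thesis unfolding flip_def by (rule measurable_restrict)
qed

lemma K_flip:
  assumes "i \<in> S" "j \<in> S"
  shows "K (flip l h) i j = (if i = l then -1 else 1) * (if j = l then -1 else 1) * K h i j"
  unfolding K_def
proof (rule pker_sign_flip)
  fix i a assume i: "i \<in> S" and a: "a < p"
  have "dotp p u (flip l h i) = (if i = l then -1 else 1) * dotp p u (h i)"
  proof -
    have "dotp p u (flip l h i) = dotp p u (\<lambda>a. (if i = l then -1 else 1) * h i a)"
      using i S by (intro dotp_cong) (auto simp: flip_def)
    thus ?thesis by (simp only: dotp_scale_right)
  qed
  thus "perp p u (flip l h i) a = (if i = l then -1 else 1) * perp p u (h i) a"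
    using i a S by (auto simp: perp_def flip_def)
qed (use assms in auto)

lemma expectation_distinct_pairs:
  assumes ij: "i \<in> S" "j \<in> S" "i \<noteq> j" and kl: "k \<in> S" "l \<in> S" "k \<noteq> l" and ne: "{i,j} \<noteq> {k,l}"
  shows "P.expectation (\<lambda>h. K h i j * K h k l) = 0"
proof -
  \<comment> \<open>a vertex of the first edge outside the second: flipping its row changes the sign\<close>
  obtain m where m: "m \<in> {i,j}" "m \<notin> {k,l}" using ij kl ne by auto
  have "P.expectation (\<lambda>h. K h i j * K h k l) = (\<integral>h. K h i j * K h k l \<partial>distr rows rows (flip m))"
    by (simp only: distr_flip)
  also have "\<dots> = P.expectation (\<lambda>h. K (flip m h) i j * K (flip m h) k l)"
    using ij kl by (intro integral_distr measurable_flip) measurable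
  also have "\<dots> = P.expectation (\<lambda>h. - (K h i j * K h k l))"
    using m ij kl by (intro Bochner_Integration.integral_cong refl) (auto simp: K_flip)
  finally show ?thesis by simp
qed

lemma expectation_permute:
  assumes f: "bij_betw f {..<n} {..<n}" "bij_betw f S S" and ij: "i \<in> S" "j \<in> S" "k \<in> S" "l \<in> S"
  shows "P.expectation (\<lambda>h. K h (f i) (f j) * K h (f k) (f l)) = P.expectation (\<lambda>h. K h i j * K h k l)"
proof -
  define t where "t = (\<lambda>h::nat\<Rightarrow>nat\<Rightarrow>real. \<lambda>m\<in>{..<n}. h (f m))"
  have fn: "f \<in> {..<n} \<rightarrow> {..<n}" "inj_on f {..<n}" using f(1) by (auto simp: bij_betw_def)
  have d: "distr rows rows t = rows"
    unfolding t_def using distr_PiM_reindex[of "{..<n}" "\<lambda>_. std_gauss p" f "{..<n}", OF prob_space_std_gauss fn(2,1)] .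
  have t: "t \<in> measurable rows rows"
    unfolding t_def using fn(1) by (intro measurable_restrict measurable_component_singleton) auto
  have Kt: "K (t h) i j = K h (f i) (f j)" if "i \<in> S" "j \<in> S" for h i j
    unfolding K_def
    by (rule pker_permute[OF f(2)]) (use that S in \<open>auto simp: t_def perp_def\<close>)
  have "P.expectation (\<lambda>h. K h i j * K h k l) = (\<integral>h. K h i j * K h k l \<partial>distr rows rows t)"
    by (simp only: d)
  also have "\<dots> = P.expectation (\<lambda>h. K (t h) i j * K (t h) k l)"
    using ij by (intro integral_distr t) measurable
  finally show ?thesis using ij by (simp add: Kt)
qed

lemma exchange_pairs:
  assumes "i \<in> S" "j \<in> S" "i \<noteq> j" "i' \<in> S" "j' \<in> S" "i' \<noteq> j'"
  shows "\<exists>f. bij_betw f {..<n} {..<n} \<and> bij_betw f S S \<and> f i = i' \<and> f j = j'"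
proof -
  let ?t = "Transposition.transpose i i'"
  let ?f = "Transposition.transpose (?t j) j' \<circ> ?t"
  have tj: "?t j \<in> S" "?t j \<noteq> i'" using assms by (auto simp: Transposition.transpose_def)
  have b: "bij_betw (Transposition.transpose a b) A A" if "a \<in> A" "b \<in> A" for a b :: nat and A
    using that by (intro bij_betw_byWitness[where f' = "Transposition.transpose a b"])
      (auto simp: Transposition.transpose_def)
  have "bij_betw ?f A A" if "S \<subseteq> A" for A
    by (rule bij_betw_trans[OF b b]) (use assms tj that in auto)
  moreover have "?f i = i'" "?f j = j'" using assms tj by (auto simp: Transposition.transpose_def)
  ultimately show ?thesis using S by blast
qed

text \<open>All off-diagonal entries have the same second moment, and the squares in each row of a projection
  sum to at most \<open>1\<close>.\<close>

lemma expectation_off_diagonal: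
  assumes "i \<in> S" "j \<in> S" "i \<noteq> j"
  shows "P.expectation (\<lambda>h. (K h i j)\<^sup>2) \<le> 1 / (real (card S) - 1)"
proof -
  define N where "N = card S"
  have N2: "N \<ge> 2" using assms finite_S card_mono[of S "{i,j}"] by (simp add: N_def)
  define c where "c = P.expectation (\<lambda>h. (K h i j)\<^sup>2)"
  have eq: "P.expectation (\<lambda>h. K h k l * K h k l) = c" if kl: "k \<in> S" "l \<in> S" "k \<noteq> l" for k l
  proof -
    obtain f where f: "bij_betw f {..<n} {..<n}" "bij_betw f S S" "f i = k" "f j = l"
      using exchange_pairs[OF assms kl] by blast
    from expectation_permute[OF f(1,2) assms(1,2) assms(1,2)] f(3,4)
    show ?thesis by (simp add: c_def power2_eq_square)
  qed
  have "real (N * (N - 1)) * c = (\<Sum>k\<in>S. \<Sum>l\<in>S-{k}. P.expectation (\<lambda>h. K h k l * K h k l))"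
  proof -
    have "(\<Sum>k\<in>S. \<Sum>l\<in>S-{k}. P.expectation (\<lambda>h. K h k l * K h k l)) = (\<Sum>k\<in>S. \<Sum>l\<in>S-{k}. c)"
      by (intro sum.cong refl eq) auto
    thus ?thesis using finite_S by (simp add: N_def)
  qed
  also have "\<dots> \<le> (\<Sum>k\<in>S. \<Sum>l\<in>S. P.expectation (\<lambda>h. K h k l * K h k l))"
    using finite_S by (intro sum_mono sum_mono2) auto
  also have "\<dots> = P.expectation (\<lambda>h. \<Sum>k\<in>S. \<Sum>l\<in>S. K h k l * K h k l)"
    by (simp add: integrable_K2)
  also have "\<dots> \<le> P.expectation (\<lambda>h. real N)"
  proof (rule integral_mono)
    fix h
    have "(\<Sum>k\<in>S. \<Sum>l\<in>S. K h k l * K h k l) = (\<Sum>k\<in>S. K h k k)"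
      by (intro sum.cong refl) (simp add: K_squares power2_eq_square[symmetric])
    also have "\<dots> \<le> (\<Sum>k\<in>S. 1)" by (intro sum_mono K_bounds)
    finally show "(\<Sum>k\<in>S. \<Sum>l\<in>S. K h k l * K h k l) \<le> real N" by (simp add: N_def)
  qed (auto intro!: Bochner_Integration.integrable_sum integrable_K2)
  finally have "real N * (real (N - 1) * c) \<le> real N * 1" by (simp add: P.prob_space mult.assoc)
  hence "real (N - 1) * c \<le> 1" using N2 by (subst (asm) mult_le_cancel_left_pos) auto
  thus ?thesis using N2 by (simp add: c_def N_def field_simps of_nat_diff)
qed

text \<open>The weights are centred, so by exchangeability only the difference \<open>E[K\<^sub>i\<^sub>i\<^sup>2] - E[K\<^sub>i\<^sub>i K\<^sub>j\<^sub>j] \<le> 1\<close>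
  survives.\<close>

lemma second_moment_diagonal:
  assumes N2: "2 \<le> card S"
  shows "P.expectation (\<lambda>h. (\<Sum>i\<in>S. (c i - (\<Sum>k\<in>S. c k) / card S) * K h i i)\<^sup>2) \<le> (\<Sum>i\<in>S. (c i)\<^sup>2)"
proof -
  define m where "m = (\<Sum>k\<in>S. c k) / card S"
  define d where "d = (\<lambda>i. c i - m)"
  have N0: "real (card S) > 0" using N2 by simp
  have "\<exists>i j. i \<in> S \<and> j \<in> S \<and> i \<noteq> j"
  proof (rule ccontr)
    assume "\<not> ?thesis"
    hence "is_singleton S \<or> S = {}" by (metis is_singletonI' )
    thus False using N2 by (auto simp: is_singleton_altdef)
  qed
  then obtain i0 j0 where ij: "i0 \<in> S" "j0 \<in> S" "i0 \<noteq> j0" by blast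
  define A where "A = P.expectation (\<lambda>h. K h i0 i0 * K h i0 i0)"
  define B where "B = P.expectation (\<lambda>h. K h i0 i0 * K h j0 j0)"
  have EB: "P.expectation (\<lambda>h. K h i i * K h k k) = (if i = k then A - B else 0) + B" if ik: "i \<in> S" "k \<in> S" for i k
  proof (cases "i = k")
    case True
    obtain k' where "k' \<in> S" "k' \<noteq> i" using ij by metis
    then obtain f where f: "bij_betw f {..<n} {..<n}" "bij_betw f S S" "f i0 = i"
      using exchange_pairs[OF ij, of i k'] ik by metis
    from expectation_permute[OF f(1,2) ij(1,1,1,1)] True f(3) show ?thesis by (simp add: A_def)
  next
    case False
    then obtain f where f: "bij_betw f {..<n} {..<n}" "bij_betw f S S" "f i0 = i" "f j0 = k"
      using exchange_pairs[OF ij ik] by blast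
    from expectation_permute[OF f(1,2) ij(1,1,2,2)] False f(3,4) show ?thesis by (simp add: B_def)
  qed
  have "B \<ge> 0" unfolding B_def using ij by (intro Bochner_Integration.integral_nonneg) (simp add: K_bounds)
  moreover have "A \<le> 1"
  proof -
    have "A \<le> P.expectation (\<lambda>h. 1)"
      unfolding A_def using ij
      by (intro integral_mono integrable_K2) (auto intro!: mult_le_one K_bounds)
    thus ?thesis by (simp add: P.prob_space)
  qed
  ultimately have AB: "A - B \<le> 1" by simp
  have sd: "(\<Sum>i\<in>S. d i) = 0" using N0 by (simp add: d_def sum_subtractf m_def)
  have "P.expectation (\<lambda>h. (\<Sum>i\<in>S. d i * K h i i)\<^sup>2) =
      P.expectation (\<lambda>h. \<Sum>i\<in>S. \<Sum>k\<in>S. d i * d k * (K h i i * K h k k))"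
    by (simp add: power2_eq_square sum_product mult_ac)
  also have "\<dots> = (\<Sum>i\<in>S. \<Sum>k\<in>S. d i * d k * P.expectation (\<lambda>h. K h i i * K h k k))"
    by (simp add: integrable_K2)
  also have "\<dots> = (\<Sum>i\<in>S. \<Sum>k\<in>S. (if k = i then (A - B) * (d i)\<^sup>2 else 0) + B * (d i * d k))"
    by (intro sum.cong refl) (simp add: EB power2_eq_square algebra_simps)
  also have "\<dots> = (\<Sum>i\<in>S. (A - B) * (d i)\<^sup>2 + B * (d i * (\<Sum>k\<in>S. d k)))"
    using finite_S by (intro sum.cong refl) (simp add: sum.distrib sum_distrib_left)
  also have "\<dots> = (A - B) * (\<Sum>i\<in>S. (d i)\<^sup>2)" by (simp only: sd sum_distrib_left) simp
  also have "\<dots> \<le> (\<Sum>i\<in>S. (d i)\<^sup>2)"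
    using AB mult_right_mono[OF AB, of "\<Sum>i\<in>S. (d i)\<^sup>2"] by (simp add: sum_nonneg)
  also have "\<dots> = (\<Sum>i\<in>S. (c i)\<^sup>2) - real (card S) * m\<^sup>2"
  proof -
    have "(\<Sum>i\<in>S. (d i)\<^sup>2) = (\<Sum>i\<in>S. (c i)\<^sup>2 - 2 * m * c i + m\<^sup>2)"
      by (simp add: d_def power2_diff algebra_simps)
    also have "\<dots> = (\<Sum>i\<in>S. (c i)\<^sup>2) - 2 * m * (\<Sum>i\<in>S. c i) + real (card S) * m\<^sup>2"
      by (simp add: sum.distrib sum_subtractf sum_distrib_left)
    also have "(\<Sum>i\<in>S. c i) = real (card S) * m" using N0 by (simp add: m_def)
    finally show ?thesis by (simp add: power2_eq_square)
  qed
  also have "\<dots> \<le> (\<Sum>i\<in>S. (c i)\<^sup>2)" by simp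
  finally show ?thesis by (simp add: d_def m_def)
qed

text \<open>Distinct unordered pairs are uncorrelated; the sum runs over \<open>i < j\<close> so that each pair occurs once,
  with both of its coefficients.\<close>

lemma second_moment_off_diagonal:
  assumes N2: "2 \<le> card S"
  shows "P.expectation (\<lambda>h. (\<Sum>e\<in>{e\<in>S\<times>S. fst e < snd e}. (a (fst e) * b (snd e) + a (snd e) * b (fst e)) * K h (fst e) (snd e))\<^sup>2)
     \<le> 2 * (\<Sum>i\<in>S. (a i)\<^sup>2) * (\<Sum>i\<in>S. (b i)\<^sup>2) / (real (card S) - 1)"
proof -
  define U where "U = {e\<in>S\<times>S. fst e < snd e}"
  define m where "m = (\<lambda>e. a (fst e) * b (snd e) + a (snd e) * b (fst e))"
  define Ke where "Ke = (\<lambda>h e. K h (fst e) (snd e))"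
  define C where "C = 1 / (real (card S) - 1)"
  have C: "C \<ge> 0" using N2 by (simp add: C_def)
  have U: "finite U" "\<And>e. e \<in> U \<Longrightarrow> fst e \<in> S \<and> snd e \<in> S \<and> fst e \<noteq> snd e"
    using finite_S by (auto simp: U_def)
  have orth: "P.expectation (\<lambda>h. Ke h e * Ke h f) = 0" if e: "e \<in> U" and f: "f \<in> U" and ne: "e \<noteq> f" for e f
    unfolding Ke_def
  proof (rule expectation_distinct_pairs)
    show "{fst e, snd e} \<noteq> {fst f, snd f}"
      using e f ne by (cases e, cases f) (auto simp: U_def doubleton_eq_iff)
  qed (use U(2)[OF e] U(2)[OF f] in auto)
  have int: "integrable rows (\<lambda>h. Ke h e * Ke h f)" if "e \<in> U" "f \<in> U" for e f
    unfolding Ke_def using U(2)[OF that(1)] U(2)[OF that(2)] by (intro integrable_K2) auto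
  have "P.expectation (\<lambda>h. (\<Sum>e\<in>U. m e * Ke h e)\<^sup>2) =
      P.expectation (\<lambda>h. \<Sum>e\<in>U. \<Sum>f\<in>U. m e * m f * (Ke h e * Ke h f))"
    by (simp add: power2_eq_square sum_product mult_ac)
  also have "\<dots> = (\<Sum>e\<in>U. \<Sum>f\<in>U. m e * m f * P.expectation (\<lambda>h. Ke h e * Ke h f))"
    by (simp add: int)
  also have "\<dots> = (\<Sum>e\<in>U. \<Sum>f\<in>U. if f = e then (m e)\<^sup>2 * P.expectation (\<lambda>h. (Ke h e)\<^sup>2) else 0)"
    using orth by (intro sum.cong refl) (auto simp: power2_eq_square)
  also have "\<dots> = (\<Sum>e\<in>U. (m e)\<^sup>2 * P.expectation (\<lambda>h. (Ke h e)\<^sup>2))"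
    using U(1) by simp
  also have "\<dots> \<le> (\<Sum>e\<in>U. (m e)\<^sup>2 * C)"
    unfolding Ke_def C_def using U(2) by (intro sum_mono mult_left_mono expectation_off_diagonal) auto
  also have "\<dots> = C * (\<Sum>e\<in>U. (m e)\<^sup>2)" by (simp add: sum_distrib_left mult.commute)
  also have "\<dots> \<le> C * (2 * ((\<Sum>i\<in>S. (a i)\<^sup>2) * (\<Sum>i\<in>S. (b i)\<^sup>2)))"
  proof (rule mult_left_mono[OF _ C])
    have "(\<Sum>e\<in>U. (m e)\<^sup>2) \<le> (\<Sum>e\<in>U. 2 * ((a (fst e))\<^sup>2 * (b (snd e))\<^sup>2 + (a (snd e))\<^sup>2 * (b (fst e))\<^sup>2))"
    proof (rule sum_mono)
      fix e :: "nat \<times> nat"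
      have "0 \<le> (a (fst e) * b (snd e) - a (snd e) * b (fst e))\<^sup>2" by simp
      thus "(m e)\<^sup>2 \<le> 2 * ((a (fst e))\<^sup>2 * (b (snd e))\<^sup>2 + (a (snd e))\<^sup>2 * (b (fst e))\<^sup>2)"
        unfolding m_def power2_eq_square by (simp add: algebra_simps)
    qed
    also have "\<dots> \<le> 2 * (\<Sum>i\<in>S. \<Sum>j\<in>S. (a i)\<^sup>2 * (b j)\<^sup>2)"
    proof -
      have "0 \<le> (\<Sum>i\<in>S. (a i)\<^sup>2 * (b i)\<^sup>2)" by (simp add: sum_nonneg)
      thus ?thesis
        using sum_pairs_split[OF finite_S, of "\<lambda>i j. (a i)\<^sup>2 * (b j)\<^sup>2"]
        unfolding U_def[symmetric] sum_distrib_left[symmetric] by linarith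
    qed
    finally show "(\<Sum>e\<in>U. (m e)\<^sup>2) \<le> 2 * ((\<Sum>i\<in>S. (a i)\<^sup>2) * (\<Sum>i\<in>S. (b i)\<^sup>2))"
      by (simp add: sum_product)
  qed
  finally show ?thesis by (simp add: U_def m_def Ke_def C_def)
qed

lemma
  assumes N2: "2 \<le> card S"
  shows integrable_form_square: "integrable rows (\<lambda>h. ((\<Sum>i\<in>S. a i * (\<Sum>j\<in>S. K h i j * b j))
            - (\<Sum>i\<in>S. K h i i) / card S * (\<Sum>i\<in>S. a i * b i))\<^sup>2)"
    and expectation_form_square: "P.expectation (\<lambda>h. ((\<Sum>i\<in>S. a i * (\<Sum>j\<in>S. K h i j * b j))
            - (\<Sum>i\<in>S. K h i i) / card S * (\<Sum>i\<in>S. a i * b i))\<^sup>2)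
     \<le> 4 * (\<Sum>i\<in>S. (a i)\<^sup>2) * (\<Sum>i\<in>S. (b i)\<^sup>2) / (real (card S) - 1) + 2 * (\<Sum>i\<in>S. (a i * b i)\<^sup>2)"
proof -
  define U where "U = {e\<in>S\<times>S. fst e < snd e}"
  have U: "finite U" "\<And>e. e \<in> U \<Longrightarrow> fst e \<in> S \<and> snd e \<in> S"
    using finite_S by (auto simp: U_def)
  define Off where "Off = (\<lambda>h. \<Sum>e\<in>U. (a (fst e) * b (snd e) + a (snd e) * b (fst e)) * K h (fst e) (snd e))"
  define Dia where "Dia = (\<lambda>h. \<Sum>i\<in>S. (a i * b i - (\<Sum>k\<in>S. a k * b k) / card S) * K h i i)"
  define X where "X = (\<lambda>h. (\<Sum>i\<in>S. a i * (\<Sum>j\<in>S. K h i j * b j)) - (\<Sum>i\<in>S. K h i i) / card S * (\<Sum>i\<in>S. a i * b i))"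
  have X: "X h = Off h + Dia h" for h
  proof -
    have "(\<Sum>i\<in>S. a i * (\<Sum>j\<in>S. K h i j * b j)) = (\<Sum>i\<in>S. \<Sum>j\<in>S. a i * b j * K h i j)"
      by (simp add: sum_distrib_left mult_ac)
    also have "\<dots> = (\<Sum>i\<in>S. a i * b i * K h i i) + Off h"
    proof -
      have "a i * b j * K h i j + a j * b i * K h j i = (a i * b j + a j * b i) * K h i j" for i j
        using K_sym[of h i j] by (simp add: algebra_simps)
      thus ?thesis unfolding sum_pairs_split[OF finite_S] Off_def U_def by simp
    qed
    moreover have "Dia h = (\<Sum>i\<in>S. a i * b i * K h i i) - (\<Sum>k\<in>S. a k * b k) / card S * (\<Sum>i\<in>S. K h i i)"
      unfolding Dia_def left_diff_distrib sum_subtractf sum_distrib_left ..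
    ultimately show ?thesis by (simp add: X_def)
  qed
  have sq_int: "integrable rows (\<lambda>h. (\<Sum>e\<in>I. c e * K h (s e) (t e))\<^sup>2)"
    if "finite I" "\<And>e. e \<in> I \<Longrightarrow> s e \<in> S \<and> t e \<in> S" for I :: "'e set" and c s t
  proof -
    have "(\<lambda>h. (\<Sum>e\<in>I. c e * K h (s e) (t e))\<^sup>2) =
       (\<lambda>h. \<Sum>e\<in>I. \<Sum>f\<in>I. c e * c f * (K h (s e) (t e) * K h (s f) (t f)))"
      by (simp add: power2_eq_square sum_product mult_ac)
    moreover have "integrable rows (\<lambda>h. \<Sum>e\<in>I. \<Sum>f\<in>I. c e * c f * (K h (s e) (t e) * K h (s f) (t f)))"
      using that by (intro Bochner_Integration.integrable_sum integrable_mult_right integrable_K2) auto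
    ultimately show ?thesis by simp
  qed
  have iO: "integrable rows (\<lambda>h. (Off h)\<^sup>2)" unfolding Off_def using U by (rule sq_int)
  have iD: "integrable rows (\<lambda>h. (Dia h)\<^sup>2)" unfolding Dia_def using finite_S by (rule sq_int) auto
  have dom: "(X h)\<^sup>2 \<le> 2 * (Off h)\<^sup>2 + 2 * (Dia h)\<^sup>2" for h
  proof -
    have "0 \<le> (Off h - Dia h)\<^sup>2" by simp
    thus ?thesis unfolding X power2_eq_square by (simp add: algebra_simps)
  qed
  have iOD: "integrable rows (\<lambda>h. 2 * (Off h)\<^sup>2 + 2 * (Dia h)\<^sup>2)" using iO iD by simp
  have iX: "integrable rows (\<lambda>h. (X h)\<^sup>2)"
  proof (rule Bochner_Integration.integrable_bound[OF iOD])
    have "Off \<in> borel_measurable rows" "Dia \<in> borel_measurable rows"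
      unfolding Off_def Dia_def using U(2)
      by (intro borel_measurable_sum borel_measurable_times measurable_K; simp)+
    thus "(\<lambda>h. (X h)\<^sup>2) \<in> borel_measurable rows" unfolding X by measurable
    show "AE h in rows. norm ((X h)\<^sup>2) \<le> norm (2 * (Off h)\<^sup>2 + 2 * (Dia h)\<^sup>2)"
    proof (rule AE_I2)
      fix h
      have "norm ((X h)\<^sup>2) = (X h)\<^sup>2" by simp
      also note dom
      also have "2 * (Off h)\<^sup>2 + 2 * (Dia h)\<^sup>2 \<le> norm (2 * (Off h)\<^sup>2 + 2 * (Dia h)\<^sup>2)" by simp
      finally show "norm ((X h)\<^sup>2) \<le> norm (2 * (Off h)\<^sup>2 + 2 * (Dia h)\<^sup>2)" .
    qed
  qed
  thus "integrable rows (\<lambda>h. ((\<Sum>i\<in>S. a i * (\<Sum>j\<in>S. K h i j * b j))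
            - (\<Sum>i\<in>S. K h i i) / card S * (\<Sum>i\<in>S. a i * b i))\<^sup>2)" by (simp add: X_def)
  have "P.expectation (\<lambda>h. (X h)\<^sup>2) \<le> P.expectation (\<lambda>h. 2 * (Off h)\<^sup>2 + 2 * (Dia h)\<^sup>2)"
    by (rule integral_mono[OF iX iOD dom])
  also have "\<dots> = 2 * P.expectation (\<lambda>h. (Off h)\<^sup>2) + 2 * P.expectation (\<lambda>h. (Dia h)\<^sup>2)"
    using iO iD by simp
  also have "\<dots> \<le> 2 * (2 * (\<Sum>i\<in>S. (a i)\<^sup>2) * (\<Sum>i\<in>S. (b i)\<^sup>2) / (real (card S) - 1)) + 2 * (\<Sum>i\<in>S. (a i * b i)\<^sup>2)"
    using second_moment_off_diagonal[OF N2, of a b] second_moment_diagonal[OF N2, of "\<lambda>i. a i * b i"]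
    by (intro add_mono mult_left_mono) (simp_all add: Off_def Dia_def U_def)
  finally show "P.expectation (\<lambda>h. ((\<Sum>i\<in>S. a i * (\<Sum>j\<in>S. K h i j * b j))
            - (\<Sum>i\<in>S. K h i i) / card S * (\<Sum>i\<in>S. a i * b i))\<^sup>2)
     \<le> 4 * (\<Sum>i\<in>S. (a i)\<^sup>2) * (\<Sum>i\<in>S. (b i)\<^sup>2) / (real (card S) - 1) + 2 * (\<Sum>i\<in>S. (a i * b i)\<^sup>2)"
    by (simp add: X_def)
qed

text \<open>The form of the projection minus its trace share. The trace is \<open>p - 1\<close> whenever the Gram matrix is nonsingular, so this is then the
  fluctuation of the residual form about \<open>(1 - (p - 1) / |S|) \<Sum>\<^sub>S a\<^sub>i b\<^sub>i\<close>, with the sign reversed.\<close>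

definition form_deviation :: "(nat \<Rightarrow> real) \<Rightarrow> (nat \<Rightarrow> real) \<Rightarrow> (nat \<Rightarrow> nat \<Rightarrow> real) \<Rightarrow> real" where
  "form_deviation a b h = (\<Sum>i\<in>S. a i * (\<Sum>j\<in>S. K h i j * b j))
            - (\<Sum>i\<in>S. K h i i) / card S * (\<Sum>i\<in>S. a i * b i)"

lemma measurable_form_deviation [measurable]: "form_deviation a b \<in> borel_measurable rows"
  unfolding form_deviation_def by measurable

lemma form_deviation_tail:
  assumes N2: "2 \<le> card S" and t: "t > 0"
    and V: "4 * (\<Sum>i\<in>S. (a i)\<^sup>2) * (\<Sum>i\<in>S. (b i)\<^sup>2) / (real (card S) - 1) + 2 * (\<Sum>i\<in>S. (a i * b i)\<^sup>2) \<le> V"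
  shows "P.prob {h \<in> space rows. t \<le> \<bar>form_deviation a b h\<bar>} \<le> V / t\<^sup>2"
proof -
  have "P.prob {h \<in> space rows. t \<le> \<bar>form_deviation a b h\<bar>} \<le> P.expectation (\<lambda>h. (form_deviation a b h)\<^sup>2) / t\<^sup>2"
  proof (rule P.second_moment_method[OF _ _ t])
    show "integrable rows (\<lambda>h. (form_deviation a b h)\<^sup>2)"
      unfolding form_deviation_def by (rule integrable_form_square[OF N2])
  qed measurable
  also have "\<dots> \<le> V / t\<^sup>2"
    using expectation_form_square[OF N2, of a b] V by (intro divide_right_mono) (auto simp: form_deviation_def)
  finally show ?thesis .
qed

end

section \<open>Selecting a subset of small total weight\<close>

lemma smallest_subset_exists:
  fixes w :: "'i \<Rightarrow> real"
  assumes I: "finite I" and m: "m \<le> card I"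
  shows "\<exists>S\<subseteq>I. card S = m \<and> (\<forall>i\<in>S. \<forall>j\<in>I-S. w i \<le> w j)"
  using m
proof (induction m)
  case (Suc m)
  then obtain S where S: "S \<subseteq> I" "card S = m" "\<forall>i\<in>S. \<forall>j\<in>I-S. w i \<le> w j" by auto
  have "finite (I - S)" "I - S \<noteq> {}" using S Suc.prems I by auto
  then obtain k where k: "k \<in> I - S" "\<forall>j\<in>I-S. w k \<le> w j"
    by (metis (no_types, lifting) arg_min_if_finite(1) arg_min_least)
  have "card (insert k S) = Suc m" using S k I finite_subset by (subst card_insert_disjoint) auto
  thus ?case using S k by (intro exI[of _ "insert k S"]) auto
qed (intro exI[of _ "{}"], auto)

text \<open>Integrality of the knapsack relaxation: fractional weights can be rounded to a set of
  indices without increasing the total.\<close>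

lemma fractional_subset_rounding:
  fixes w \<phi> :: "'i \<Rightarrow> real"
  assumes I: "finite I" and \<phi>: "\<And>i. i \<in> I \<Longrightarrow> 0 \<le> \<phi> i \<and> \<phi> i \<le> 1" and m: "(\<Sum>i\<in>I. \<phi> i) = real m"
  shows "\<exists>S\<subseteq>I. card S = m \<and> (\<Sum>i\<in>S. w i) \<le> (\<Sum>i\<in>I. \<phi> i * w i)"
proof -
  have "(\<Sum>i\<in>I. \<phi> i) \<le> (\<Sum>i\<in>I. 1)" using \<phi> by (intro sum_mono) auto
  hence "m \<le> card I" using m by simp
  then obtain S where S: "S \<subseteq> I" "card S = m" "\<And>i j. i \<in> S \<Longrightarrow> j \<in> I - S \<Longrightarrow> w i \<le> w j"
    using smallest_subset_exists[OF I, of m w] by blast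
  have finS: "finite S" using S I finite_subset by blast
  obtain t where t: "\<And>i. i \<in> S \<Longrightarrow> w i \<le> t" "\<And>j. j \<in> I - S \<Longrightarrow> t \<le> w j"
  proof (cases "S = {}")
    case True
    show thesis
    proof (cases "I = {}")
      case False
      show thesis by (rule that[of "Min (w ` I)"]) (use True I in auto)
    qed (use True that in auto)
  next
    case False
    show thesis by (rule that[of "Max (w ` S)"]) (use False finS S in auto)
  qed
  have "0 \<le> (\<Sum>i\<in>I. (\<phi> i - indicator S i) * (w i - t))"
  proof (rule sum_nonneg)
    fix i assume i: "i \<in> I"
    show "0 \<le> (\<phi> i - indicator S i) * (w i - t)"
    proof (cases "i \<in> S")
      case True
      thus ?thesis using \<phi>[OF i] t(1)[OF True] by (simp add: mult_nonpos_nonpos)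
    next
      case False
      thus ?thesis using \<phi>[OF i] t(2)[of i] i by simp
    qed
  qed
  also have "\<dots> = (\<Sum>i\<in>I. \<phi> i * w i) - (\<Sum>i\<in>I. indicator S i * w i) - t * ((\<Sum>i\<in>I. \<phi> i) - (\<Sum>i\<in>I. indicator S i))"
    by (simp add: algebra_simps sum.distrib sum_subtractf sum_distrib_left)
  also have "(\<Sum>i\<in>I. indicator S i * w i) = (\<Sum>i\<in>S. w i)"
    using S(1) I by (simp add: indicator_def if_distrib[of "\<lambda>x. x * _"] sum.If_cases Int_absorb1 cong: if_cong)
  also have "(\<Sum>i\<in>I. indicator S i :: real) = real m"
    using S(1,2) I by (simp add: indicator_def sum.If_cases Int_absorb1)
  finally show ?thesis using S(1,2) m by auto
qed

text \<open>The weights may carry more mass than \<open>m\<close>; scaling them down keeps a negative total negative, of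
  the proportional size.\<close>

lemma subset_with_negative_sum:
  fixes w \<phi> :: "'i \<Rightarrow> real" and c :: real
  assumes I: "finite I" and \<phi>: "\<And>i. i \<in> I \<Longrightarrow> 0 \<le> \<phi> i \<and> \<phi> i \<le> 1"
    and m: "real m \<le> (\<Sum>i\<in>I. \<phi> i)" and c: "0 \<le> c" "(\<Sum>i\<in>I. \<phi> i * w i) \<le> - c * card I"
  shows "\<exists>S\<subseteq>I. card S = m \<and> (\<Sum>i\<in>S. w i) \<le> - c * m"
proof (cases "m = 0")
  case True
  thus ?thesis by (intro exI[of _ "{}"]) auto
next
  case False
  define F where "F = (\<Sum>i\<in>I. \<phi> i)"
  define t where "t = m / F"
  have F: "real m \<le> F" "F > 0" using m False by (auto simp: F_def)
  have Fc: "F \<le> card I"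
  proof -
    have "F \<le> (\<Sum>i\<in>I. 1)" unfolding F_def using \<phi> by (intro sum_mono) auto
    thus ?thesis by simp
  qed
  have t: "0 \<le> t" "t \<le> 1" using F by (auto simp: t_def)
  have "0 \<le> t * \<phi> i \<and> t * \<phi> i \<le> 1" if "i \<in> I" for i
    using t \<phi>[OF that] by (auto intro: mult_le_one)
  moreover have "(\<Sum>i\<in>I. t * \<phi> i) = real m"
  proof -
    have "(\<Sum>i\<in>I. t * \<phi> i) = t * F" by (simp only: F_def sum_distrib_left)
    thus ?thesis using F by (simp add: t_def)
  qed
  ultimately obtain S where S: "S \<subseteq> I" "card S = m" "(\<Sum>i\<in>S. w i) \<le> (\<Sum>i\<in>I. t * \<phi> i * w i)"
    using fractional_subset_rounding[OF I, of "\<lambda>i. t * \<phi> i" m w] by blast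
  have "(\<Sum>i\<in>I. t * \<phi> i * w i) = t * (\<Sum>i\<in>I. \<phi> i * w i)" by (simp add: sum_distrib_left mult.assoc)
  also have "\<dots> \<le> t * (- c * card I)" using c t by (intro mult_left_mono) auto
  also have "\<dots> = - (c * (t * card I))" by simp
  also have "\<dots> \<le> - (c * m)"
  proof -
    have "real m = t * F" using F by (simp add: t_def)
    also have "\<dots> \<le> t * card I" using Fc t by (intro mult_left_mono) auto
    finally show ?thesis using c(1) by (simp add: mult_left_mono)
  qed
  finally show ?thesis using S by auto
qed

section \<open>A weak law of large numbers on product spaces\<close>

lemma (in prob_space) PiM_weak_law_deviation:
  fixes f :: "'a \<Rightarrow> real" and n :: nat and \<delta> :: real
  assumes f: "f \<in> borel_measurable M" and f2: "integrable M (\<lambda>x. (f x)\<^sup>2)" and n: "0 < n" and \<delta>: "0 < \<delta>"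
  shows "measure (PiM {..<n} (\<lambda>_. M)) {\<omega> \<in> space (PiM {..<n} (\<lambda>_. M)). \<bar>(\<Sum>i<n. f (\<omega> i)) - n * expectation f\<bar> \<ge> \<delta> * n}
     \<le> variance f / (\<delta>\<^sup>2 * n)"
proof -
  interpret P: product_prob_space "\<lambda>_::nat. M" by (rule product_prob_spaceI) (rule prob_space_axioms)
  interpret PP: prob_space "PiM {..<n} (\<lambda>_. M)" by (intro prob_space_PiM prob_space_axioms)
  have fi: "integrable M f" using f f2 by (rule square_integrable_imp_integrable)
  define g where "g = (\<lambda>x. f x - expectation f)"
  have g: "integrable M g" "expectation g = 0" using fi by (simp_all add: g_def prob_space)
  have g2: "integrable M (\<lambda>x. (g x)\<^sup>2)"
    using f2 fi by (simp add: g_def power2_diff)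
  have gm[measurable]: "g \<in> borel_measurable M" using f by (simp add: g_def)
  have prod: "integrable (PiM {..<n} (\<lambda>_. M)) (\<lambda>\<omega>. g (\<omega> i) * g (\<omega> k)) \<and>
      PP.expectation (\<lambda>\<omega>. g (\<omega> i) * g (\<omega> k)) = (if i = k then expectation (\<lambda>x. (g x)\<^sup>2) else 0)"
    if ik: "i < n" "k < n" for i k
  proof -
    define h where "h = (\<lambda>j x. if j = i \<and> j = k then (g x)\<^sup>2 else if j = i \<or> j = k then g x else (1::real))"
    have hi: "integrable M (h j)" for j unfolding h_def using g g2 by (cases "j = i"; cases "j = k") simp_all
    have eq: "(\<Prod>j<n. h j (\<omega> j)) = g (\<omega> i) * g (\<omega> k)" for \<omega>
    proof (cases "i = k")
      case True
      have "(\<Prod>j<n. h j (\<omega> j)) = (\<Prod>j<n. if j = i then (g (\<omega> i))\<^sup>2 else 1)"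
        by (intro prod.cong refl) (auto simp: h_def True)
      thus ?thesis using ik True by (simp add: power2_eq_square)
    next
      case False
      have "(\<Prod>j<n. h j (\<omega> j)) = (\<Prod>j<n. (if j = i then g (\<omega> i) else 1) * (if j = k then g (\<omega> k) else 1))"
        by (intro prod.cong refl) (use False in \<open>auto simp: h_def\<close>)
      thus ?thesis using ik by (simp add: prod.distrib)
    qed
    have "(\<Prod>j<n. expectation (h j)) = (if i = k then expectation (\<lambda>x. (g x)\<^sup>2) else 0)"
    proof (cases "i = k")
      case True
      have "(\<Prod>j<n. expectation (h j)) = (\<Prod>j<n. if j = i then expectation (\<lambda>x. (g x)\<^sup>2) else 1)"
        by (intro prod.cong refl) (auto simp: h_def True prob_space)
      thus ?thesis using ik True by simp
    next
      case False
      hence "expectation (h i) = 0" by (simp add: h_def g)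
      thus ?thesis using False ik by (auto intro!: prod_zero)
    qed
    thus ?thesis
      using P.product_integrable_prod[of "{..<n}" h] P.product_integral_prod[of "{..<n}" h] hi by (simp add: eq)
  qed
  have sq: "(\<Sum>i<n. g (\<omega> i))\<^sup>2 = (\<Sum>i<n. \<Sum>k<n. g (\<omega> i) * g (\<omega> k))" for \<omega>
    by (simp add: power2_eq_square sum_product)
  have "PP.expectation (\<lambda>\<omega>. (\<Sum>i<n. g (\<omega> i))\<^sup>2) = (\<Sum>i<n. \<Sum>k<n. if i = k then expectation (\<lambda>x. (g x)\<^sup>2) else 0)"
  proof -
    have "PP.expectation (\<lambda>\<omega>. \<Sum>i<n. \<Sum>k<n. g (\<omega> i) * g (\<omega> k)) =
        (\<Sum>i<n. PP.expectation (\<lambda>\<omega>. \<Sum>k<n. g (\<omega> i) * g (\<omega> k)))"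
      by (rule Bochner_Integration.integral_sum) (intro Bochner_Integration.integrable_sum, use prod in auto)
    also have "\<dots> = (\<Sum>i<n. \<Sum>k<n. PP.expectation (\<lambda>\<omega>. g (\<omega> i) * g (\<omega> k)))"
      by (intro sum.cong refl Bochner_Integration.integral_sum) (use prod in auto)
    also have "\<dots> = (\<Sum>i<n. \<Sum>k<n. if i = k then expectation (\<lambda>x. (g x)\<^sup>2) else 0)"
      by (intro sum.cong refl) (use prod in auto)
    finally show ?thesis unfolding sq .
  qed
  hence var: "PP.expectation (\<lambda>\<omega>. (\<Sum>i<n. g (\<omega> i))\<^sup>2) = n * variance f" by (simp add: g_def)
  have int: "integrable (PiM {..<n} (\<lambda>_. M)) (\<lambda>\<omega>. (\<Sum>i<n. g (\<omega> i))\<^sup>2)"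
    unfolding sq using prod by (intro Bochner_Integration.integrable_sum) auto
  have meas: "(\<lambda>\<omega>. \<Sum>i<n. g (\<omega> i)) \<in> borel_measurable (PiM {..<n} (\<lambda>_. M))" by measurable
  have "(\<Sum>i<n. g (\<omega> i)) = (\<Sum>i<n. f (\<omega> i)) - n * expectation f" for \<omega>
    by (simp add: g_def sum_subtractf)
  hence "measure (PiM {..<n} (\<lambda>_. M)) {\<omega> \<in> space (PiM {..<n} (\<lambda>_. M)). \<bar>(\<Sum>i<n. f (\<omega> i)) - n * expectation f\<bar> \<ge> \<delta> * n} \<le>
     n * variance f / (\<delta> * n)\<^sup>2"
    using PP.second_moment_method[OF meas int, of "\<delta> * n"] n \<delta> var by simp
  also have "\<dots> = variance f / (\<delta>\<^sup>2 * n)" using n by (simp add: power2_eq_square)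
  finally show ?thesis .
qed

lemma (in prob_space) PiM_weak_law:
  fixes f :: "'a \<Rightarrow> real" and \<delta> :: real
  assumes f: "f \<in> borel_measurable M" and f2: "integrable M (\<lambda>x. (f x)\<^sup>2)" and \<delta>: "0 < \<delta>"
  shows "(\<lambda>n::nat. measure (PiM {..<n::nat} (\<lambda>_. M)) {\<omega> \<in> space (PiM {..<n::nat} (\<lambda>_. M)). \<bar>(\<Sum>i<n::nat. f (\<omega> i)) - real n * expectation f\<bar> \<ge> \<delta> * real n}) \<longlonglongrightarrow> 0"
proof -
  have ev: "\<forall>\<^sub>F n in sequentially. measure (PiM {..<n::nat} (\<lambda>_. M)) {\<omega> \<in> space (PiM {..<n::nat} (\<lambda>_. M)). \<bar>(\<Sum>i<n::nat. f (\<omega> i)) - real n * expectation f\<bar> \<ge> \<delta> * real n}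
      \<le> variance f / \<delta>\<^sup>2 * (1 / real n)"
    using eventually_gt_at_top[of "0 :: nat"]
  proof eventually_elim
    case (elim n)
    from PiM_weak_law_deviation[OF f f2 elim \<delta>] show ?case by simp
  qed
  have lim: "(\<lambda>n. variance f / \<delta>\<^sup>2 * (1 / real n)) \<longlonglongrightarrow> 0"
    by (rule tendsto_mult_right_zero[OF lim_1_over_n])
  show ?thesis by (rule tendsto_sandwich[OF _ ev tendsto_const lim]) auto
qed

section \<open>The population inequality\<close>

lemma (in pair_prob_space) integrable_prod_product:
  fixes f :: "'a \<Rightarrow> real" and g :: "'b \<Rightarrow> real"
  assumes f: "integrable M1 f" and g: "integrable M2 g"
  shows "integrable (M1 \<Otimes>\<^sub>M M2) (\<lambda>x. f (fst x) * g (snd x))"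
    and "(\<integral>x. f (fst x) * g (snd x) \<partial>(M1 \<Otimes>\<^sub>M M2)) = integral\<^sup>L M1 f * integral\<^sup>L M2 g"
proof -
  have [measurable]: "f \<in> borel_measurable M1" "g \<in> borel_measurable M2" using f g by auto
  show i: "integrable (M1 \<Otimes>\<^sub>M M2) (\<lambda>x. f (fst x) * g (snd x))"
  proof (rule Fubini_integrable)
    show "integrable M1 (\<lambda>x. \<integral>y. norm (f (fst (x, y)) * g (snd (x, y))) \<partial>M2)"
      using f by (simp add: abs_mult)
    show "AE x in M1. integrable M2 (\<lambda>y. f (fst (x, y)) * g (snd (x, y)))"
      using g by simp
  qed measurable
  show "(\<integral>x. f (fst x) * g (snd x) \<partial>(M1 \<Otimes>\<^sub>M M2)) = integral\<^sup>L M1 f * integral\<^sup>L M2 g"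
    using integral_fst'[OF i] by simp
qed

locale noise =
  fixes D :: "real measure"
  assumes prob_space_D: "prob_space D" and sets_D [measurable_cong]: "sets D = sets borel"
    and moments: "\<And>j. integrable D (\<lambda>e. e ^ j)" and mean_zero: "integral\<^sup>L D (\<lambda>e. e) = 0"
begin

sublocale D: prob_space D by (rule prob_space_D)
sublocale Z: prob_space std_normal_distribution by (rule prob_space_std_normal)
sublocale DZ: pair_prob_space D std_normal_distribution ..

text \<open>The joint law of a noise variable and an independent standard normal variable.\<close>

abbreviation A :: "(real \<times> real) measure" where "A \<equiv> D \<Otimes>\<^sub>M std_normal_distribution"

lemma sets_A: "sets A = sets (borel \<Otimes>\<^sub>M borel)"
  by (intro sets_pair_measure_cong sets_D) simp

lemma space_D: "space D = UNIV"
  using sets_eq_imp_space_eq[OF sets_D] by simp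

lemma space_A: "space A = UNIV"
  by (simp add: space_pair_measure space_D)

lemma integrable_monomial: "integrable A (\<lambda>x. fst x ^ i * snd x ^ j)"
  by (intro DZ.integrable_prod_product moments integrable_std_normal_distribution_moment)

lemma integral_monomial:
  "(\<integral>x. fst x ^ i * snd x ^ j \<partial>A) = integral\<^sup>L D (\<lambda>e. e ^ i) * integral\<^sup>L std_normal_distribution (\<lambda>z. z ^ j)"
  by (intro DZ.integrable_prod_product moments integrable_std_normal_distribution_moment)

lemma std_normal_second_moment: "integral\<^sup>L std_normal_distribution (\<lambda>z. z\<^sup>2) = 1"
  using std_normal_distribution_even_moments(1)[of 1] by simp

lemma integral_ez: "(\<integral>x. fst x * snd x \<partial>A) = 0"
  using integral_monomial[of 1 1] mean_zero by simp

lemma integral_zz: "(\<integral>x. (snd x)\<^sup>2 \<partial>A) = 1"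
  using integral_monomial[of 0 2] by (simp add: std_normal_second_moment D.prob_space)

lemma integrable_ez: "integrable A (\<lambda>x. fst x * snd x)"
  using integrable_monomial[of 1 1] by simp

lemma integrable_zz: "integrable A (\<lambda>x. (snd x)\<^sup>2)"
  using integrable_monomial[of 0 2] by simp

lemma integrable_bounded_times:
  assumes [measurable]: "\<phi> \<in> borel_measurable A" and b: "\<And>x. \<bar>\<phi> x\<bar> \<le> (1::real)" and f: "integrable A f"
  shows "integrable A (\<lambda>x. \<phi> x * f x)"
proof (rule Bochner_Integration.integrable_bound[OF f])
  show "AE x in A. norm (\<phi> x * f x) \<le> norm (f x)"
    using mult_right_mono[OF b] by (intro AE_I2) (simp add: abs_mult)
qed (use f in measurable)

lemma distr_reflect: "distr A (borel \<Otimes>\<^sub>M borel) (\<lambda>x. (fst x, - snd x)) = A"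
proof -
  have 1: "distr D borel (\<lambda>x. x) \<Otimes>\<^sub>M distr std_normal_distribution borel uminus =
      distr A (borel \<Otimes>\<^sub>M borel) (\<lambda>(x, y). (x, - y))"
    by (rule pair_measure_distr)
      (auto simp: std_normal_uminus measurable_cong_sets[OF sets_D refl] intro: Z.sigma_finite_measure)
  have 2: "distr D borel (\<lambda>x. x) = D" using distr_id2[OF sets_D[symmetric]] .
  show ?thesis using 1[unfolded 2 std_normal_uminus case_prod_unfold] by (rule sym)
qed

lemma integral_reflect:
  assumes f: "(f :: _ \<Rightarrow> real) \<in> borel_measurable A"
  shows "(\<integral>x. f (fst x, - snd x) \<partial>A) = integral\<^sup>L A f"
proof -
  have f': "f \<in> borel_measurable (borel \<Otimes>\<^sub>M borel)" using f by (simp add: measurable_cong_sets[OF sets_A refl])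
  have "integral\<^sup>L A f = (\<integral>x. f x \<partial>distr A (borel \<Otimes>\<^sub>M borel) (\<lambda>x. (fst x, - snd x)))"
    by (simp only: distr_reflect)
  also have "\<dots> = (\<integral>x. f (fst x, - snd x) \<partial>A)"
    by (rule integral_distr[OF _ f']) measurable
  finally show ?thesis ..
qed

definition prod_law :: "real measure" where
  "prod_law = distr A borel (\<lambda>x. fst x * snd x)"

sublocale Q: real_distribution prod_law
proof -
  have "prob_space prod_law"
    unfolding prod_law_def by (rule DZ.prob_space_distr) measurable
  thus "real_distribution prod_law"
    by (simp add: real_distribution_def real_distribution_axioms_def prod_law_def)
qed

lemma measure_prod_law: "B \<in> sets borel \<Longrightarrow> measure prod_law B = measure A {x \<in> space A. fst x * snd x \<in> B}"
  unfolding prod_law_def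
  by (subst measure_distr) (auto intro!: arg_cong[of _ _ "measure A"])

text \<open>The product \<open>e z\<close> has a symmetric law because \<open>z\<close> has; since \<open>1 - \<alpha> > 1/2\<close>, the quantile is
  nonnegative. It may be an atom, hence the two one-sided bounds.\<close>

lemma quantile_props:
  assumes \<alpha>: "0 < \<alpha>" "\<alpha> < 1/2"
  defines "q \<equiv> quantile prod_law (1 - \<alpha>)"
  shows "0 \<le> q" "1 - \<alpha> \<le> measure prod_law {..q}" "measure prod_law {..<q} \<le> 1 - \<alpha>"
proof -
  let ?T = "{t. 1 - \<alpha> \<le> cdf prod_law t}"
  have q: "q = Inf ?T" by (simp add: q_def quantile_def)
  have nonneg: "0 \<le> t" if t: "t \<in> ?T" for t
  proof (rule ccontr)
    assume "\<not> 0 \<le> t"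
    hence neg: "t < 0" by simp
    have sym: "measure prod_law {..t} = measure prod_law {-t..}"
    proof -
      have "measure prod_law {..t} = measure A {x \<in> space A. fst x * snd x \<in> {..t}}"
        by (rule measure_prod_law) simp
      also have "\<dots> = measure (distr A (borel \<Otimes>\<^sub>M borel) (\<lambda>x. (fst x, - snd x))) {x \<in> space A. fst x * snd x \<in> {..t}}"
        by (simp only: distr_reflect)
      also have "\<dots> = measure A {x \<in> space A. fst x * snd x \<in> {-t..}}"
      proof (subst measure_distr)
        have "{x \<in> space A. fst x * snd x \<in> {..t}} \<in> sets A" by measurable
        thus "{x \<in> space A. fst x * snd x \<in> {..t}} \<in> sets (borel \<Otimes>\<^sub>M borel)" by (simp only: sets_A)
      qed (measurable, auto simp: space_A intro!: arg_cong[of _ _ "measure A"])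
      also have "\<dots> = measure prod_law {-t..}" by (rule measure_prod_law[symmetric]) simp
      finally show ?thesis .
    qed
    have "measure prod_law {..t} + measure prod_law {-t..} = measure prod_law ({..t} \<union> {-t..})"
      using neg by (intro Q.finite_measure_Union[symmetric]) auto
    also have "\<dots> \<le> 1" by (rule Q.prob_le_1)
    finally have "cdf prod_law t \<le> 1/2" using sym by (simp add: cdf_def2)
    thus False using t \<alpha> by simp
  qed
  have bdd: "bdd_below ?T" by (rule bdd_belowI[of _ 0]) (rule nonneg)
  have ne: "?T \<noteq> {}"
  proof -
    have "\<forall>\<^sub>F t in at_top. 1 - \<alpha> < cdf prod_law t"
      using \<alpha> by (intro order_tendstoD(1)[OF Q.cdf_lim_at_top_prob]) auto
    then obtain t where "1 - \<alpha> < cdf prod_law t" by (auto simp: eventually_at_top_linorder)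
    thus ?thesis by (auto intro: less_imp_le)
  qed
  show "0 \<le> q" unfolding q using ne nonneg by (rule cInf_greatest)
  have above: "1 - \<alpha> \<le> cdf prod_law t" if qt: "q < t" for t
  proof -
    obtain s where s: "s \<in> ?T" "s < t" using qt cInf_less_iff[OF ne bdd] unfolding q by blast
    thus ?thesis using Q.cdf_nondecreasing[of s t] by simp
  qed
  have "(cdf prod_law \<longlongrightarrow> cdf prod_law q) (at_right q)"
    using Q.cdf_is_right_cont[of q] by (simp add: continuous_within)
  moreover have "\<forall>\<^sub>F t in at_right q. 1 - \<alpha> \<le> cdf prod_law t"
    unfolding eventually_at_right_field using above by (intro exI[of _ "q + 1"]) auto
  ultimately show "1 - \<alpha> \<le> measure prod_law {..q}"
    unfolding cdf_def2[symmetric] by (rule tendsto_lowerbound) simp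
  have below: "cdf prod_law t \<le> 1 - \<alpha>" if "t < q" for t
  proof (rule ccontr)
    assume "\<not> ?thesis"
    hence "q \<le> t" unfolding q using bdd by (intro cInf_lower) auto
    thus False using that by simp
  qed
  have "(cdf prod_law \<longlongrightarrow> measure prod_law {..<q}) (at_left q)" by (rule Q.cdf_at_left)
  moreover have "\<forall>\<^sub>F t in at_left q. cdf prod_law t \<le> 1 - \<alpha>"
    unfolding eventually_at_left_field using below by (intro exI[of _ "q - 1"]) auto
  ultimately show "measure prod_law {..<q} \<le> 1 - \<alpha>"
    by (rule tendsto_upperbound) simp
qed

text \<open>For fixed \<open>e\<close>, the symmetrisation of \<open>\<phi> (e z)\<close> in \<open>z\<close> is a decreasing function of \<open>|z|\<close>, because the
  half with \<open>e z < 0\<close> contributes a constant. Hence it is negatively correlated with \<open>z\<^sup>2\<close>, whose mean is \<open>1\<close>: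
  the difference from the value at \<open>|z| = 1\<close> and \<open>1 - z\<^sup>2\<close> have the same sign.\<close>

lemma integral_truncation_times_square:
  fixes \<phi> :: "real \<Rightarrow> real"
  assumes [measurable]: "\<phi> \<in> borel_measurable borel" and range: "\<And>t. 0 \<le> \<phi> t \<and> \<phi> t \<le> 1"
    and neg: "\<And>t. t < 0 \<Longrightarrow> \<phi> t = 1" and mono: "\<And>s t. 0 < s \<Longrightarrow> s \<le> t \<Longrightarrow> \<phi> t \<le> \<phi> s"
  shows "(\<integral>x. \<phi> (fst x * snd x) * (snd x)\<^sup>2 \<partial>A) \<le> (\<integral>x. \<phi> (fst x * snd x) \<partial>A)"
proof -
  have abs1: "\<bar>\<phi> t\<bar> \<le> 1" for t using range[of t] by simp
  define f where "f = (\<lambda>x. \<phi> (fst x * snd x) * (1 - (snd x)\<^sup>2))"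
  define psi where "psi = (\<lambda>e z. \<phi> (e * z) + \<phi> (- (e * z)))"
  have [measurable]: "f \<in> borel_measurable A" unfolding f_def by measurable
  have i1z: "integrable A (\<lambda>x. 1 - (snd x)\<^sup>2)" using integrable_zz by simp
  have fi: "integrable A f" unfolding f_def by (intro integrable_bounded_times i1z) (auto simp: abs1)
  have fi': "integrable A (\<lambda>x. f (fst x, - snd x))"
    unfolding f_def by (intro integrable_bounded_times) (auto simp: abs1 i1z)
  have psi1: "integrable A (\<lambda>x. psi (fst x) 1 * (1 - (snd x)\<^sup>2))"
    and psi1': "(\<integral>x. psi (fst x) 1 * (1 - (snd x)\<^sup>2) \<partial>A) = 0"
  proof -
    have pD: "integrable D (\<lambda>e. psi e 1)"
    proof (rule D.integrable_const_bound[where B = 2])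
      show "AE e in D. norm (psi e 1) \<le> 2"
      proof (rule AE_I2)
        fix e show "norm (psi e 1) \<le> 2" using range[of e] range[of "-e"] by (simp add: psi_def)
      qed
      show "(\<lambda>e. psi e 1) \<in> borel_measurable D" unfolding psi_def by measurable
    qed
    have zz: "integrable std_normal_distribution (\<lambda>z. 1 - z\<^sup>2)"
      using integrable_std_normal_distribution_moment[of 2] by simp
    have "(\<integral>z. 1 - z\<^sup>2 \<partial>std_normal_distribution) = 0"
    proof -
      have "Z.prob UNIV = 1" using Z.prob_space by simp
      thus ?thesis using integrable_std_normal_distribution_moment[of 2] by (simp add: std_normal_second_moment)
    qed
    thus "integrable A (\<lambda>x. psi (fst x) 1 * (1 - (snd x)\<^sup>2))"
      "(\<integral>x. psi (fst x) 1 * (1 - (snd x)\<^sup>2) \<partial>A) = 0"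
      using DZ.integrable_prod_product[OF pD zz] by simp_all
  qed
  have z0: "AE x in A. snd x \<noteq> 0"
  proof -
    have "AE z in std_normal_distribution. z \<noteq> 0"
      using AE_lborel_singleton[of 0] by (subst AE_density) auto
    have "{x \<in> space A. snd x \<noteq> 0} \<in> sets A" by measurable
    thus ?thesis using \<open>AE z in std_normal_distribution. z \<noteq> 0\<close> by (intro DZ.AE_pair_measure) auto
  qed
  have "0 = (\<integral>x. psi (fst x) 1 * (1 - (snd x)\<^sup>2) \<partial>A)" using psi1' by simp
  also have "\<dots> \<le> (\<integral>x. f x + f (fst x, - snd x) \<partial>A)"
  proof (rule integral_mono_AE)
    show "AE x in A. psi (fst x) 1 * (1 - (snd x)\<^sup>2) \<le> f x + f (fst x, - snd x)"
      using z0
    proof eventually_elim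
      fix x :: "real \<times> real" assume z: "snd x \<noteq> 0"
      define e where "e = fst x" define z where "z = snd x"
      have sum: "f x + f (fst x, - snd x) = psi e z * (1 - z\<^sup>2)"
        by (simp add: f_def psi_def e_def z_def algebra_simps)
      have ps: "psi e t = \<phi> \<bar>e * t\<bar> + \<phi> (- \<bar>e * t\<bar>)" for t by (simp add: psi_def abs_if)
      have anti: "psi e t \<le> psi e s" if st: "\<bar>s\<bar> \<le> \<bar>t\<bar>" "s \<noteq> 0" for s t
      proof (cases "e = 0")
        case False
        have "0 < \<bar>e * s\<bar>" "\<bar>e * s\<bar> \<le> \<bar>e * t\<bar>"
          using st False by (auto simp: abs_mult intro: mult_left_mono)
        hence "\<phi> (- \<bar>e * t\<bar>) = 1" "\<phi> (- \<bar>e * s\<bar>) = 1" "\<phi> \<bar>e * t\<bar> \<le> \<phi> \<bar>e * s\<bar>"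
          by (intro neg mono; linarith)+
        thus ?thesis unfolding ps by simp
      qed (simp add: psi_def)
      have "0 \<le> (psi e z - psi e 1) * (1 - z\<^sup>2)"
      proof (cases "\<bar>z\<bar> \<le> 1")
        case True
        thus ?thesis using anti[of z 1] z by (simp add: z_def abs_square_le_1)
      next
        case False
        hence "1 \<le> z\<^sup>2" by (metis abs_square_le_1 linear)
        thus ?thesis using anti[of 1 z] False by (intro mult_nonpos_nonpos) auto
      qed
      thus "psi (fst x) 1 * (1 - (snd x)\<^sup>2) \<le> f x + f (fst x, - snd x)"
        unfolding sum by (simp add: e_def z_def algebra_simps)
    qed
  qed (use psi1 fi fi' in auto)
  also have "\<dots> = 2 * integral\<^sup>L A f"
    using fi fi' integral_reflect[of f] by simp
  finally have "0 \<le> integral\<^sup>L A f" by simp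
  also have "integral\<^sup>L A f = (\<integral>x. \<phi> (fst x * snd x) \<partial>A) - (\<integral>x. \<phi> (fst x * snd x) * (snd x)\<^sup>2 \<partial>A)"
  proof -
    have "integrable A (\<lambda>x. \<phi> (fst x * snd x) * 1)" by (intro integrable_bounded_times) (auto simp: abs1)
    moreover have "integrable A (\<lambda>x. \<phi> (fst x * snd x) * (snd x)\<^sup>2)"
      by (intro integrable_bounded_times integrable_zz) (auto simp: abs1)
    ultimately show ?thesis by (simp add: f_def right_diff_distrib)
  qed
  finally show ?thesis by simp
qed

lemma pair_set_null_contradiction:
  assumes nz: "\<not> (AE e in D. e = 0)" and ae: "AE x in A. P x"
  shows "\<exists>e. e \<noteq> 0 \<and> (AE z in std_normal_distribution. P (e, z))"
proof (rule ccontr)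
  assume neg: "\<not> ?thesis"
  have "AE e in D. AE z in std_normal_distribution. P (e, z)" using DZ.AE_pair[OF ae] .
  hence "AE e in D. e = 0" by eventually_elim (use neg in blast)
  thus False using nz by simp
qed

text \<open>The weights \<open>\<phi>\<^sub>0\<close> keep the mass \<open>1 - \<alpha>\<close> of smallest products \<open>e z\<close>, splitting a possible atom at
  the quantile. They already give \<open>E[\<phi>\<^sub>0 (e z + L z\<^sup>2)] \<le> 0\<close>. They also keep the points with
  \<open>e z < 0\<close> and arbitrarily large \<open>z\<^sup>2\<close>, where \<open>e z + L z\<^sup>2\<close> exceeds any bound \<open>B\<close>; removing these,
  of mass \<open>a\<close>, and returning the mass to all points uniformly makes the inequality strict once
  \<open>\<alpha> B > 2 L\<close>.\<close>

lemma population_weights: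
  assumes \<alpha>: "0 < \<alpha>" "\<alpha> < 1/2" and nz: "\<not> (AE e in D. e = 0)"
  defines "q \<equiv> quantile prod_law (1 - \<alpha>)"
  defines "L \<equiv> 1 / (1 - \<alpha>) * (\<integral>x. fst x * snd x * indicator {q<..} (fst x * snd x) \<partial>A)"
  shows "\<exists>\<phi>. \<phi> \<in> borel_measurable A \<and> (\<forall>x. 0 \<le> \<phi> x \<and> \<phi> x \<le> 1) \<and> 1 - \<alpha> < (\<integral>x. \<phi> x \<partial>A) \<and>
        (\<integral>x. \<phi> x * (snd x * (fst x + L * snd x)) \<partial>A) < 0"
proof -
  note qp = quantile_props[OF \<alpha>, folded q_def]
  let ?X = "\<lambda>x::real\<times>real. fst x * snd x"
  have i_tail: "integrable A (\<lambda>x. ?X x * indicator {q<..} (?X x))"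
  proof -
    have "integrable A (\<lambda>x. indicator {q<..} (?X x) * ?X x)"
      by (intro integrable_bounded_times integrable_ez) (auto simp: indicator_def)
    thus ?thesis by (simp add: mult.commute)
  qed
  have L: "0 < L"
  proof -
    have nn: "0 \<le> ?X x * indicator {q<..} (?X x)" for x using qp(1) by (auto simp: indicator_def)
    have "(\<integral>x. ?X x * indicator {q<..} (?X x) \<partial>A) \<noteq> 0"
    proof
      assume "(\<integral>x. ?X x * indicator {q<..} (?X x) \<partial>A) = 0"
      hence "AE x in A. ?X x * indicator {q<..} (?X x) = 0"
        using integral_nonneg_eq_0_iff_AE[OF i_tail] nn by simp
      hence "AE x in A. ?X x \<le> q"
        by eventually_elim (use qp(1) in \<open>auto simp: indicator_def split: if_splits\<close>)
      from pair_set_null_contradiction[OF nz this] obtain e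
        where e: "e \<noteq> 0" "AE z in std_normal_distribution. e * z \<le> q" by auto
      show False
      proof (cases "e > 0")
        case True
        obtain z where z: "z \<ge> (q + 1) / e" "e * z \<le> q" using std_normal_AE_ray(1)[OF e(2)] by blast
        have "q + 1 \<le> e * z" using z(1) True by (simp add: field_simps)
        thus False using z(2) by simp
      next
        case False
        obtain z where z: "z \<le> (q + 1) / e" "e * z \<le> q" using std_normal_AE_ray(2)[OF e(2)] by blast
        have "q + 1 \<le> e * z" using z(1) False e(1) by (simp add: field_simps)
        thus False using z(2) by simp
      qed
    qed
    moreover have "0 \<le> (\<integral>x. ?X x * indicator {q<..} (?X x) \<partial>A)" using nn by (intro Bochner_Integration.integral_nonneg)
    ultimately show ?thesis using \<alpha> by (simp add: L_def)
  qed
  define P0 where "P0 = measure prod_law {..<q}"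
  define P1 where "P1 = measure prod_law {q}"
  have P01: "measure prod_law {..q} = P0 + P1"
  proof -
    have "measure prod_law ({..<q} \<union> {q}) = P0 + P1"
      unfolding P0_def P1_def by (intro Q.finite_measure_Union) auto
    moreover have "{..<q} \<union> {q} = {..q}" by auto
    ultimately show ?thesis by simp
  qed
  define c where "c = (if P1 = 0 then 0 else (1 - \<alpha> - P0) / P1)"
  have P1nn: "0 \<le> P1" by (simp add: P1_def)
  have c: "0 \<le> c" "c \<le> 1" "P0 + c * P1 = 1 - \<alpha>"
    using qp(2,3) P1nn unfolding P01 P0_def[symmetric] by (auto simp: c_def field_simps)
  define \<phi>0 where "\<phi>0 = (\<lambda>t. indicator {..<q} t + c * indicator {q} t)"
  have \<phi>0m[measurable]: "\<phi>0 \<in> borel_measurable borel" unfolding \<phi>0_def by measurable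
  have \<phi>0r: "0 \<le> \<phi>0 t \<and> \<phi>0 t \<le> 1" for t using c by (auto simp: \<phi>0_def indicator_def)
  have \<phi>0abs: "\<bar>\<phi>0 t\<bar> \<le> 1" for t using \<phi>0r[of t] by simp
  have \<phi>0neg: "\<phi>0 t = 1" if "t < 0" for t using that qp(1) by (auto simp: \<phi>0_def indicator_def)
  have \<phi>0mono: "\<phi>0 t \<le> \<phi>0 s" if "0 < s" "s \<le> t" for s t
    using that c by (auto simp: \<phi>0_def indicator_def)
  have i\<phi>0: "integrable A (\<lambda>x. \<phi>0 (?X x))"
    using integrable_bounded_times[of "\<lambda>x. \<phi>0 (?X x)" "\<lambda>_. 1"] by (simp add: \<phi>0abs)
  have E\<phi>0: "(\<integral>x. \<phi>0 (?X x) \<partial>A) = 1 - \<alpha>"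
  proof -
    have "(\<integral>x. \<phi>0 (?X x) \<partial>A) = (\<integral>t. \<phi>0 t \<partial>prod_law)"
      unfolding prod_law_def by (rule integral_distr[symmetric]) measurable
    also have "\<dots> = P0 + c * P1"
      unfolding \<phi>0_def P0_def P1_def by (subst Bochner_Integration.integral_add) (auto simp: Q.emeasure_eq_measure)
    finally show ?thesis using c(3) by simp
  qed
  have E\<phi>0z: "(\<integral>x. \<phi>0 (?X x) * (snd x)\<^sup>2 \<partial>A) \<le> 1 - \<alpha>"
    using integral_truncation_times_square[of \<phi>0, OF \<phi>0m \<phi>0r \<phi>0neg \<phi>0mono] E\<phi>0 by simp
  have i\<phi>0z: "integrable A (\<lambda>x. \<phi>0 (?X x) * (snd x)\<^sup>2)"
    by (intro integrable_bounded_times integrable_zz) (auto simp: \<phi>0abs)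
  have i\<phi>0X: "integrable A (\<lambda>x. \<phi>0 (?X x) * ?X x)"
    by (intro integrable_bounded_times integrable_ez) (auto simp: \<phi>0abs)
  have E\<phi>0X: "(\<integral>x. \<phi>0 (?X x) * ?X x \<partial>A) \<le> - ((1 - \<alpha>) * L)"
  proof -
    have "(\<integral>x. \<phi>0 (?X x) * ?X x \<partial>A) \<le> (\<integral>x. ?X x - ?X x * indicator {q<..} (?X x) \<partial>A)"
    proof (rule integral_mono[OF i\<phi>0X])
      show "integrable A (\<lambda>x. ?X x - ?X x * indicator {q<..} (?X x))"
        using integrable_ez i_tail by simp
      fix x
      have "(1 - c) * q \<ge> 0" using c qp(1) by simp
      thus "\<phi>0 (?X x) * ?X x \<le> ?X x - ?X x * indicator {q<..} (?X x)"
        by (auto simp: \<phi>0_def indicator_def algebra_simps)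
    qed
    also have "\<dots> = - ((1 - \<alpha>) * L)"
      using integrable_ez i_tail integral_ez \<alpha> by (simp add: L_def)
    finally show ?thesis .
  qed
  define w where "w = (\<lambda>x::real\<times>real. snd x * (fst x + L * snd x))"
  have w: "w x = ?X x + L * (snd x)\<^sup>2" for x by (simp add: w_def algebra_simps power2_eq_square)
  have wm[measurable]: "w \<in> borel_measurable A" unfolding w_def by measurable
  have iw: "integrable A w" unfolding w using integrable_ez integrable_zz by simp
  have Ew: "integral\<^sup>L A w = L"
    unfolding w using integrable_ez integrable_zz integral_ez integral_zz by simp
  have E\<phi>0w: "(\<integral>x. \<phi>0 (?X x) * w x \<partial>A) \<le> 0"
  proof -
    have "(\<integral>x. \<phi>0 (?X x) * w x \<partial>A) = (\<integral>x. \<phi>0 (?X x) * ?X x + L * (\<phi>0 (?X x) * (snd x)\<^sup>2) \<partial>A)"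
      by (simp add: w algebra_simps)
    also have "\<dots> = (\<integral>x. \<phi>0 (?X x) * ?X x \<partial>A) + L * (\<integral>x. \<phi>0 (?X x) * (snd x)\<^sup>2 \<partial>A)"
      using i\<phi>0X i\<phi>0z by simp
    also have "\<dots> \<le> - ((1 - \<alpha>) * L) + L * (1 - \<alpha>)"
      using E\<phi>0X E\<phi>0z L by (intro add_mono mult_left_mono) auto
    finally show ?thesis by simp
  qed
  define B where "B = 3 * L / \<alpha>"
  define R where "R = {x::real\<times>real. ?X x < 0 \<and> B \<le> w x}"
  have Rm[measurable]: "R \<in> sets A"
  proof -
    have "{x \<in> space A. ?X x < 0 \<and> B \<le> w x} \<in> sets A" by measurable
    thus ?thesis by (simp add: R_def space_A)
  qed
  define a where "a = measure A R"
  have "a \<noteq> 0"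
  proof
    assume "a = 0"
    hence "AE x in A. x \<notin> R"
      using Rm by (intro AE_not_in null_setsI) (auto simp: a_def DZ.P.emeasure_eq_measure)
    from pair_set_null_contradiction[OF nz this] obtain e
      where e: "e \<noteq> 0" "AE z in std_normal_distribution. (e, z) \<notin> R" by auto
    define T where "T = (\<bar>e\<bar> + B) / L + 1"
    have B0: "0 < B" using L \<alpha> by (simp add: B_def)
    have T1: "T \<ge> 1" "L * T \<ge> \<bar>e\<bar> + B" using L B0 by (auto simp: T_def field_simps)
    have "\<exists>z. T \<le> \<bar>z\<bar> \<and> e * z < 0 \<and> (e, z) \<notin> R"
    proof (cases "e > 0")
      case True
      obtain z where "z \<le> - T" "(e, z) \<notin> R" using std_normal_AE_ray(2)[OF e(2), of "- T"] by blast
      thus ?thesis using True T1 by (intro exI[of _ z]) (auto simp: mult_less_0_iff)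
    next
      case False
      obtain z where "z \<ge> T" "(e, z) \<notin> R" using std_normal_AE_ray(1)[OF e(2), of T] by blast
      thus ?thesis using False e(1) T1 by (intro exI[of _ z]) (auto simp: mult_less_0_iff)
    qed
    then obtain z where z: "T \<le> \<bar>z\<bar>" "e * z < 0" "(e, z) \<notin> R" by blast
    have "w (e, z) = \<bar>z\<bar> * (L * \<bar>z\<bar> - \<bar>e\<bar>)"
      using z(2) by (auto simp: w_def abs_if algebra_simps mult_less_0_iff)
    also have "\<dots> \<ge> 1 * B"
    proof (rule mult_mono)
      have "L * T \<le> L * \<bar>z\<bar>" using z(1) L by simp
      thus "B \<le> L * \<bar>z\<bar> - \<bar>e\<bar>" using T1 by linarith
    qed (use T1 z(1) B0 in auto)
    finally have "(e, z) \<in> R" using z(2) by (simp add: R_def)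
    thus False using z(3) by simp
  qed
  hence a: "a > 0" by (simp add: a_def zero_less_measure_iff)
  define \<phi>1 where "\<phi>1 = (\<lambda>x. \<phi>0 (?X x) - indicator R x)"
  have RX: "\<phi>0 (?X x) = 1" if "x \<in> R" for x using that \<phi>0neg by (simp add: R_def)
  have \<phi>1r: "0 \<le> \<phi>1 x \<and> \<phi>1 x \<le> 1" for x
    using \<phi>0r[of "?X x"] RX[of x] by (auto simp: \<phi>1_def indicator_def)
  have \<phi>1m[measurable]: "\<phi>1 \<in> borel_measurable A" unfolding \<phi>1_def by measurable
  have iR: "integrable A (\<lambda>x. indicator R x :: real)"
    using Rm by (simp add: DZ.P.emeasure_eq_measure)
  have iRw: "integrable A (\<lambda>x. indicator R x * w x)"
    by (intro integrable_bounded_times iw) (auto simp: indicator_def)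
  have i\<phi>0w: "integrable A (\<lambda>x. \<phi>0 (?X x) * w x)"
    by (intro integrable_bounded_times iw) (auto simp: \<phi>0abs)
  have E\<phi>1: "(\<integral>x. \<phi>1 x \<partial>A) = 1 - \<alpha> - a"
    unfolding \<phi>1_def using i\<phi>0 iR E\<phi>0 Rm by (simp add: a_def)
  have E\<phi>1w: "(\<integral>x. \<phi>1 x * w x \<partial>A) \<le> - (B * a)"
  proof -
    have "B * a = (\<integral>x. B * indicator R x \<partial>A)" using Rm by (simp add: a_def)
    also have "\<dots> \<le> (\<integral>x. indicator R x * w x \<partial>A)"
      using iR iRw by (intro integral_mono) (auto simp: indicator_def R_def)
    finally have "B * a \<le> (\<integral>x. indicator R x * w x \<partial>A)" .
    moreover have "(\<integral>x. \<phi>1 x * w x \<partial>A) = (\<integral>x. \<phi>0 (?X x) * w x \<partial>A) - (\<integral>x. indicator R x * w x \<partial>A)"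
      unfolding \<phi>1_def left_diff_distrib using i\<phi>0w iRw by simp
    ultimately show ?thesis using E\<phi>0w by simp
  qed
  \<comment> \<open>mixing with the constant weight \<open>1\<close> restores a total mass above \<open>1 - \<alpha>\<close> once \<open>s > a / (\<alpha> + a)\<close>\<close>
  define s where "s = 2 * a / (\<alpha> + 2 * a)"
  have s: "0 \<le> s" "s \<le> 1" "1 - s = \<alpha> / (\<alpha> + 2 * a)" using a \<alpha> by (auto simp: s_def field_simps)
  define \<phi>2 where "\<phi>2 = (\<lambda>x. (1 - s) * \<phi>1 x + s)"
  have i\<phi>1: "integrable A \<phi>1" unfolding \<phi>1_def using i\<phi>0 iR by simp
  have i\<phi>1w: "integrable A (\<lambda>x. \<phi>1 x * w x)"
    by (intro integrable_bounded_times iw) (use \<phi>1r in \<open>auto simp: abs_le_iff intro: order_trans[of _ 0]\<close>)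
  have "\<phi>2 \<in> borel_measurable A" unfolding \<phi>2_def by measurable
  moreover have "\<forall>x. 0 \<le> \<phi>2 x \<and> \<phi>2 x \<le> 1"
  proof
    fix x
    have "(1 - s) * \<phi>1 x \<le> 1 - s" using mult_left_mono[of "\<phi>1 x" 1 "1 - s"] s(2) \<phi>1r[of x] by simp
    moreover have "0 \<le> (1 - s) * \<phi>1 x" using s(2) \<phi>1r[of x] by (intro mult_nonneg_nonneg) auto
    ultimately have "0 \<le> \<phi>2 x" "\<phi>2 x \<le> 1" using s(1) unfolding \<phi>2_def by linarith+
    thus "0 \<le> \<phi>2 x \<and> \<phi>2 x \<le> 1" ..
  qed
  moreover have "1 - \<alpha> < (\<integral>x. \<phi>2 x \<partial>A)"
  proof -
    have "(\<integral>x. \<phi>2 x \<partial>A) = (1 - s) * (1 - \<alpha> - a) + s"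
      unfolding \<phi>2_def using i\<phi>1 E\<phi>1 DZ.P.prob_space by simp
    also have "\<dots> = 1 - \<alpha> + (s * (\<alpha> + a) - a)" by (simp add: algebra_simps)
    also have "s * (\<alpha> + a) - a = a * \<alpha> / (\<alpha> + 2 * a)" using a \<alpha> by (simp add: s_def field_simps)
    finally show ?thesis using a \<alpha> by simp
  qed
  moreover have "(\<integral>x. \<phi>2 x * w x \<partial>A) < 0"
  proof -
    have "(\<integral>x. \<phi>2 x * w x \<partial>A) = (\<integral>x. (1 - s) * (\<phi>1 x * w x) + s * w x \<partial>A)"
      by (simp add: \<phi>2_def algebra_simps)
    also have "\<dots> = (1 - s) * (\<integral>x. \<phi>1 x * w x \<partial>A) + s * L"
      using i\<phi>1w iw Ew by simp
    also have "\<dots> \<le> (1 - s) * (- (B * a)) + s * L"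
      using E\<phi>1w s by (intro add_mono mult_left_mono) auto
    also have "\<dots> = - (a * L) / (\<alpha> + 2 * a)"
    proof -
      have 1: "\<alpha> / (\<alpha> + 2 * a) * (- (B * a)) = - (3 * (a * L)) / (\<alpha> + 2 * a)"
        using \<alpha> by (simp add: B_def mult_ac)
      have 2: "s * L = 2 * (a * L) / (\<alpha> + 2 * a)" by (simp add: s_def)
      have "(1 - s) * (- (B * a)) + s * L = (- (3 * (a * L)) + 2 * (a * L)) / (\<alpha> + 2 * a)"
        by (simp only: s(3) 1 2 add_divide_distrib)
      thus ?thesis by simp
    qed
    also have "\<dots> < 0" using a L \<alpha> by (simp add: divide_neg_pos)
    finally show ?thesis .
  qed
  ultimately show "\<exists>\<phi>. \<phi> \<in> borel_measurable A \<and> (\<forall>x. 0 \<le> \<phi> x \<and> \<phi> x \<le> 1) \<and> 1 - \<alpha> < (\<integral>x. \<phi> x \<partial>A) \<and>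
        (\<integral>x. \<phi> x * (snd x * (fst x + L * snd x)) \<partial>A) < 0"
    unfolding w_def by blast
qed

end

section \<open>Measurability of the deletion effect\<close>

lemma
  fixes X :: "nat \<Rightarrow> nat \<Rightarrow> real"
  shows ols_index: "a < p \<Longrightarrow> ols (mat m p (\<lambda>(i,j). X i j)) (Matrix.vec m y) $ a =
    (\<Sum>i<m. (\<Sum>b<p. mat_inv (mat p p (\<lambda>(b,c). \<Sum>i<m. X i b * X i c)) $$ (a,b) * X i b) * y i)"
    and ols_dim: "dim_vec (ols (mat m p (\<lambda>(i,j). X i j)) (Matrix.vec m y)) = p"
proof -
  let ?X = "mat m p (\<lambda>(i,j). X i j)"
  have G: "transpose_mat ?X * ?X = mat p p (\<lambda>(b,c). \<Sum>i<m. X i b * X i c)"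
    by (rule eq_matI) (auto simp: scalar_prod_def atLeast0LessThan)
  have c: "mat_inv (mat p p (\<lambda>(b,c). \<Sum>i<m. X i b * X i c)) \<in> carrier_mat p p"
    by (rule mat_inv_carrier) simp
  show "ols ?X (Matrix.vec m y) $ a =
    (\<Sum>i<m. (\<Sum>b<p. mat_inv (mat p p (\<lambda>(b,c). \<Sum>i<m. X i b * X i c)) $$ (a,b) * X i b) * y i)" if "a < p"
    unfolding ols_def G using c that by (auto simp: scalar_prod_def atLeast0LessThan)
  show "dim_vec (ols ?X (Matrix.vec m y)) = p" unfolding ols_def G using c by simp
qed

lemma measurable_ols:
  assumes X: "\<And>i j. i < m \<Longrightarrow> j < p \<Longrightarrow> (\<lambda>\<omega>. X \<omega> i j) \<in> borel_measurable M"
    and y: "\<And>i. i < m \<Longrightarrow> (\<lambda>\<omega>. y \<omega> i) \<in> borel_measurable M" and a: "a < p"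
  shows "(\<lambda>\<omega>. ols (mat m p (\<lambda>(i,j). X \<omega> i j)) (Matrix.vec m (y \<omega>)) $ a) \<in> borel_measurable M"
  unfolding ols_index[OF a] using X y a
  by (intro borel_measurable_sum borel_measurable_times measurable_mat_inv) auto

lemma restrict_design:
  assumes S: "S \<subseteq> {..<n}"
  shows "restrict_rows (design_mat n p x) S = mat (card S) p (\<lambda>(i,j). x (pick S i) j)"
    and "restrict_entries (Matrix.vec n y) S = Matrix.vec (card S) (\<lambda>i. y (pick S i))"
proof -
  have SS: "{i. i < n \<and> i \<in> S} = S" using S by auto
  have pk: "pick S i < n" if "i < card S" for i using pick_in_set_le[OF that] S by auto
  show "restrict_rows (design_mat n p x) S = mat (card S) p (\<lambda>(i,j). x (pick S i) j)"
    unfolding restrict_rows_def submatrix_def design_mat_def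
    by (rule eq_matI) (auto simp: SS pk pick_UNIV)
  show "restrict_entries (Matrix.vec n y) S = Matrix.vec (card S) (\<lambda>i. y (pick S i))"
    unfolding restrict_entries_def by (rule eq_vecI) (auto simp: SS pk)
qed

text \<open>A finite maximum of estimates whose entries are, by the cofactor formula, quotients of polynomials in
  the data.\<close>

lemma measurable_deletion_effect:
  assumes x: "\<And>i j. i < n \<Longrightarrow> j < p \<Longrightarrow> (\<lambda>\<omega>. x \<omega> i j) \<in> borel_measurable M"
    and y: "\<And>i. i < n \<Longrightarrow> (\<lambda>\<omega>. y \<omega> i) \<in> borel_measurable M" and v: "v \<in> carrier_vec p"
  shows "(\<lambda>\<omega>. max_deletion_effect k (design_mat n p (x \<omega>)) (Matrix.vec n (y \<omega>)) v) \<in> borel_measurable M"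
proof -
  let ?F = "{S. S \<subseteq> {..<n} \<and> card S = n - k}"
  have fin: "finite ?F" by (rule finite_subset[of _ "Pow {..<n}"]) auto
  let ?g = "\<lambda>S \<omega>. (ols (design_mat n p (x \<omega>)) (Matrix.vec n (y \<omega>)) -
     ols (restrict_rows (design_mat n p (x \<omega>)) S) (restrict_entries (Matrix.vec n (y \<omega>)) S)) \<bullet> v"
  have "?g S \<in> borel_measurable M" if "S \<in> ?F" for S
  proof -
    have S: "S \<subseteq> {..<n}" using that by simp
    have pk: "pick S i < n" if "i < card S" for i using pick_in_set_le[OF that] S by auto
    have eq: "?g S \<omega> = (\<Sum>a<p. (ols (mat n p (\<lambda>(i,j). x \<omega> i j)) (Matrix.vec n (y \<omega>)) $ a -
       ols (mat (card S) p (\<lambda>(i,j). x \<omega> (pick S i) j)) (Matrix.vec (card S) (\<lambda>i. y \<omega> (pick S i))) $ a) * v $ a)" for \<omega>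
      unfolding restrict_design[OF S] using v
      by (auto simp: design_mat_def scalar_prod_def ols_dim atLeast0LessThan)
    show ?thesis unfolding eq
      by (intro borel_measurable_sum borel_measurable_times borel_measurable_diff measurable_ols x y pk) auto
  qed
  hence "(\<lambda>\<omega>. Max ((\<lambda>S. ?g S \<omega>) ` ?F)) \<in> borel_measurable M"
    by (intro borel_measurable_Max fin)
  thus ?thesis by (simp add: max_deletion_effect_def design_mat_def)
qed

section \<open>Reduction to standard Gaussian rows\<close>

lemma pos_def_mat_inverse:
  assumes B: "pos_def_mat p B"
  shows "B * mat_inv B = 1\<^sub>m p" "mat_inv B * B = 1\<^sub>m p" "mat_inv B \<in> carrier_mat p p"
proof -
  have Bc: "B \<in> carrier_mat p p" using B by (simp add: pos_def_mat_def)
  have "Determinant.det B \<noteq> 0"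
  proof
    assume "Determinant.det B = 0"
    then obtain w where "w \<in> carrier_vec p" "w \<noteq> 0\<^sub>v p" "B *\<^sub>v w = 0\<^sub>v p"
      using det_0_iff_vec_prod_zero_field[OF Bc] by blast
    thus False using B by (auto simp: pos_def_mat_def)
  qed
  from mat_inv_inverse[OF Bc this] show "B * mat_inv B = 1\<^sub>m p" "mat_inv B * B = 1\<^sub>m p" .
  show "mat_inv B \<in> carrier_mat p p" by (rule mat_inv_carrier[OF Bc])
qed

text \<open>Writing \<open>x\<^sub>i = B g\<^sub>i\<close> and \<open>y\<^sub>i = \<langle>\<beta>, x\<^sub>i\<rangle> + e\<^sub>i\<close> with \<open>B = \<Sigma>\<^sup>1\<^sup>/\<^sup>2\<close>, the rescaled estimation error
  \<open>d = B (h - \<beta>)\<close> solves the normal equations of the regression of \<open>e\<close> on \<open>g\<close>, and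
  \<open>\<langle>h - \<beta>, v\<rangle> = \<langle>d, B\<^sup>-\<^sup>1 v\<rangle>\<close>.\<close>

lemma whitened_normal_equations:
  fixes g :: "nat \<Rightarrow> nat \<Rightarrow> real" and h :: "real Matrix.vec"
  assumes B: "pos_def_mat p B" and \<beta>: "\<beta> \<in> carrier_vec p" and h: "h \<in> carrier_vec p" and v: "v \<in> carrier_vec p"
    and x: "\<And>i j. i \<in> S \<Longrightarrow> j < p \<Longrightarrow> x i j = (B *\<^sub>v Matrix.vec p (g i)) $ j"
    and y: "\<And>i. i \<in> S \<Longrightarrow> y i = dotp p (($) \<beta>) (x i) + e i"
    and normal: "\<And>j. j < p \<Longrightarrow> (\<Sum>i\<in>S. x i j * (y i - dotp p (x i) (($) h))) = 0"
  defines "d \<equiv> ($) (B *\<^sub>v (h - \<beta>))"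
  shows "\<And>a. a < p \<Longrightarrow> (\<Sum>i\<in>S. g i a * (e i - dotp p (g i) d)) = 0"
    and "(h - \<beta>) \<bullet> v = dotp p d (($) (mat_inv B *\<^sub>v v))"
proof -
  have Bc: "B \<in> carrier_mat p p" "transpose_mat B = B" using B by (auto simp: pos_def_mat_def)
  note inv = pos_def_mat_inverse[OF B]
  have Bij: "B $$ (i,j) = B $$ (j,i)" if "i < p" "j < p" for i j
    using Bc that by (metis carrier_matD index_transpose_mat(1))
  have mv: "(B *\<^sub>v w) $ j = dotp p (\<lambda>k. B $$ (j,k)) (($) w)" if "j < p" "w \<in> carrier_vec p" for j w
    using Bc that by (auto simp: scalar_prod_def dotp_def atLeast0LessThan)
  have x': "x i j = dotp p (\<lambda>k. B $$ (j,k)) (g i)" if "i \<in> S" "j < p" for i j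
    unfolding x[OF that] mv[OF that(2) vec_carrier] by (rule dotp_cong) auto
  have hb: "h - \<beta> \<in> carrier_vec p" using h \<beta> by simp
  have xd: "dotp p (x i) (($) (h - \<beta>)) = dotp p (g i) d" if i: "i \<in> S" for i
  proof -
    have "dotp p (x i) (($) (h - \<beta>)) = dotp p (($) (h - \<beta>)) (\<lambda>j. dotp p (\<lambda>k. B $$ (j,k)) (g i))"
      by (subst dotp_commute) (intro dotp_cong, auto simp: x' i)
    also have "\<dots> = dotp p (\<lambda>k. \<Sum>j<p. (h - \<beta>) $ j * B $$ (j,k)) (g i)" by (rule dotp_matrix_swap)
    also have "\<dots> = dotp p d (g i)"
      unfolding d_def by (rule dotp_cong) (auto simp: mv[OF _ hb] dotp_def Bij mult.commute simp del: index_mult_mat_vec intro!: sum.cong)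
    finally show ?thesis by (simp add: dotp_commute)
  qed
  have res: "y i - dotp p (x i) (($) h) = e i - dotp p (g i) d" if i: "i \<in> S" for i
  proof -
    have "dotp p (x i) (($) (h - \<beta>)) = dotp p (x i) (\<lambda>a. h $ a - \<beta> $ a)"
      by (rule dotp_cong) (use h \<beta> in auto)
    thus ?thesis using xd[OF i] y[OF i] by (simp add: dotp_linear dotp_commute[of p "x i" "($) \<beta>"])
  qed
  define t where "t = (\<lambda>k. \<Sum>i\<in>S. g i k * (e i - dotp p (g i) d))"
  have Bt: "dotp p (\<lambda>k. B $$ (j,k)) t = 0" if j: "j < p" for j
  proof -
    have "(\<Sum>i\<in>S. x i j * (y i - dotp p (x i) (($) h))) =
        (\<Sum>i\<in>S. (e i - dotp p (g i) d) * dotp p (\<lambda>k. B $$ (j,k)) (g i))"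
      by (intro sum.cong refl) (simp add: res x' j mult.commute)
    also have "\<dots> = dotp p (\<lambda>k. B $$ (j,k)) (\<lambda>k. \<Sum>i\<in>S. (e i - dotp p (g i) d) * g i k)"
      by (simp only: dotp_sum_right dotp_scale_right)
    finally show ?thesis using normal[OF j] by (simp add: t_def mult.commute)
  qed
  have "B *\<^sub>v Matrix.vec p t = 0\<^sub>v p"
  proof (rule eq_vecI)
    fix j assume "j < dim_vec (0\<^sub>v p :: real Matrix.vec)"
    hence j: "j < p" by simp
    have "dotp p (\<lambda>k. B $$ (j,k)) (($) (Matrix.vec p t)) = dotp p (\<lambda>k. B $$ (j,k)) t" by (rule dotp_cong) auto
    thus "(B *\<^sub>v Matrix.vec p t) $ j = (0\<^sub>v p :: real Matrix.vec) $ j"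
      using mv[OF j vec_carrier, of t] Bt[OF j] j by simp
  qed (use Bc in simp)
  hence "mat_inv B *\<^sub>v (B *\<^sub>v Matrix.vec p t) = mat_inv B *\<^sub>v 0\<^sub>v p" by simp
  moreover have "mat_inv B *\<^sub>v (B *\<^sub>v Matrix.vec p t) = Matrix.vec p t"
    using assoc_mult_mat_vec[OF inv(3) Bc(1) vec_carrier, of t] inv(2) by simp
  moreover have "mat_inv B *\<^sub>v 0\<^sub>v p = 0\<^sub>v p"
    using inv(3) by (intro eq_vecI) (auto simp: scalar_prod_def)
  ultimately have t0: "Matrix.vec p t = 0\<^sub>v p" by simp
  show "(\<Sum>i\<in>S. g i a * (e i - dotp p (g i) d)) = 0" if "a < p" for a
    using arg_cong[OF t0, of "\<lambda>w. w $ a"] that by (simp add: t_def)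
  define w where "w = mat_inv B *\<^sub>v v"
  have w: "w \<in> carrier_vec p" using inv(3) v by (simp add: w_def)
  have Bw: "B *\<^sub>v w = v"
    unfolding w_def using assoc_mult_mat_vec[OF Bc(1) inv(3) v] inv(1) v by simp
  have "(h - \<beta>) \<bullet> v = dotp p (($) (h - \<beta>)) (\<lambda>j. dotp p (\<lambda>k. B $$ (j,k)) (($) w))"
    using hb v Bw by (subst dotp_scalar_prod[of _ p]) (auto intro!: dotp_cong simp: mv[OF _ w, symmetric])
  also have "\<dots> = dotp p (\<lambda>k. \<Sum>j<p. (h - \<beta>) $ j * B $$ (j,k)) (($) w)" by (rule dotp_matrix_swap)
  also have "\<dots> = dotp p d (($) w)"
    unfolding d_def by (rule dotp_cong) (auto simp: mv[OF _ hb] dotp_def Bij mult.commute simp del: index_mult_mat_vec intro!: sum.cong)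
  finally show "(h - \<beta>) \<bullet> v = dotp p d (($) (mat_inv B *\<^sub>v v))" by (simp add: w_def)
qed

text \<open>Deleting the complement of \<open>S\<close> changes the estimate along \<open>v\<close> by \<open>\<parallel>B\<^sup>-\<^sup>1 v\<parallel>\<close> times the change of the
  coordinate along \<open>u = B\<^sup>-\<^sup>1 v / \<parallel>B\<^sup>-\<^sup>1 v\<parallel>\<close> of the whitened error.\<close>

lemma deletion_effect_lower_bound:
  fixes g :: "nat \<Rightarrow> nat \<Rightarrow> real"
  assumes B: "pos_def_mat p B" and \<beta>: "\<beta> \<in> carrier_vec p" and v: "v \<in> carrier_vec p"
    and x: "\<And>i j. i < n \<Longrightarrow> j < p \<Longrightarrow> x i j = (B *\<^sub>v Matrix.vec p (g i)) $ j"
    and y: "\<And>i. i < n \<Longrightarrow> y i = dotp p (($) \<beta>) (x i) + e i"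
    and S: "S \<subseteq> {..<n}" "card S = n - k"
    and injS: "\<forall>c. (\<forall>i\<in>S. dotp p (g i) c = 0) \<longrightarrow> (\<forall>j<p. c j = 0)"
    and s: "s = vec_l2norm (mat_inv B *\<^sub>v v)" "s > 0"
    and u: "\<And>j. u j = (mat_inv B *\<^sub>v v) $ j / s"
  shows "\<exists>d0 dS. (\<forall>a<p. (\<Sum>i<n. g i a * (e i - dotp p (g i) d0)) = 0) \<and>
     (\<forall>a<p. (\<Sum>i\<in>S. g i a * (e i - dotp p (g i) dS)) = 0) \<and>
     s * (dotp p u d0 - dotp p u dS) \<le> max_deletion_effect k (design_mat n p x) (Matrix.vec n y) v"
proof -
  let ?X = "design_mat n p x" and ?y = "Matrix.vec n y"
  have Bc: "B \<in> carrier_mat p p" "transpose_mat B = B" using B by (auto simp: pos_def_mat_def)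
  note inv = pos_def_mat_inverse[OF B]
  have X: "?X \<in> carrier_mat n p" by (simp add: design_mat_def)
  have Xij: "?X $$ (i,j) = x i j" if "i < n" "j < p" for i j using that by (simp add: design_mat_def)
  have Xd: "dotp p (\<lambda>j. ?X $$ (i,j)) c = dotp p (x i) c" if "i < n" for i c
    by (rule dotp_cong) (auto simp: Xij that)
  have inj_x: "\<forall>c. (\<forall>i\<in>T. dotp p (\<lambda>j. ?X $$ (i,j)) c = 0) \<longrightarrow> (\<forall>j<p. c j = 0)"
    if T: "S \<subseteq> T" "T \<subseteq> {..<n}" for T
  proof (rule allI, rule impI)
    fix c assume c: "\<forall>i\<in>T. dotp p (\<lambda>j. ?X $$ (i,j)) c = 0"
    define c' where "c' = ($) (B *\<^sub>v Matrix.vec p c)"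
    have Bij: "B $$ (i,j) = B $$ (j,i)" if "i < p" "j < p" for i j
      using Bc that by (metis carrier_matD index_transpose_mat(1))
    have mv: "(B *\<^sub>v Matrix.vec p f) $ j = dotp p (\<lambda>k. B $$ (j,k)) f" if "j < p" for f j
      using Bc that by (auto simp: scalar_prod_def dotp_def atLeast0LessThan)
    have "dotp p (g i) c' = 0" if i: "i \<in> S" for i
    proof -
      have iT: "i \<in> T" "i < n" using i T S by auto
      have "dotp p (x i) c = dotp p c (\<lambda>j. dotp p (\<lambda>k. B $$ (j,k)) (g i))"
        by (subst dotp_commute) (intro dotp_cong, auto simp: x iT mv simp del: index_mult_mat_vec)
      also have "\<dots> = dotp p (\<lambda>k. \<Sum>j<p. c j * B $$ (j,k)) (g i)" by (rule dotp_matrix_swap)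
      also have "\<dots> = dotp p c' (g i)"
        unfolding c'_def by (rule dotp_cong) (auto simp: mv dotp_def Bij mult.commute simp del: index_mult_mat_vec intro!: sum.cong)
      finally show ?thesis using c iT Xd[OF iT(2), of c] by (simp add: dotp_commute)
    qed
    hence z: "\<forall>j<p. c' j = 0" using injS by blast
    have "B *\<^sub>v Matrix.vec p c = 0\<^sub>v p"
      using z Bc by (intro eq_vecI) (auto simp: c'_def simp del: index_mult_mat_vec)
    hence "mat_inv B *\<^sub>v (B *\<^sub>v Matrix.vec p c) = mat_inv B *\<^sub>v 0\<^sub>v p" by simp
    moreover have "mat_inv B *\<^sub>v (B *\<^sub>v Matrix.vec p c) = Matrix.vec p c"
      using assoc_mult_mat_vec[OF inv(3) Bc(1) vec_carrier, of c] inv(2) by simp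
    moreover have "mat_inv B *\<^sub>v 0\<^sub>v p = 0\<^sub>v p"
      using inv(3) by (intro eq_vecI) (auto simp: scalar_prod_def)
    ultimately have c0: "Matrix.vec p c = 0\<^sub>v p" by simp
    show "\<forall>j<p. c j = 0"
    proof (rule allI, rule impI)
      fix j assume "j < p"
      thus "c j = 0" using arg_cong[OF c0, of "\<lambda>w. w $ j"] by simp
    qed
  qed
  have yc: "?y \<in> carrier_vec n" by simp
  define h0 where "h0 = ols ?X ?y"
  define hS where "hS = ols (restrict_rows ?X S) (restrict_entries ?y S)"
  have full: "{..<n} = {i. i < n}" by auto
  have inj0: "\<forall>c. (\<forall>i<n. dotp p (\<lambda>j. ?X $$ (i,j)) c = 0) \<longrightarrow> (\<forall>j<p. c j = 0)"
    using inj_x[OF S(1) subset_refl] by (simp add: full)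
  note n0 = ols_normal_equations[OF X yc inj0, folded h0_def]
  note nS = ols_restrict_normal_equations[OF X yc S(1) inj_x[OF subset_refl S(1)], folded hS_def]
  define d0 where "d0 = ($) (B *\<^sub>v (h0 - \<beta>))"
  define dS where "dS = ($) (B *\<^sub>v (hS - \<beta>))"
  have e0: "(\<Sum>i\<in>{..<n}. x i j * (y i - dotp p (x i) (($) h0))) = 0" if "j < p" for j
    using n0(2)[OF that] that by (simp add: Xij Xd)
  have eS: "(\<Sum>i\<in>S. x i j * (y i - dotp p (x i) (($) hS))) = 0" if j: "j < p" for j
  proof -
    have "i < n" if "i \<in> S" for i using S that by auto
    thus ?thesis using nS(2)[OF j] j by (simp add: Xij Xd cong: sum.cong)
  qed
  have Sn: "i < n" if "i \<in> S" for i using S that by auto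
  note w0 = whitened_normal_equations[OF B \<beta> n0(1) v, of "{..<n}" x g y e, folded d0_def]
  note wS = whitened_normal_equations[OF B \<beta> nS(1) v, of S x g y e, folded dS_def]
  have N0: "\<forall>a<p. (\<Sum>i<n. g i a * (e i - dotp p (g i) d0)) = 0"
    using w0(1) x y e0 by (auto simp del: index_mult_mat_vec)
  have NS: "\<forall>a<p. (\<Sum>i\<in>S. g i a * (e i - dotp p (g i) dS)) = 0"
    using wS(1) x y eS Sn by (auto simp del: index_mult_mat_vec)
  have v0: "(h0 - \<beta>) \<bullet> v = dotp p d0 (($) (mat_inv B *\<^sub>v v))"
    using w0(2) x y e0 by (auto simp del: index_mult_mat_vec)
  have vS: "(hS - \<beta>) \<bullet> v = dotp p dS (($) (mat_inv B *\<^sub>v v))"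
    using wS(2) x y eS Sn by (auto simp del: index_mult_mat_vec)
  have su: "dotp p d (($) (mat_inv B *\<^sub>v v)) = s * dotp p u d" for d
  proof -
    have "dotp p d (($) (mat_inv B *\<^sub>v v)) = dotp p d (\<lambda>j. s * u j)"
      using s by (intro dotp_cong) (auto simp: u simp del: index_mult_mat_vec)
    thus ?thesis by (simp add: dotp_linear dotp_commute)
  qed
  have "(h0 - hS) \<bullet> v = (h0 - \<beta>) \<bullet> v - (hS - \<beta>) \<bullet> v"
  proof -
    have "h0 - hS = (h0 - \<beta>) - (hS - \<beta>)" using n0(1) nS(1) \<beta> by (intro eq_vecI) auto
    thus ?thesis using n0(1) nS(1) \<beta> v by (simp add: minus_scalar_prod_distrib[of _ p])
  qed
  hence eq: "(h0 - hS) \<bullet> v = s * (dotp p u d0 - dotp p u dS)"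
    unfolding v0 vS su by (simp add: algebra_simps)
  have "(h0 - hS) \<bullet> v \<le> max_deletion_effect k ?X ?y v"
  proof -
    have dr: "dim_row ?X = n" by (simp add: design_mat_def)
    have fin: "finite {S. S \<subseteq> {..<n} \<and> card S = n - k}" by (rule finite_subset[of _ "Pow {..<n}"]) auto
    show ?thesis unfolding max_deletion_effect_def dr h0_def hS_def
      using fin S by (intro Max_ge finite_imageI imageI) auto
  qed
  thus ?thesis using N0 NS eq by (intro exI[of _ d0] exI[of _ dS]) auto
qed

section \<open>From the projections to the deletion effect\<close>

lemma perp_recombine: "a < p \<Longrightarrow> recombine p u z x a = perp p u x a + z * u a"
  by (simp add: recombine_def perp_def algebra_simps)

text \<open>The deterministic core. On the retained rows the residual form of \<open>z\<close> against \<open>e + l z\<close> is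
  negative of order \<open>n\<close>, so the coordinate along \<open>u\<close> falls below \<open>- l\<close> by at least \<open>\<delta>\<close>; on the full
  sample the form against \<open>e + \<delta> z\<close> is nonnegative, so the coordinate stays above \<open>- \<delta>\<close>.\<close>

lemma deletion_effect_ge:
  fixes e z :: "nat \<Rightarrow> real" and h :: "nat \<Rightarrow> nat \<Rightarrow> real" and \<gamma> c C \<delta> l :: real
  assumes B: "pos_def_mat p B" and \<beta>: "\<beta> \<in> carrier_vec p" and v: "v \<in> carrier_vec p"
    and s: "s = vec_l2norm (mat_inv B *\<^sub>v v)" "s > 0" and u: "\<And>j. u j = (mat_inv B *\<^sub>v v) $ j / s"
    and uu: "dotp p u u = 1"
    and x: "\<And>i j. i < n \<Longrightarrow> j < p \<Longrightarrow> x i j = (B *\<^sub>v Matrix.vec p (recombine p u (z i) (h i))) $ j"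
    and y: "\<And>i. i < n \<Longrightarrow> y i = dotp p (($) \<beta>) (x i) + e i"
    and S: "S \<subseteq> {..<n}" "card S = n - k" and n: "0 < n" "real n \<le> 2 * card S"
    and inj: "\<forall>c. (\<forall>i\<in>S. dotp p (recombine p u (z i) (h i)) c = 0) \<longrightarrow> (\<forall>j<p. c j = 0)"
    and p: "1 \<le> p" "real p \<le> \<gamma> * card S" and \<gamma>: "0 \<le> \<gamma>" "\<gamma> < 1"
    and C: "0 < c" "0 < C" "0 < \<delta>" "\<delta> * C \<le> (1 - \<gamma>) * c / 4"
    and zz: "(\<Sum>i<n. (z i)\<^sup>2) \<le> C * n"
    and sumS: "(\<Sum>i\<in>S. z i * (e i + l * z i)) \<le> - c * card S"
    and sumn: "\<delta> / 2 * n \<le> (\<Sum>i<n. z i * (e i + \<delta> * z i))"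
    and devn: "gaussian_rows.form_deviation p {..<n} u z (\<lambda>i. e i + \<delta> * z i) h \<le> (1 - \<gamma>) * \<delta> / 2 * n"
    and devS: "- ((1 - \<gamma>) * c / 4 * n) \<le> gaussian_rows.form_deviation p S u z (\<lambda>i. e i + l * z i) h"
  shows "s * l \<le> max_deletion_effect k (design_mat n p x) (Matrix.vec n y) v"
proof -
  let ?g = "\<lambda>i. recombine p u (z i) (h i)" and ?r = "\<lambda>i. perp p u (h i)"
  interpret RS: gaussian_rows p n S u using uu S by unfold_locales
  interpret Rn: gaussian_rows p n "{..<n}" u using uu by unfold_locales auto
  have "\<exists>d0 dS. (\<forall>a<p. (\<Sum>i<n. ?g i a * (e i - dotp p (?g i) d0)) = 0) \<and>
     (\<forall>a<p. (\<Sum>i\<in>S. ?g i a * (e i - dotp p (?g i) dS)) = 0) \<and>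
     s * (dotp p u d0 - dotp p u dS) \<le> max_deletion_effect k (design_mat n p x) (Matrix.vec n y) v"
    by (rule deletion_effect_lower_bound[OF B \<beta> v x y S inj s u])
  then obtain d0 dS where d: "\<forall>a<p. (\<Sum>i<n. ?g i a * (e i - dotp p (?g i) d0)) = 0"
      "\<forall>a<p. (\<Sum>i\<in>S. ?g i a * (e i - dotp p (?g i) dS)) = 0"
    and le: "s * (dotp p u d0 - dotp p u dS) \<le> max_deletion_effect k (design_mat n p x) (Matrix.vec n y) v"
    by (elim exE conjE)
  have inj_n: "\<forall>c. (\<forall>i\<in>{..<n}. dotp p (?g i) c = 0) \<longrightarrow> (\<forall>j<p. c j = 0)"
  proof (rule allI, rule impI)
    fix c assume "\<forall>i\<in>{..<n}. dotp p (?g i) c = 0"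
    hence "\<forall>i\<in>S. dotp p (?g i) c = 0" using S(1) by blast
    thus "\<forall>j<p. c j = 0" using inj by blast
  qed
  have perp0: "dotp p u (?r i) = 0" for i by (rule dotp_perp[OF uu])
  note FS = frisch_waugh_lovell[where S = S and r = ?r and g = ?g and z = z and e = e and d = dS,
      OF RS.finite_S uu perp0 perp_recombine inj]
  note Fn = frisch_waugh_lovell[where S = "{..<n}" and r = ?r and g = ?g and z = z and e = e and d = d0,
      OF Rn.finite_S uu perp0 perp_recombine inj_n]
  let ?QS = "resid_form p S ?r u" and ?Qn = "resid_form p {..<n} ?r u"
  have m: "0 < card S" using n by simp
  have Sn: "card S \<le> n" using card_mono[OF finite_lessThan S(1)] by simp
  have split: "resid_form p T ?r u z b = (1 - (real p - 1) / card T) * (\<Sum>i\<in>T. z i * b i) - gaussian_rows.form_deviation p T u z b h"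
    if R: "gaussian_rows p n T u" and ns: "nonsing p (gram T ?r u)" for T b
  proof -
    interpret R: gaussian_rows p n T u by (rule R)
    have "(\<Sum>i\<in>T. R.K h i i) = real p - 1"
      unfolding R.K_def by (rule pker_trace[OF ns uu perp0])
    thus ?thesis by (simp add: R.form_deviation_def resid_form_def R.K_def left_diff_distrib)
  qed
  have nsS: "nonsing p (gram S ?r u)" using FS(1) d(2) by blast
  have nsn: "nonsing p (gram {..<n} ?r u)" using Fn(1) d(1) by blast
  have QS: "?QS z (\<lambda>i. e i + l * z i) = (dotp p u dS + l) * ?QS z z" "0 < ?QS z z" "?QS z z \<le> (\<Sum>i\<in>S. (z i)\<^sup>2)"
    using FS(2-4) d(2) by blast+
  have Qn: "?Qn z (\<lambda>i. e i + \<delta> * z i) = (dotp p u d0 + \<delta>) * ?Qn z z" "0 < ?Qn z z"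
    using Fn(2,3) d(1) by blast+
  have frac: "1 - \<gamma> \<le> 1 - (real p - 1) / N" if "card S \<le> N" for N :: nat
  proof -
    have "real p - 1 \<le> \<gamma> * N" using p \<gamma> that mult_left_mono[of "real (card S)" N \<gamma>] by simp
    thus ?thesis using m that by (simp add: field_simps)
  qed
  \<comment> \<open>the quotient of the forms against \<open>e + l z\<close> and against \<open>z\<close> is \<open>\<langle>u, d\<^sub>S\<rangle> + l\<close>; the deviation consumes half of the available negativity\<close>
  have "?QS z (\<lambda>i. e i + l * z i) \<le> - ((1 - \<gamma>) * c / 4 * n)"
  proof -
    have neg: "(\<Sum>i\<in>S. z i * (e i + l * z i)) \<le> - (c * card S)" using sumS by simp
    have "(1 - (real p - 1) / card S) * (\<Sum>i\<in>S. z i * (e i + l * z i)) \<le> (1 - \<gamma>) * - (c * card S)"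
    proof -
      have "(1 - (real p - 1) / card S) * (\<Sum>i\<in>S. z i * (e i + l * z i)) \<le> (1 - (real p - 1) / card S) * - (c * card S)"
        using neg frac[of "card S"] \<gamma> by (intro mult_left_mono) auto
      also have "\<dots> \<le> (1 - \<gamma>) * - (c * card S)"
        using frac[of "card S"] C(1) by (intro mult_right_mono_neg) auto
      finally show ?thesis .
    qed
    moreover have "(1 - \<gamma>) * c / 2 * n \<le> (1 - \<gamma>) * (c * card S)"
      using mult_left_mono[OF n(2), of "(1 - \<gamma>) * c / 2"] n(2) \<gamma> C by (simp add: mult_ac)
    ultimately show ?thesis
      unfolding split[OF RS.gaussian_rows_axioms nsS] using devS by (simp add: algebra_simps)
  qed
  hence "(dotp p u dS + l) * ?QS z z \<le> - ((1 - \<gamma>) * c / 4 * n)" by (simp only: QS(1))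
  also have "\<dots> \<le> - (\<delta> * C * n)" using C(4) mult_right_mono[OF C(4), of "real n"] by simp
  also have "\<dots> \<le> - \<delta> * ?QS z z"
  proof -
    have "?QS z z \<le> C * n"
      using QS(3) zz sum_mono2[OF finite_lessThan S(1), of "\<lambda>i. (z i)\<^sup>2"] by simp
    thus ?thesis using C(3) mult_left_mono[of "?QS z z" "C * n" \<delta>] by (simp add: mult_ac)
  qed
  finally have "dotp p u dS + l \<le> - \<delta>" using QS(2) by (simp only: mult_le_cancel_right)
  \<comment> \<open>on the full sample only the sign of the form against \<open>e + \<delta> z\<close> matters\<close>
  moreover have "0 \<le> ?Qn z (\<lambda>i. e i + \<delta> * z i)"
  proof -
    have "(1 - \<gamma>) * (\<delta> / 2 * n) \<le> (1 - (real p - 1) / n) * (\<Sum>i<n. z i * (e i + \<delta> * z i))"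
      using frac[OF Sn] sumn \<gamma> C by (intro mult_mono) auto
    moreover have "(1 - \<gamma>) * (\<delta> / 2 * n) = (1 - \<gamma>) * \<delta> / 2 * n" by simp
    ultimately show ?thesis
      unfolding split[OF Rn.gaussian_rows_axioms nsn] card_lessThan using devn by linarith
  qed
  hence "0 \<le> dotp p u d0 + \<delta>" using Qn by (simp add: zero_le_mult_iff)
  ultimately have "l \<le> dotp p u d0 - dotp p u dS" by simp
  hence "s * l \<le> s * (dotp p u d0 - dotp p u dS)" using s(2) by (intro mult_left_mono) auto
  thus ?thesis using le by simp
qed

text \<open>Without noise both regressions have the solution \<open>0\<close>, uniquely as the retained rows have full rank.\<close>

lemma deletion_effect_nonneg_noiseless:
  assumes B: "pos_def_mat p B" and \<beta>: "\<beta> \<in> carrier_vec p" and v: "v \<in> carrier_vec p"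
    and s: "s = vec_l2norm (mat_inv B *\<^sub>v v)" "s > 0" and u: "\<And>j. u j = (mat_inv B *\<^sub>v v) $ j / s"
    and x: "\<And>i j. i < n \<Longrightarrow> j < p \<Longrightarrow> x i j = (B *\<^sub>v Matrix.vec p (g i)) $ j"
    and y: "\<And>i. i < n \<Longrightarrow> y i = dotp p (($) \<beta>) (x i) + e i" and e: "\<And>i. i < n \<Longrightarrow> e i = 0"
    and S: "S \<subseteq> {..<n}" "card S = n - k"
    and inj: "\<forall>c. (\<forall>i\<in>S. dotp p (g i) c = 0) \<longrightarrow> (\<forall>j<p. c j = 0)"
  shows "0 \<le> max_deletion_effect k (design_mat n p x) (Matrix.vec n y) v"
proof -
  have zero: "dotp p u d = 0" if T: "S \<subseteq> T" "T \<subseteq> {..<n}"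
      and d: "\<forall>a<p. (\<Sum>i\<in>T. g i a * (e i - dotp p (g i) d)) = 0" for T d
  proof -
    have fin: "finite T" using T finite_subset by blast
    have e0: "e i = 0" if "i \<in> T" for i using e T that by auto
    have "(\<Sum>i\<in>T. g i a * dotp p (g i) d) = 0" if "a < p" for a
    proof -
      have "(\<Sum>i\<in>T. g i a * (e i - dotp p (g i) d)) = - (\<Sum>i\<in>T. g i a * dotp p (g i) d)"
        by (simp add: e0 sum_negf)
      thus ?thesis using d that by simp
    qed
    hence "0 = dotp p d (\<lambda>a. \<Sum>i\<in>T. dotp p (g i) d * g i a)" by (simp add: dotp_def mult.commute)
    also have "\<dots> = (\<Sum>i\<in>T. dotp p (g i) d * dotp p d (g i))" by (simp only: dotp_sum_right dotp_scale_right)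
    also have "\<dots> = (\<Sum>i\<in>T. (dotp p (g i) d)\<^sup>2)" by (simp add: dotp_commute[of p d] power2_eq_square)
    finally have "\<forall>i\<in>T. (dotp p (g i) d)\<^sup>2 = 0" using fin by (simp add: sum_nonneg_eq_0_iff)
    hence "\<forall>i\<in>S. dotp p (g i) d = 0" using T(1) by auto
    hence "\<forall>j<p. d j = 0" using inj by blast
    thus ?thesis by (simp add: dotp_def)
  qed
  have "\<exists>d0 dS. (\<forall>a<p. (\<Sum>i<n. g i a * (e i - dotp p (g i) d0)) = 0) \<and>
     (\<forall>a<p. (\<Sum>i\<in>S. g i a * (e i - dotp p (g i) dS)) = 0) \<and>
     s * (dotp p u d0 - dotp p u dS) \<le> max_deletion_effect k (design_mat n p x) (Matrix.vec n y) v"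
    by (rule deletion_effect_lower_bound[OF B \<beta> v x y S inj s u])
  then obtain d0 dS where d: "\<forall>a<p. (\<Sum>i<n. g i a * (e i - dotp p (g i) d0)) = 0"
      "\<forall>a<p. (\<Sum>i\<in>S. g i a * (e i - dotp p (g i) dS)) = 0"
    and le: "s * (dotp p u d0 - dotp p u dS) \<le> max_deletion_effect k (design_mat n p x) (Matrix.vec n y) v"
    by (elim exE conjE)
  show ?thesis using le zero[OF S(1) subset_refl d(1)] zero[OF subset_refl S(1) d(2)] by simp
qed

text \<open>The variance bound of the residual form is of order \<open>n\<close>, uniformly in \<open>S\<close>: every factor is dominated
  by \<open>1 + z\<^sub>i\<^sup>4 + e\<^sub>i\<^sup>4\<close>, whose sum over the whole sample obeys a law of large numbers. Uniformity matters since
  \<open>S\<close> depends on the sample.\<close>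

lemma form_deviation_moments_le:
  fixes z e :: "nat \<Rightarrow> real" and C l :: real
  assumes q: "(\<Sum>i<n. 1 + z i ^ 4 + e i ^ 4) \<le> C * n" and S: "S \<subseteq> {..<n}" and n: "0 < n" "real n / 4 \<le> real (card S) - 1"
  shows "4 * (\<Sum>i\<in>S. (z i)\<^sup>2) * (\<Sum>i\<in>S. (e i + l * z i)\<^sup>2) / (real (card S) - 1) + 2 * (\<Sum>i\<in>S. (z i * (e i + l * z i))\<^sup>2)
      \<le> (32 * C\<^sup>2 + 4 * C) * (1 + l\<^sup>2) * n"
proof -
  define Q where "Q = (\<lambda>i. 1 + z i ^ 4 + e i ^ 4)"
  have Q0: "0 \<le> Q i" for i by (simp add: Q_def)
  have QS: "(\<Sum>i\<in>S. Q i) \<le> C * n"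
    using q sum_mono2[OF finite_lessThan S, of Q] Q0 by (simp add: Q_def)
  have sq: "t\<^sup>2 \<le> 1 + t ^ 4" for t :: real
  proof -
    have "0 \<le> (t\<^sup>2 - 1)\<^sup>2" "0 \<le> t ^ 4" by simp_all
    thus ?thesis by (simp add: power2_eq_square power4_eq_xxxx algebra_simps)
  qed
  have prod: "(a * b)\<^sup>2 \<le> a ^ 4 + b ^ 4" for a b :: real
  proof -
    have "0 \<le> (a\<^sup>2 - b\<^sup>2)\<^sup>2" "0 \<le> a ^ 4" "0 \<le> b ^ 4" by simp_all
    thus ?thesis by (simp add: power2_eq_square power4_eq_xxxx algebra_simps)
  qed
  have lin: "(a + l * b)\<^sup>2 \<le> 2 * (a\<^sup>2 + l\<^sup>2 * b\<^sup>2)" for a b :: real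
  proof -
    have "0 \<le> (a - l * b)\<^sup>2" by simp
    thus ?thesis by (simp add: power2_eq_square algebra_simps)
  qed
  have z2: "(z i)\<^sup>2 \<le> Q i" and e2: "(e i)\<^sup>2 \<le> Q i" for i
    using sq[of "z i"] sq[of "e i"] by (auto simp: Q_def intro: order_trans)
  have b2: "(e i + l * z i)\<^sup>2 \<le> 2 * (1 + l\<^sup>2) * Q i" for i
  proof -
    have "(e i + l * z i)\<^sup>2 \<le> 2 * ((e i)\<^sup>2 + l\<^sup>2 * (z i)\<^sup>2)" by (rule lin)
    also have "\<dots> \<le> 2 * (Q i + l\<^sup>2 * Q i)" using z2[of i] e2[of i] by (intro mult_left_mono add_mono) auto
    finally show ?thesis by (simp add: algebra_simps)
  qed
  have zb2: "(z i * (e i + l * z i))\<^sup>2 \<le> 2 * (1 + l\<^sup>2) * Q i" for i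
  proof -
    have "(z i * (e i + l * z i))\<^sup>2 = (z i * e i + l * (z i)\<^sup>2)\<^sup>2" by (simp add: power2_eq_square algebra_simps)
    also have "\<dots> \<le> 2 * ((z i * e i)\<^sup>2 + l\<^sup>2 * ((z i)\<^sup>2)\<^sup>2)" by (rule lin)
    also have "\<dots> \<le> 2 * (Q i + l\<^sup>2 * Q i)"
    proof (intro mult_left_mono add_mono)
      show "(z i * e i)\<^sup>2 \<le> Q i" using prod[of "z i" "e i"] by (simp add: Q_def)
      show "((z i)\<^sup>2)\<^sup>2 \<le> Q i" by (simp add: Q_def power_mult[symmetric])
    qed auto
    finally show ?thesis by (simp add: algebra_simps)
  qed
  have Cn: "0 \<le> C * n" using QS sum_nonneg[of S Q] Q0 by (meson order_trans)
  have C0: "0 \<le> C" using Cn n(1) by (simp add: zero_le_mult_iff)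
  have Z: "(\<Sum>i\<in>S. (z i)\<^sup>2) \<le> C * n" using QS sum_mono[of S "\<lambda>i. (z i)\<^sup>2" Q] z2 by (meson order_trans)
  have E: "(\<Sum>i\<in>S. (e i + l * z i)\<^sup>2) \<le> 2 * (1 + l\<^sup>2) * (C * n)"
  proof -
    have "(\<Sum>i\<in>S. (e i + l * z i)\<^sup>2) \<le> (\<Sum>i\<in>S. 2 * (1 + l\<^sup>2) * Q i)" by (intro sum_mono b2)
    also have "\<dots> = 2 * (1 + l\<^sup>2) * (\<Sum>i\<in>S. Q i)" by (simp add: sum_distrib_left)
    also have "\<dots> \<le> 2 * (1 + l\<^sup>2) * (C * n)" using QS by (intro mult_left_mono) auto
    finally show ?thesis .
  qed
  have W: "(\<Sum>i\<in>S. (z i * (e i + l * z i))\<^sup>2) \<le> 2 * (1 + l\<^sup>2) * (C * n)"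
  proof -
    have "(\<Sum>i\<in>S. (z i * (e i + l * z i))\<^sup>2) \<le> (\<Sum>i\<in>S. 2 * (1 + l\<^sup>2) * Q i)" by (intro sum_mono zb2)
    also have "\<dots> = 2 * (1 + l\<^sup>2) * (\<Sum>i\<in>S. Q i)" by (simp add: sum_distrib_left)
    also have "\<dots> \<le> 2 * (1 + l\<^sup>2) * (C * n)" using QS by (intro mult_left_mono) auto
    finally show ?thesis .
  qed
  have "4 * (\<Sum>i\<in>S. (z i)\<^sup>2) * (\<Sum>i\<in>S. (e i + l * z i)\<^sup>2) / (real (card S) - 1)
     \<le> 4 * (C * n) * (2 * (1 + l\<^sup>2) * (C * n)) / (real n / 4)"
    using Z E n Cn C0 by (intro frac_le mult_mono mult_nonneg_nonneg sum_nonneg) auto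
  also have "\<dots> = 32 * C\<^sup>2 * (1 + l\<^sup>2) * n" using n by (simp add: power2_eq_square)
  finally show ?thesis using W by (simp add: algebra_simps)
qed

section \<open>Laws of the sample\<close>

text \<open>A Gaussian vector and independent noise, assembled from the pair (noise, component along \<open>u\<close>) and a
  Gaussian vector supplying the other directions.\<close>

lemma distr_gaussian_noise:
  assumes D: "prob_space D" "sets D = sets borel" and u: "dotp p u u = 1"
  shows "distr ((D \<Otimes>\<^sub>M std_normal_distribution) \<Otimes>\<^sub>M std_gauss p) (borel_vec p \<Otimes>\<^sub>M borel)
     (\<lambda>x. (recombine p u (snd (fst x)) (snd x), fst (fst x))) = std_gauss p \<Otimes>\<^sub>M D"
    (is "distr ?P ?N ?f = _")
proof -
  interpret d: prob_space D by fact
  interpret n: prob_space std_normal_distribution by (rule prob_space_std_normal)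
  interpret g: prob_space "std_gauss p" by (rule prob_space_std_gauss)
  interpret ng: pair_prob_space std_normal_distribution "std_gauss p" ..
  interpret dn: pair_prob_space D std_normal_distribution ..
  interpret dng: pair_prob_space "D \<Otimes>\<^sub>M std_normal_distribution" "std_gauss p" ..
  note [measurable_cong] = sets_std_gauss D(2)
  have f[measurable]: "?f \<in> measurable ?P ?N" by measurable
  show ?thesis
  proof (rule pair_measure_eqI[symmetric])
    show "sigma_finite_measure (std_gauss p)" "sigma_finite_measure D"
      by (intro prob_space_imp_sigma_finite g.prob_space_axioms d.prob_space_axioms)+
    show "sets (std_gauss p \<Otimes>\<^sub>M D) = sets (distr ?P ?N ?f)"
      using sets_pair_measure_cong[OF sets_std_gauss D(2), of p] by simp
    fix X E assume "X \<in> sets (std_gauss p)" "E \<in> sets D"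
    hence X[measurable]: "X \<in> sets (borel_vec p)" and E[measurable]: "E \<in> sets borel"
      by (simp_all add: sets_std_gauss D(2))
    have "emeasure (distr ?P ?N ?f) (X \<times> E) = (\<integral>\<^sup>+y. indicator (X \<times> E) y \<partial>distr ?P ?N ?f)"
      by simp
    also have "\<dots> = (\<integral>\<^sup>+x. indicator (X \<times> E) (?f x) \<partial>?P)" by (rule nn_integral_distr) measurable
    also have "\<dots> = (\<integral>\<^sup>+w. \<integral>\<^sup>+h. indicator (X \<times> E) (?f (w, h)) \<partial>std_gauss p \<partial>(D \<Otimes>\<^sub>M std_normal_distribution))"
      by (rule g.nn_integral_fst[symmetric]) measurable
    also have "\<dots> = (\<integral>\<^sup>+e. \<integral>\<^sup>+z. \<integral>\<^sup>+h. indicator (X \<times> E) (?f ((e, z), h)) \<partial>std_gauss p \<partial>std_normal_distribution \<partial>D)"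
      by (rule n.nn_integral_fst[symmetric]) measurable
    also have "\<dots> = (\<integral>\<^sup>+e. indicator E e * emeasure (std_gauss p) X \<partial>D)"
    proof (rule nn_integral_cong)
      fix e
      have "(\<integral>\<^sup>+z. \<integral>\<^sup>+h. indicator (X \<times> E) (?f ((e, z), h)) \<partial>std_gauss p \<partial>std_normal_distribution) =
          (\<integral>\<^sup>+z. \<integral>\<^sup>+h. indicator E e * indicator X (recombine p u z h) \<partial>std_gauss p \<partial>std_normal_distribution)"
        by (intro nn_integral_cong) (auto simp: indicator_def)
      also have "\<dots> = (\<integral>\<^sup>+x. indicator E e * indicator X (recombine p u (fst x) (snd x)) \<partial>(std_normal_distribution \<Otimes>\<^sub>M std_gauss p))"
        by (subst g.nn_integral_fst[symmetric]) simp_all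
      also have "\<dots> = indicator E e * (\<integral>\<^sup>+x. indicator X (recombine p u (fst x) (snd x)) \<partial>(std_normal_distribution \<Otimes>\<^sub>M std_gauss p))"
        by (rule nn_integral_cmult) measurable
      also have "(\<integral>\<^sup>+x. indicator X (recombine p u (fst x) (snd x)) \<partial>(std_normal_distribution \<Otimes>\<^sub>M std_gauss p)) =
          (\<integral>\<^sup>+x. indicator X x \<partial>distr (std_normal_distribution \<Otimes>\<^sub>M std_gauss p) (borel_vec p) (\<lambda>x. recombine p u (fst x) (snd x)))"
        by (rule nn_integral_distr[symmetric]) measurable
      also have "\<dots> = emeasure (std_gauss p) X"
        unfolding distr_recombine[OF u] by simp
      finally show "(\<integral>\<^sup>+z. \<integral>\<^sup>+h. indicator (X \<times> E) (?f ((e, z), h)) \<partial>std_gauss p \<partial>std_normal_distribution) =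
         indicator E e * emeasure (std_gauss p) X" .
    qed
    also have "\<dots> = emeasure D E * emeasure (std_gauss p) X"
      by (subst nn_integral_multc) auto
    finally show "emeasure (std_gauss p) X * emeasure D E = emeasure (distr ?P ?N ?f) (X \<times> E)"
      by (simp add: mult.commute)
  qed
qed

text \<open>One observation as a function of its noise \<open>e\<close>, its Gaussian component \<open>z\<close> along \<open>u\<close> and an
  independent Gaussian vector supplying the other directions.\<close>

definition row_map :: "nat \<Rightarrow> real mat \<Rightarrow> real Matrix.vec \<Rightarrow> (nat \<Rightarrow> real) \<Rightarrow> (real \<times> real) \<times> (nat \<Rightarrow> real) \<Rightarrow> (nat \<Rightarrow> real) \<times> real" where
  "row_map p B \<beta> u x = (let w = (\<lambda>j\<in>{..<p}. (B *\<^sub>v Matrix.vec p (recombine p u (snd (fst x)) (snd x))) $ j)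
     in (w, \<beta> \<bullet> Matrix.vec p w + fst (fst x)))"

lemma measurable_linear_image:
  assumes B: "B \<in> carrier_mat p p"
  shows "(\<lambda>g. \<lambda>j\<in>{..<p}. (B *\<^sub>v Matrix.vec p g) $ j) \<in> measurable (borel_vec p) (borel_vec p)"
proof (rule measurable_restrict)
  fix j assume "j \<in> {..<p}"
  hence "(\<lambda>g. (B *\<^sub>v Matrix.vec p g) $ j) = (\<lambda>g. dotp p (\<lambda>k. B $$ (j,k)) g)"
    using B by (auto simp: scalar_prod_def dotp_def atLeast0LessThan fun_eq_iff)
  thus "(\<lambda>g. (B *\<^sub>v Matrix.vec p g) $ j) \<in> borel_measurable (borel_vec p)"
    by (simp del: index_mult_mat_vec) measurable
qed

lemma linear_model_law_row_map:
  assumes D: "prob_space D" "sets D = sets borel" and u: "dotp p u u = 1"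
    and B: "B = mat_sqrt \<Sigma>" "B \<in> carrier_mat p p" and \<beta>: "\<beta> \<in> carrier_vec p"
  shows "row_map p B \<beta> u \<in> measurable ((D \<Otimes>\<^sub>M std_normal_distribution) \<Otimes>\<^sub>M std_gauss p) (borel_vec p \<Otimes>\<^sub>M borel)"
    and "linear_model_law p \<Sigma> \<beta> D =
      distr ((D \<Otimes>\<^sub>M std_normal_distribution) \<Otimes>\<^sub>M std_gauss p) (borel_vec p \<Otimes>\<^sub>M borel) (row_map p B \<beta> u)"
proof -
  note [measurable_cong] = sets_std_gauss D(2)
  let ?P = "(D \<Otimes>\<^sub>M std_normal_distribution) \<Otimes>\<^sub>M std_gauss p" and ?N = "borel_vec p \<Otimes>\<^sub>M borel :: ((nat \<Rightarrow> real) \<times> real) measure"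
  let ?f = "\<lambda>x. (recombine p u (snd (fst x)) (snd x), fst (fst x))"
  let ?lin = "\<lambda>g. \<lambda>j\<in>{..<p}. (B *\<^sub>v Matrix.vec p g) $ j"
  have lin[measurable]: "?lin \<in> measurable (borel_vec p) (borel_vec p)" by (rule measurable_linear_image[OF B(2)])
  have f[measurable]: "?f \<in> measurable ?P ?N" by measurable
  define m where "m = (\<lambda>(x, e). (x, \<beta> \<bullet> Matrix.vec p x + e) :: (nat \<Rightarrow> real) \<times> real)"
  have m[measurable]: "m \<in> measurable ?N ?N"
  proof -
    have "m = (\<lambda>x. (fst x, dotp p (($) \<beta>) (fst x) + snd x))"
      using \<beta> by (auto simp: m_def fun_eq_iff dotp_scalar_prod[of _ p] intro!: dotp_cong)
    thus ?thesis by simp measurable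
  qed
  define l where "l = (\<lambda>(g, e). (?lin g, e) :: (nat \<Rightarrow> real) \<times> real)"
  have l[measurable]: "l \<in> measurable ?N ?N" unfolding l_def case_prod_beta by measurable
  have rm: "row_map p B \<beta> u = (\<lambda>x. m (l (?f x)))" by (auto simp: row_map_def m_def l_def Let_def fun_eq_iff)
  show rmm: "row_map p B \<beta> u \<in> measurable ?P ?N" unfolding rm by measurable
  have sD: "sigma_finite_measure (distr D borel (\<lambda>x. x))"
    by (intro prob_space_imp_sigma_finite prob_space.prob_space_distr D) measurable
  have dD: "distr D borel (\<lambda>x. x) = D" using distr_id2[OF D(2)[symmetric]] .
  have sN: "sets (std_gauss p \<Otimes>\<^sub>M D) = sets ?N" by (rule sets_pair_measure_cong[OF sets_std_gauss D(2)])
  have "gaussian_measure p \<Sigma> \<Otimes>\<^sub>M D = distr (std_gauss p) (borel_vec p) ?lin \<Otimes>\<^sub>M distr D borel (\<lambda>x. x)"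
    by (simp add: gaussian_measure_def B(1) dD)
  also have "\<dots> = distr (std_gauss p \<Otimes>\<^sub>M D) ?N (\<lambda>(x, y). (?lin x, y))"
    by (rule pair_measure_distr[OF _ _ sD]) measurable
  also have "\<dots> = distr (std_gauss p \<Otimes>\<^sub>M D) ?N l" by (simp add: l_def)
  also have "\<dots> = distr (distr ?P ?N ?f) ?N l" by (simp only: distr_gaussian_noise[OF D u])
  also have "\<dots> = distr ?P ?N (l \<circ> ?f)" by (rule distr_distr[OF l f])
  finally have "linear_model_law p \<Sigma> \<beta> D = distr (distr ?P ?N (l \<circ> ?f)) ?N m"
    by (simp add: linear_model_law_def m_def)
  also have "\<dots> = distr ?P ?N (m \<circ> (l \<circ> ?f))" by (rule distr_distr[OF m]) measurable
  finally show "linear_model_law p \<Sigma> \<beta> D = distr ?P ?N (row_map p B \<beta> u)"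
    by (simp add: rm comp_def)
qed

text \<open>An event for an i.i.d. sample with law \<open>T\<^sub>*(A \<otimes> B)\<close> is an event for two independent families
  with laws \<open>A\<close> and \<open>B\<close>.\<close>

lemma iid_samples_measure:
  fixes A :: "'a measure" and B :: "'b measure" and N :: "'c measure"
  assumes M: "prob_space M" and A: "prob_space A" and B: "prob_space B"
    and T: "T \<in> measurable (A \<Otimes>\<^sub>M B) N" and L: "L = distr (A \<Otimes>\<^sub>M B) N T"
    and iid: "iid_samples M n L Z" and n: "0 < n"
    and E: "E \<in> sets (PiM {..<n} (\<lambda>_. N))"
  shows "measure M {\<omega> \<in> space M. (\<lambda>i\<in>{..<n}. Z i \<omega>) \<in> E} =
     measure (PiM {..<n} (\<lambda>_. A) \<Otimes>\<^sub>M PiM {..<n} (\<lambda>_. B))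
       {\<omega> \<in> space (PiM {..<n} (\<lambda>_. A) \<Otimes>\<^sub>M PiM {..<n} (\<lambda>_. B)). (\<lambda>i\<in>{..<n}. T (fst \<omega> i, snd \<omega> i)) \<in> E}"
proof -
  interpret M: prob_space M by fact
  interpret a: prob_space A by fact
  interpret b: prob_space B by fact
  interpret ab: pair_prob_space A B ..
  have setsL: "sets L = sets N" by (simp add: L)
  have ind: "M.indep_vars (\<lambda>_. L) Z {..<n}" and dist: "\<And>i. i < n \<Longrightarrow> distr M L (Z i) = L"
    using iid by (auto simp: iid_samples_def)
  have rv: "Z i \<in> measurable M L" if "i \<in> {..<n}" for i
    using ind that by (auto simp: M.indep_vars_def2)
  have ZL: "(\<lambda>\<omega>. \<lambda>i\<in>{..<n}. Z i \<omega>) \<in> measurable M (PiM {..<n} (\<lambda>_. L))"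
    by (rule measurable_restrict) (rule rv)
  have dZ: "distr M (PiM {..<n} (\<lambda>_. L)) (\<lambda>\<omega>. \<lambda>i\<in>{..<n}. Z i \<omega>) = PiM {..<n} (\<lambda>_. L)"
  proof -
    have "distr M (PiM {..<n} (\<lambda>_. L)) (\<lambda>\<omega>. \<lambda>i\<in>{..<n}. Z i \<omega>) = PiM {..<n} (\<lambda>i. distr M L (Z i))"
      using M.indep_vars_iff_distr_eq_PiM'[of "{..<n}" Z "\<lambda>_. L"] n rv ind by auto
    also have "\<dots> = PiM {..<n} (\<lambda>_. L)" by (intro PiM_cong refl) (simp add: dist)
    finally show ?thesis .
  qed
  let ?AB = "PiM {..<n} (\<lambda>_. A) \<Otimes>\<^sub>M PiM {..<n} (\<lambda>_. B)"
  let ?zip = "\<lambda>\<omega>. \<lambda>i\<in>{..<n}. (fst \<omega> i, snd \<omega> i)"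
  let ?T = "\<lambda>\<omega>. \<lambda>i\<in>{..<n}. T (\<omega> i)"
  have zip: "?zip \<in> measurable ?AB (PiM {..<n} (\<lambda>_. A \<Otimes>\<^sub>M B))" by measurable
  have Tm: "?T \<in> measurable (PiM {..<n} (\<lambda>_. A \<Otimes>\<^sub>M B)) (PiM {..<n} (\<lambda>_. N))"
  proof (rule measurable_restrict)
    fix i assume "i \<in> {..<n}"
    from measurable_compose[OF measurable_component_singleton[OF this, of "\<lambda>_. A \<Otimes>\<^sub>M B"] T]
    show "(\<lambda>\<omega>. T (\<omega> i)) \<in> measurable (PiM {..<n} (\<lambda>_. A \<Otimes>\<^sub>M B)) N" .
  qed
  have "PiM {..<n} (\<lambda>_. L) = distr (PiM {..<n} (\<lambda>_. A \<Otimes>\<^sub>M B)) (PiM {..<n} (\<lambda>_. N)) ?T"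
    unfolding L by (rule distr_PiM_componentwise[symmetric]) (auto intro: T ab.prob_space_axioms)
  also have "\<dots> = distr (distr ?AB (PiM {..<n} (\<lambda>_. A \<Otimes>\<^sub>M B)) ?zip) (PiM {..<n} (\<lambda>_. N)) ?T"
    by (simp only: distr_zip_PiM[OF finite_lessThan A B])
  also have "\<dots> = distr ?AB (PiM {..<n} (\<lambda>_. N)) (?T \<circ> ?zip)" by (rule distr_distr[OF Tm zip])
  finally have PL: "PiM {..<n} (\<lambda>_. L) = distr ?AB (PiM {..<n} (\<lambda>_. N)) (?T \<circ> ?zip)" .
  have EL: "E \<in> sets (PiM {..<n} (\<lambda>_. L))"
    using E sets_PiM_cong[of "{..<n}" "{..<n}" "\<lambda>_. L" "\<lambda>_. N"] setsL by simp
  have "measure M {\<omega> \<in> space M. (\<lambda>i\<in>{..<n}. Z i \<omega>) \<in> E} = measure (distr M (PiM {..<n} (\<lambda>_. L)) (\<lambda>\<omega>. \<lambda>i\<in>{..<n}. Z i \<omega>)) E"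
    by (subst measure_distr[OF ZL EL]) (auto intro!: arg_cong[of _ _ "measure M"])
  also have "\<dots> = measure (distr ?AB (PiM {..<n} (\<lambda>_. N)) (?T \<circ> ?zip)) E" unfolding dZ unfolding PL ..
  also have "\<dots> = measure ?AB ((?T \<circ> ?zip) -` E \<inter> space ?AB)"
    by (rule measure_distr[OF measurable_comp[OF zip Tm] E])
  also have "(?T \<circ> ?zip) -` E \<inter> space ?AB = {\<omega> \<in> space ?AB. (\<lambda>i\<in>{..<n}. T (fst \<omega> i, snd \<omega> i)) \<in> E}"
  proof -
    have "(?T \<circ> ?zip) \<omega> = (\<lambda>i\<in>{..<n}. T (fst \<omega> i, snd \<omega> i))" for \<omega> by auto
    thus ?thesis by (intro Set.set_eqI) (simp only: vimage_eq Int_iff mem_Collect_eq conj_commute)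
  qed
  finally show ?thesis .
qed

text \<open>Conditioning on the first factor: the set \<open>G\<close> collects the pairs \<open>(e\<^sub>i, z\<^sub>i)\<close> admitting a good selection, and
  the second factor carries the nuisance directions.\<close>

lemma measure_pair_lower_bound:
  assumes P: "prob_space P" and Q: "prob_space Q" and E: "E \<in> sets (P \<Otimes>\<^sub>M Q)" and G: "G \<in> sets P" and t: "0 \<le> t"
    and ae: "AE a in P. a \<in> G \<longrightarrow> t \<le> measure Q (Pair a -` E)"
  shows "t * measure P G \<le> measure (P \<Otimes>\<^sub>M Q) E"
proof -
  interpret p: prob_space P by fact
  interpret q: prob_space Q by fact
  interpret pq: pair_prob_space P Q ..
  have "ennreal (t * measure P G) = (\<integral>\<^sup>+a. ennreal t * indicator G a \<partial>P)"
    using G t by (simp add: nn_integral_cmult_indicator p.emeasure_eq_measure ennreal_mult)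
  also have "\<dots> \<le> (\<integral>\<^sup>+a. emeasure Q (Pair a -` E) \<partial>P)"
    using ae by (intro nn_integral_mono_AE, eventually_elim)
      (auto simp: indicator_def q.emeasure_eq_measure ennreal_leI)
  also have "\<dots> = emeasure (P \<Otimes>\<^sub>M Q) E" by (rule q.emeasure_pair_measure_alt[OF E, symmetric])
  also have "\<dots> = ennreal (measure (P \<Otimes>\<^sub>M Q) E)" by (rule pq.P.emeasure_eq_measure)
  finally show ?thesis by (simp add: ennreal_le_iff)
qed

section \<open>The limit\<close>

context noise
begin

lemma integrable_square_quartic: "integrable A (\<lambda>x. (1 + snd x ^ 4 + fst x ^ 4)\<^sup>2)"
proof -
  have eq: "(1 + snd x ^ 4 + fst x ^ 4)\<^sup>2 = fst x ^ 0 * snd x ^ 0 + 2 * (fst x ^ 0 * snd x ^ 4) + 2 * (fst x ^ 4 * snd x ^ 0)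
     + fst x ^ 0 * snd x ^ 8 + fst x ^ 8 * snd x ^ 0 + 2 * (fst x ^ 4 * snd x ^ 4)" for x :: "real \<times> real"
    by (simp add: power2_eq_square algebra_simps power_add[symmetric])
  show ?thesis unfolding eq
    by (intro Bochner_Integration.integrable_add integrable_mult_right integrable_monomial)
qed

lemma integrable_square_w: "integrable A (\<lambda>x. (snd x * (fst x + l * snd x))\<^sup>2)"
proof -
  have eq: "(snd x * (fst x + l * snd x))\<^sup>2 = fst x ^ 2 * snd x ^ 2 + (2 * l) * (fst x ^ 1 * snd x ^ 3) + l\<^sup>2 * (fst x ^ 0 * snd x ^ 4)"
    for x :: "real \<times> real"
    by (simp add: power2_eq_square power3_eq_cube power4_eq_xxxx algebra_simps)
  show ?thesis unfolding eq
    by (intro Bochner_Integration.integrable_add integrable_mult_right integrable_monomial)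
qed

lemma integral_w: "(\<integral>x. snd x * (fst x + l * snd x) \<partial>A) = l"
proof -
  have eq: "snd x * (fst x + l * snd x) = fst x * snd x + l * (snd x)\<^sup>2" for x :: "real \<times> real"
    by (simp add: power2_eq_square algebra_simps)
  show ?thesis unfolding eq using integrable_ez integrable_zz integral_ez integral_zz by simp
qed

text \<open>With the selection weights in hand, everything is a law of large numbers for the pairs
  \<open>(e\<^sub>i, z\<^sub>i)\<close>, followed by Chebyshev's inequality for the independent projection.
  The abstract event family \<open>E\<close> stands for the deletion effect being large.\<close>

lemma selection_probability_tendsto_1:
  fixes p k :: "nat \<Rightarrow> nat" and u :: "nat \<Rightarrow> nat \<Rightarrow> real" and \<alpha> \<gamma> l :: real
  assumes \<alpha>: "0 < \<alpha>" "\<alpha> < 1/2" and \<gamma>: "0 \<le> \<gamma>" "\<gamma> < 1"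
    and k: "(\<lambda>n. real (k n) / real n) \<longlonglongrightarrow> \<alpha>" and p: "(\<lambda>n. real (p n) / (real n - real (k n))) \<longlonglongrightarrow> \<gamma>"
    and \<phi>: "\<phi> \<in> borel_measurable A" "\<And>x. 0 \<le> \<phi> x \<and> \<phi> x \<le> 1" "1 - \<alpha> < (\<integral>x. \<phi> x \<partial>A)"
      "(\<integral>x. \<phi> x * (snd x * (fst x + l * snd x)) \<partial>A) < 0"
    and u: "\<And>n. dotp (p n) (u n) (u n) = 1"
  defines "P \<equiv> \<lambda>n. PiM {..<n} (\<lambda>_. A) \<Otimes>\<^sub>M PiM {..<n} (\<lambda>_. std_gauss (p n))"
  assumes E: "\<And>n. E n \<in> sets (P n)"
    and inj: "\<And>n. AE \<omega> in P n. \<forall>S\<subseteq>{..<n}. p n \<le> card S \<longrightarrow>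
       (\<forall>c. (\<forall>i\<in>S. dotp (p n) (recombine (p n) (u n) (snd (fst \<omega> i)) (snd \<omega> i)) c = 0) \<longrightarrow> (\<forall>j<p n. c j = 0))"
    and core: "\<And>n a h S (c::real) (C::real) (\<delta>::real) (g::real). (a, h) \<in> space (P n) \<Longrightarrow> 0 < n \<Longrightarrow> S \<subseteq> {..<n} \<Longrightarrow> card S = n - k n \<Longrightarrow> real n \<le> 2 * card S \<Longrightarrow>
       \<forall>c. (\<forall>i\<in>S. dotp (p n) (recombine (p n) (u n) (snd (a i)) (h i)) c = 0) \<longrightarrow> (\<forall>j<p n. c j = 0) \<Longrightarrow>
       real (p n) \<le> g * card S \<Longrightarrow> 0 \<le> g \<Longrightarrow> g < 1 \<Longrightarrow> 0 < c \<Longrightarrow> 0 < C \<Longrightarrow> 0 < \<delta> \<Longrightarrow> \<delta> * C \<le> (1 - g) * c / 4 \<Longrightarrow>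
       (\<Sum>i<n. (snd (a i))\<^sup>2) \<le> C * n \<Longrightarrow>
       (\<Sum>i\<in>S. snd (a i) * (fst (a i) + l * snd (a i))) \<le> - c * card S \<Longrightarrow>
       \<delta> / 2 * n \<le> (\<Sum>i<n. snd (a i) * (fst (a i) + \<delta> * snd (a i))) \<Longrightarrow>
       gaussian_rows.form_deviation (p n) {..<n} (u n) (\<lambda>i. snd (a i)) (\<lambda>i. fst (a i) + \<delta> * snd (a i)) h \<le> (1 - g) * \<delta> / 2 * n \<Longrightarrow>
       - ((1 - g) * c / 4 * n) \<le> gaussian_rows.form_deviation (p n) S (u n) (\<lambda>i. snd (a i)) (\<lambda>i. fst (a i) + l * snd (a i)) h \<Longrightarrow>
       (a, h) \<in> E n"
  shows "(\<lambda>n. measure (P n) (E n)) \<longlonglongrightarrow> 1"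
proof -
  define E\<phi> where "E\<phi> = (\<integral>x. \<phi> x \<partial>A)"
  define w where "w = (\<lambda>x::real\<times>real. snd x * (fst x + l * snd x))"
  define \<mu> where "\<mu> = - (\<integral>x. \<phi> x * w x \<partial>A)"
  have \<mu>: "\<mu> > 0" using \<phi>(4) by (simp add: \<mu>_def w_def)
  define c where "c = \<mu> / 2"
  \<comment> \<open>\<open>g\<close> leaves room for \<open>p / (n - k)\<close> to exceed its limit\<close>
  define g where "g = (1 + \<gamma>) / 2"
  have g: "\<gamma> < g" "0 \<le> g" "g < 1" using \<gamma> by (auto simp: g_def)
  define q where "q = (\<lambda>x::real\<times>real. 1 + snd x ^ 4 + fst x ^ 4)"
  define Eq where "Eq = integral\<^sup>L A q"
  define C where "C = Eq + 1"
  have C: "0 < C" unfolding C_def Eq_def q_def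
    by (rule add_nonneg_pos[OF Bochner_Integration.integral_nonneg]) auto
  define \<delta> where "\<delta> = (1 - g) * c / (4 * C)"
  have c: "0 < c" and \<delta>: "0 < \<delta>" "\<delta> * C = (1 - g) * c / 4"
    using \<mu> g C by (auto simp: c_def \<delta>_def)
  define f where "f = (\<lambda>x::real\<times>real. snd x * (fst x + \<delta> * snd x))"
  \<comment> \<open>half of the spare mass of the weights pays for their fluctuation, half for that of \<open>k / n\<close>\<close>
  define \<epsilon> where "\<epsilon> = (E\<phi> - (1 - \<alpha>)) / 2"
  have \<epsilon>: "\<epsilon> > 0" "E\<phi> - \<epsilon> = 1 - \<alpha> + \<epsilon>" using \<phi>(3) by (auto simp: \<epsilon>_def E\<phi>_def field_simps)
  define PA where "PA = (\<lambda>n::nat. PiM {..<n} (\<lambda>_. A))"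
  define PG where "PG = (\<lambda>n::nat. PiM {..<n} (\<lambda>_. std_gauss (p n)))"
  have P: "P n = PA n \<Otimes>\<^sub>M PG n" for n by (simp add: P_def PA_def PG_def)
  have prPA: "prob_space (PA n)" for n unfolding PA_def by (intro prob_space_PiM DZ.P.prob_space_axioms)
  have prPG: "prob_space (PG n)" for n unfolding PG_def by (intro prob_space_PiM prob_space_std_gauss)
  have wm[measurable]: "w \<in> borel_measurable A" and qm[measurable]: "q \<in> borel_measurable A" and fm[measurable]: "f \<in> borel_measurable A"
    unfolding w_def q_def f_def by measurable
  note \<phi>m[measurable] = \<phi>(1)
  have \<phi>w2: "integrable A (\<lambda>x. (\<phi> x * w x)\<^sup>2)"
  proof -
    have "\<bar>(\<phi> x)\<^sup>2\<bar> \<le> 1" for x using \<phi>(2)[of x] by (simp add: power_le_one)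
    hence "integrable A (\<lambda>x. (\<phi> x)\<^sup>2 * (w x)\<^sup>2)"
      unfolding w_def by (intro integrable_bounded_times integrable_square_w) auto
    thus ?thesis by (simp add: power_mult_distrib)
  qed
  have \<phi>2: "integrable A (\<lambda>x. (\<phi> x)\<^sup>2)"
  proof (rule DZ.P.integrable_const_bound[where B = 1])
    show "AE x in A. norm ((\<phi> x)\<^sup>2) \<le> 1" using \<phi>(2) by (intro AE_I2) (simp add: power_le_one)
  qed measurable
  have q2: "integrable A (\<lambda>x. (q x)\<^sup>2)" unfolding q_def by (rule integrable_square_quartic)
  have f2: "integrable A (\<lambda>x. (f x)\<^sup>2)" unfolding f_def by (rule integrable_square_w)
  have Ef: "integral\<^sup>L A f = \<delta>" unfolding f_def by (rule integral_w)
  \<comment> \<open>deviations by a tolerance \<open>r\<close>, used for moments, the full sample, the mass of the weights and the weighted sum\<close>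
  define bad where "bad = (\<lambda>n (r::real) f. {a \<in> space (PA n). \<bar>(\<Sum>i<n. f (a i)) - real n * integral\<^sup>L A f\<bar> \<ge> r * real n})"
  have bad_sets: "bad n r f \<in> sets (PA n)" if [measurable]: "f \<in> borel_measurable A" for n r f
    unfolding bad_def PA_def by measurable
  have bad_lim: "(\<lambda>n. measure (PA n) (bad n r f)) \<longlonglongrightarrow> 0"
    if "f \<in> borel_measurable A" "integrable A (\<lambda>x. (f x)\<^sup>2)" "0 < r" for r f
    using DZ.P.PiM_weak_law[OF that] by (simp add: bad_def PA_def)
  define b where "b = (\<lambda>n. measure (PA n) (bad n 1 q) + measure (PA n) (bad n (\<delta>/2) f)
      + measure (PA n) (bad n \<epsilon> \<phi>) + measure (PA n) (bad n (\<mu>/2) (\<lambda>x. \<phi> x * w x)))"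
  have b_lim: "b \<longlonglongrightarrow> 0"
  proof -
    have "b \<longlonglongrightarrow> 0 + 0 + 0 + 0"
      unfolding b_def using \<delta> \<epsilon> \<mu>
      by (intro tendsto_add bad_lim q2 f2 \<phi>2 \<phi>w2) (auto intro!: borel_measurable_times qm fm \<phi>m wm)
    thus ?thesis by simp
  qed
  define G where "G = (\<lambda>n. space (PA n) - (bad n 1 q \<union> bad n (\<delta>/2) f \<union> bad n \<epsilon> \<phi> \<union> bad n (\<mu>/2) (\<lambda>x. \<phi> x * w x)))"
  have Gs: "G n \<in> sets (PA n)" for n
    unfolding G_def by (intro sets.Diff sets.Un bad_sets sets.top qm fm \<phi>m) measurable
  have Gb: "1 - b n \<le> measure (PA n) (G n)" for n
  proof -
    interpret X: prob_space "PA n" by (rule prPA)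
    have \<phi>wm: "(\<lambda>x. \<phi> x * w x) \<in> borel_measurable A" by measurable
    have s: "bad n 1 q \<in> X.events" "bad n (\<delta>/2) f \<in> X.events" "bad n \<epsilon> \<phi> \<in> X.events" "bad n (\<mu>/2) (\<lambda>x. \<phi> x * w x) \<in> X.events"
      by (intro bad_sets qm fm \<phi>m \<phi>wm)+
    have "X.prob (bad n 1 q \<union> bad n (\<delta>/2) f \<union> bad n \<epsilon> \<phi> \<union> bad n (\<mu>/2) (\<lambda>x. \<phi> x * w x)) \<le> b n"
      unfolding b_def using s
      by (intro order_trans[OF measure_Un_le] add_mono order_refl sets.Un)
    moreover have "X.prob (G n) = 1 - X.prob (bad n 1 q \<union> bad n (\<delta>/2) f \<union> bad n \<epsilon> \<phi> \<union> bad n (\<mu>/2) (\<lambda>x. \<phi> x * w x))"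
      unfolding G_def using s by (intro X.prob_compl) auto
    ultimately show ?thesis by simp
  qed
  define W where "W = (\<lambda>t::real. (32 * C\<^sup>2 + 4 * C) * (1 + t\<^sup>2))"
  define \<eta>1 where "\<eta>1 = (1 - g) * c / 4"
  define \<eta>2 where "\<eta>2 = (1 - g) * \<delta> / 2"
  have \<eta>: "\<eta>1 > 0" "\<eta>2 > 0" using g c \<delta> by (auto simp: \<eta>1_def \<eta>2_def)
  define t where "t = (\<lambda>n::nat. 1 - W l / \<eta>1\<^sup>2 * (1 / real n) - W \<delta> / \<eta>2\<^sup>2 * (1 / real n))"
  have t_lim: "t \<longlonglongrightarrow> 1"
  proof -
    have "t \<longlonglongrightarrow> 1 - W l / \<eta>1\<^sup>2 * 0 - W \<delta> / \<eta>2\<^sup>2 * 0"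
      unfolding t_def by (intro tendsto_intros lim_1_over_n)
    thus ?thesis by simp
  qed
  have ev_k: "\<forall>\<^sub>F n in sequentially. \<alpha> - \<epsilon> < real (k n) / real n" "\<forall>\<^sub>F n in sequentially. real (k n) / real n < 1/2"
    using order_tendstoD(1)[OF k, of "\<alpha> - \<epsilon>"] order_tendstoD(2)[OF k, of "1/2"] \<alpha> \<epsilon> by auto
  have ev_p: "\<forall>\<^sub>F n in sequentially. real (p n) / (real n - real (k n)) < g"
    using order_tendstoD(2)[OF p g(1)] .
  have ev_t: "\<forall>\<^sub>F n in sequentially. 0 < t n" using order_tendstoD(1)[OF t_lim, of 0] by simp
  have lower: "\<forall>\<^sub>F n in sequentially. t n * (1 - b n) \<le> measure (P n) (E n)"
    using ev_k ev_p ev_t eventually_ge_at_top[of 4]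
  proof eventually_elim
    case (elim n)
    define m where "m = n - k n"
    have n4: "real n \<ge> 4" using elim(5) by simp
    have kn: "real (k n) < real n / 2" using elim(2) n4 by (simp add: field_simps)
    have m: "real m = real n - real (k n)" using kn by (simp add: m_def of_nat_diff)
    have m2: "real n \<le> 2 * real m" "real n / 4 \<le> real m - 1" "real n / 4 \<le> real n - 1" "2 \<le> m"
      using kn m n4 by auto
    have mE: "real m \<le> (E\<phi> - \<epsilon>) * real n"
    proof -
      have "(\<alpha> - \<epsilon>) * real n < real (k n)" using elim(1) n4 by (simp add: field_simps)
      thus ?thesis unfolding \<epsilon>(2) m by (simp add: algebra_simps)
    qed
    have pg: "real (p n) \<le> g * real m" using elim(3) m2 n4 unfolding m[symmetric] by (simp add: field_simps)
    interpret X: prob_space "PA n" by (rule prPA)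
    interpret Y: prob_space "PG n" by (rule prPG)
    interpret XY: pair_prob_space "PA n" "PG n" ..
    have ae: "AE a in PA n. AE h in PG n. \<forall>S\<subseteq>{..<n}. p n \<le> card S \<longrightarrow>
       (\<forall>c. (\<forall>i\<in>S. dotp (p n) (recombine (p n) (u n) (snd (a i)) (h i)) c = 0) \<longrightarrow> (\<forall>j<p n. c j = 0))"
      using XY.AE_pair[OF inj[of n, unfolded P]] by simp
    have "AE a in PA n. a \<in> G n \<longrightarrow> t n \<le> measure (PG n) (Pair a -` E n)"
      using ae AE_space
    proof eventually_elim
      fix a assume inj_a: "AE h in PG n. \<forall>S\<subseteq>{..<n}. p n \<le> card S \<longrightarrow>
       (\<forall>c. (\<forall>i\<in>S. dotp (p n) (recombine (p n) (u n) (snd (a i)) (h i)) c = 0) \<longrightarrow> (\<forall>j<p n. c j = 0))"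
        and a: "a \<in> space (PA n)"
      show "a \<in> G n \<longrightarrow> t n \<le> measure (PG n) (Pair a -` E n)"
      proof
        assume aG: "a \<in> G n"
        have good: "\<bar>(\<Sum>i<n. q (a i)) - real n * Eq\<bar> < 1 * real n"
           "\<bar>(\<Sum>i<n. f (a i)) - real n * \<delta>\<bar> < \<delta> / 2 * real n"
           "\<bar>(\<Sum>i<n. \<phi> (a i)) - real n * E\<phi>\<bar> < \<epsilon> * real n"
           "\<bar>(\<Sum>i<n. \<phi> (a i) * w (a i)) - real n * (- \<mu>)\<bar> < \<mu> / 2 * real n"
          using aG a unfolding G_def bad_def Ef Eq_def[symmetric] E\<phi>_def[symmetric] \<mu>_def by auto
        have sq: "(\<Sum>i<n. q (a i)) \<le> C * n" using good(1)[unfolded abs_less_iff] by (auto simp: C_def algebra_simps)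
        have sf: "\<delta> / 2 * n \<le> (\<Sum>i<n. f (a i))" using good(2)[unfolded abs_less_iff] by (auto simp: algebra_simps)
        have s\<phi>: "real m \<le> (\<Sum>i<n. \<phi> (a i))" using good(3)[unfolded abs_less_iff] mE by (auto simp: algebra_simps)
        have sw: "(\<Sum>i<n. \<phi> (a i) * w (a i)) \<le> - c * real (card {..<n})"
          using good(4)[unfolded abs_less_iff] by (auto simp: c_def algebra_simps)
        obtain S where S: "S \<subseteq> {..<n}" "card S = m" "(\<Sum>i\<in>S. w (a i)) \<le> - c * m"
          using subset_with_negative_sum[OF finite_lessThan, of n "\<lambda>i. \<phi> (a i)" m c "\<lambda>i. w (a i)"] \<phi>(2) s\<phi> c sw by auto
        let ?z = "\<lambda>i. snd (a i)" and ?e = "\<lambda>i. fst (a i)"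
        interpret RS: gaussian_rows "p n" n S "u n" using u S by unfold_locales
        interpret Rn: gaussian_rows "p n" n "{..<n}" "u n" using u by unfold_locales auto
        have sq': "(\<Sum>i<n. 1 + ?z i ^ 4 + ?e i ^ 4) \<le> C * n" using sq by (simp add: q_def)
        define F1 where "F1 = {h \<in> space (PG n). \<eta>1 * n \<le> \<bar>RS.form_deviation ?z (\<lambda>i. ?e i + l * ?z i) h\<bar>}"
        define F2 where "F2 = {h \<in> space (PG n). \<eta>2 * n \<le> \<bar>Rn.form_deviation ?z (\<lambda>i. ?e i + \<delta> * ?z i) h\<bar>}"
        have Fs: "F1 \<in> Y.events" "F2 \<in> Y.events"
          unfolding F1_def F2_def PG_def by measurable
        have n0: "0 < n" using n4 by simp
        have F1: "Y.prob F1 \<le> W l / \<eta>1\<^sup>2 * (1 / real n)"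
        proof -
          have "Y.prob F1 \<le> (W l * n) / (\<eta>1 * n)\<^sup>2"
            unfolding F1_def PG_def
            by (rule RS.form_deviation_tail)
              (use m2 S n0 \<eta> form_deviation_moments_le[OF sq' S(1) n0, of l] in \<open>auto simp: W_def\<close>)
          thus ?thesis using n0 by (simp add: power2_eq_square)
        qed
        have F2: "Y.prob F2 \<le> W \<delta> / \<eta>2\<^sup>2 * (1 / real n)"
        proof -
          have "Y.prob F2 \<le> (W \<delta> * n) / (\<eta>2 * n)\<^sup>2"
            unfolding F2_def PG_def
            by (rule Rn.form_deviation_tail)
              (use m2 n4 n0 \<eta> form_deviation_moments_le[OF sq' subset_refl n0, of \<delta>] in \<open>auto simp: W_def\<close>)
          thus ?thesis using n0 by (simp add: power2_eq_square)
        qed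
        have Ea: "Pair a -` E n \<in> Y.events" using sets_Pair1[OF E[of n, unfolded P]] .
        have zq: "(\<Sum>i<n. (?z i)\<^sup>2) \<le> C * n"
        proof -
          have "(?z i)\<^sup>2 \<le> q (a i)" for i
          proof -
            have "0 \<le> ((?z i)\<^sup>2 - 1)\<^sup>2" "0 \<le> ?z i ^ 4" "0 \<le> ?e i ^ 4" by simp_all
            thus ?thesis by (simp add: q_def power2_eq_square power4_eq_xxxx algebra_simps)
          qed
          hence "(\<Sum>i<n. (?z i)\<^sup>2) \<le> (\<Sum>i<n. q (a i))" by (intro sum_mono)
          thus ?thesis using sq by simp
        qed
        have pm: "p n \<le> card S"
        proof -
          have "real (p n) \<le> 1 * real m" using pg g mult_right_mono[of g 1 "real m"] by simp
          thus ?thesis using S(2) by simp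
        qed
        have "t n \<le> 1 - Y.prob F1 - Y.prob F2" using F1 F2 by (simp add: t_def)
        also have "\<dots> \<le> 1 - Y.prob (F1 \<union> F2)"
          using measure_Un_le[OF Fs] by simp
        also have "\<dots> = Y.prob (space (PG n) - (F1 \<union> F2))"
          using Fs by (intro Y.prob_compl[symmetric]) auto
        also have "\<dots> \<le> Y.prob (Pair a -` E n)"
        proof (rule Y.finite_measure_mono_AE[OF _ Ea])
          show "AE h in PG n. h \<in> space (PG n) - (F1 \<union> F2) \<longrightarrow> h \<in> Pair a -` E n"
            using inj_a
          proof eventually_elim
            fix h assume ih: "\<forall>S\<subseteq>{..<n}. p n \<le> card S \<longrightarrow>
               (\<forall>c. (\<forall>i\<in>S. dotp (p n) (recombine (p n) (u n) (snd (a i)) (h i)) c = 0) \<longrightarrow> (\<forall>j<p n. c j = 0))"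
            show "h \<in> space (PG n) - (F1 \<union> F2) \<longrightarrow> h \<in> Pair a -` E n"
            proof
              assume h: "h \<in> space (PG n) - (F1 \<union> F2)"
              have d1: "- (\<eta>1 * n) \<le> RS.form_deviation ?z (\<lambda>i. ?e i + l * ?z i) h"
                and d2: "Rn.form_deviation ?z (\<lambda>i. ?e i + \<delta> * ?z i) h \<le> \<eta>2 * n"
                using h by (auto simp: F1_def F2_def)
              have "(a, h) \<in> E n"
              proof (rule core[of a h n S g c C \<delta>])
                show "(a, h) \<in> space (P n)" using a h by (simp add: P space_pair_measure)
                show "\<forall>c. (\<forall>i\<in>S. dotp (p n) (recombine (p n) (u n) (?z i) (h i)) c = 0) \<longrightarrow> (\<forall>j<p n. c j = 0)"
                  using ih S(1) pm by blast
                show "card S = n - k n" using S(2) by (simp add: m_def)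
              qed (use n0 S m2 pg g c C \<delta> zq sf d1 d2 in \<open>auto simp: w_def f_def \<eta>1_def \<eta>2_def\<close>)
              thus "h \<in> Pair a -` E n" by simp
            qed
          qed
        qed
        finally show "t n \<le> measure (PG n) (Pair a -` E n)" .
      qed
    qed
    from measure_pair_lower_bound[OF prPA prPG E[of n, unfolded P] Gs _ this]
    have "t n * measure (PA n) (G n) \<le> measure (P n) (E n)" using elim(4) by (simp add: P)
    moreover have "t n * (1 - b n) \<le> t n * measure (PA n) (G n)"
      using Gb[of n] elim(4) by (intro mult_left_mono) auto
    ultimately show ?case by linarith
  qed
  have upper: "\<forall>\<^sub>F n in sequentially. measure (P n) (E n) \<le> 1"
  proof (rule always_eventually, rule allI)
    fix n
    interpret X: prob_space "PA n" by (rule prPA)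
    interpret Y: prob_space "PG n" by (rule prPG)
    interpret XY: pair_prob_space "PA n" "PG n" ..
    show "measure (P n) (E n) \<le> 1" unfolding P by (rule XY.P.prob_le_1)
  qed
  have "(\<lambda>n. t n * (1 - b n)) \<longlonglongrightarrow> 1 * (1 - 0)" by (intro tendsto_intros t_lim b_lim)
  thus ?thesis by (intro tendsto_sandwich[OF lower upper _ tendsto_const]) simp
qed

end

text \<open>Any exponential moment of \<open>\<epsilon>\<^sup>2\<close> dominates all powers: \<open>y\<^sup>m \<le> m\<^sup>m e\<^sup>y\<close>.\<close>

lemma subgaussian_moments:
  assumes N: "prob_space N" and sg: "subgaussian N \<epsilon>"
  shows "integrable N (\<lambda>\<omega>. \<epsilon> \<omega> ^ j)"
proof -
  interpret N: prob_space N by fact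
  have [measurable]: "\<epsilon> \<in> borel_measurable N" using sg by (simp add: subgaussian_def)
  obtain t where t: "0 < t" "(\<integral>\<^sup>+\<omega>. ennreal (exp ((\<epsilon> \<omega>)\<^sup>2 / t\<^sup>2)) \<partial>N) \<le> ennreal (exp 1)"
  proof -
    have "{t::real. 0 < t \<and> (\<integral>\<^sup>+\<omega>. ennreal (exp ((\<epsilon> \<omega>)\<^sup>2 / t\<^sup>2)) \<partial>N) \<le> ennreal (exp 1)} \<noteq> {}"
    proof
      assume e: "{t::real. 0 < t \<and> (\<integral>\<^sup>+\<omega>. ennreal (exp ((\<epsilon> \<omega>)\<^sup>2 / t\<^sup>2)) \<partial>N) \<le> ennreal (exp 1)} = {}"
      have "subgaussian_norm N \<epsilon> = \<infinity>"
        unfolding subgaussian_norm_def e by (simp add: top_ereal_def)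
      thus False using sg by (simp add: subgaussian_def)
    qed
    thus thesis using that by blast
  qed
  have int: "integrable N (\<lambda>\<omega>. exp ((\<epsilon> \<omega>)\<^sup>2 / t\<^sup>2))"
    using t(2) by (intro integrableI_nonneg) (auto simp: order_le_less_trans)
  define J where "J = real (Suc j)"
  have J: "J > 0" by (simp add: J_def)
  have bound: "\<bar>\<epsilon> \<omega> ^ j\<bar> \<le> 1 + (t\<^sup>2 * J) ^ Suc j * exp ((\<epsilon> \<omega>)\<^sup>2 / t\<^sup>2)" for \<omega>
  proof -
    define y where "y = (\<epsilon> \<omega>)\<^sup>2 / t\<^sup>2"
    have y: "y \<ge> 0" "(\<epsilon> \<omega>)\<^sup>2 = t\<^sup>2 * y" using t by (auto simp: y_def)
    have "y / J \<le> exp (y / J)" using exp_ge_add_one_self[of "y / J"] by linarith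
    hence "(y / J) ^ Suc j \<le> exp (y / J) ^ Suc j" using y J by (intro power_mono) auto
    also have "\<dots> = exp y" using J by (simp add: exp_of_nat_mult[symmetric] J_def del: power_Suc of_nat_Suc)
    finally have "y ^ Suc j \<le> J ^ Suc j * exp y" using J by (simp add: power_divide field_simps del: power_Suc)
    hence "(t\<^sup>2) ^ Suc j * y ^ Suc j \<le> (t\<^sup>2) ^ Suc j * (J ^ Suc j * exp y)" by (intro mult_left_mono) auto
    hence big: "((\<epsilon> \<omega>)\<^sup>2) ^ Suc j \<le> (t\<^sup>2 * J) ^ Suc j * exp y"
      unfolding y(2) power_mult_distrib by (simp only: mult.assoc)
    have "\<bar>\<epsilon> \<omega>\<bar> ^ j \<le> 1 + ((\<epsilon> \<omega>)\<^sup>2) ^ Suc j"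
    proof (cases "\<bar>\<epsilon> \<omega>\<bar> \<le> 1")
      case True
      have "\<bar>\<epsilon> \<omega>\<bar> ^ j \<le> 1" using True by (intro power_le_one) auto
      moreover have "0 \<le> ((\<epsilon> \<omega>)\<^sup>2) ^ Suc j" by simp
      ultimately show ?thesis by linarith
    next
      case False
      have "\<bar>\<epsilon> \<omega>\<bar> ^ j \<le> \<bar>\<epsilon> \<omega>\<bar> ^ (2 * Suc j)" using False by (intro power_increasing) simp_all
      also have "\<dots> = ((\<epsilon> \<omega>)\<^sup>2) ^ Suc j" using power_mult[of "\<bar>\<epsilon> \<omega>\<bar>" 2 "Suc j"] by (simp only: power2_abs)
      finally show ?thesis by linarith
    qed
    thus ?thesis using big by (simp add: power_abs y_def)
  qed
  show ?thesis
  proof (rule Bochner_Integration.integrable_bound)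
    show "integrable N (\<lambda>\<omega>. 1 + (t\<^sup>2 * J) ^ Suc j * exp ((\<epsilon> \<omega>)\<^sup>2 / t\<^sup>2))" using int by simp
    show "AE \<omega> in N. norm (\<epsilon> \<omega> ^ j) \<le> norm (1 + (t\<^sup>2 * J) ^ Suc j * exp ((\<epsilon> \<omega>)\<^sup>2 / t\<^sup>2))"
      by (intro AE_I2) (metis bound abs_ge_self order_trans real_norm_def)
  qed measurable
qed

section \<open>The lower bound for the deletion effect\<close>

lemma vec_l2norm_dotp: "w \<in> carrier_vec p \<Longrightarrow> vec_l2norm w = sqrt (dotp p (($) w) (($) w))"
  by (simp add: vec_l2norm_def dotp_scalar_prod)

text \<open>In dimension \<open>0\<close> there is no unit vector \<open>v\<close>, and \<open>B\<^sup>-\<^sup>1 v \<noteq> 0\<close> since \<open>v = B B\<^sup>-\<^sup>1 v\<close>.\<close>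

lemma unit_direction:
  assumes B: "pos_def_mat p B" and v: "v \<in> carrier_vec p" "vec_l2norm v = 1"
  defines "s \<equiv> vec_l2norm (mat_inv B *\<^sub>v v)"
  defines "u \<equiv> (\<lambda>j. (mat_inv B *\<^sub>v v) $ j / s)"
  shows "0 < s" "dotp p u u = 1" "1 \<le> p"
proof -
  have Bc: "B \<in> carrier_mat p p" using B by (simp add: pos_def_mat_def)
  note inv = pos_def_mat_inverse[OF B]
  define w where "w = mat_inv B *\<^sub>v v"
  have w: "w \<in> carrier_vec p" using inv(3) v by (simp add: w_def)
  have nz: "dotp p (($) w) (($) w) \<noteq> 0"
  proof
    assume "dotp p (($) w) (($) w) = 0"
    hence "\<forall>i<p. w $ i = 0" by (simp only: dotp_self_eq_0)
    hence w0: "w = 0\<^sub>v p" using w by (intro eq_vecI) auto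
    have "v = B *\<^sub>v w"
      unfolding w_def using assoc_mult_mat_vec[OF Bc inv(3) v(1)] inv(1) v by simp
    also have "\<dots> = 0\<^sub>v p" unfolding w0 using Bc by (intro eq_vecI) (auto simp: scalar_prod_def)
    finally have "vec_l2norm v = 0" by (simp add: vec_l2norm_def)
    thus False using v by simp
  qed
  hence pos: "dotp p (($) w) (($) w) > 0" using dotp_self_nonneg[of p "($) w"] by linarith
  have s: "s = sqrt (dotp p (($) w) (($) w))" using vec_l2norm_dotp[OF w] by (simp add: s_def w_def)
  show s0: "0 < s" using pos by (simp add: s)
  have "u = (\<lambda>j. (1 / s) * w $ j)" by (simp add: u_def w_def)
  hence "dotp p u u = (1 / s) * ((1 / s) * dotp p (($) w) (($) w))" by (simp only: dotp_linear)
  also have "dotp p (($) w) (($) w) = s * s" using pos s by simp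
  finally show "dotp p u u = 1" using s0 by simp
  show "1 \<le> p"
  proof (rule ccontr)
    assume "\<not> 1 \<le> p"
    hence "p = 0" by simp
    hence "dotp p (($) w) (($) w) = 0" by (simp add: dotp_def)
    thus False using nz by simp
  qed
qed

text \<open>The recombined rows are i.i.d. standard Gaussian, so their common law charges no hyperplane.\<close>

lemma AE_recombined_rows_injective:
  fixes D :: "real measure" and n :: nat
  assumes A: "prob_space D" "sets D = sets borel" and u: "dotp p u u = 1"
  shows "AE \<omega> in PiM {..<n} (\<lambda>_. D \<Otimes>\<^sub>M std_normal_distribution) \<Otimes>\<^sub>M PiM {..<n} (\<lambda>_. std_gauss p).
    \<forall>S\<subseteq>{..<n}. p \<le> card S \<longrightarrow>
       (\<forall>c. (\<forall>i\<in>S. dotp p (recombine p u (snd (fst \<omega> i)) (snd \<omega> i)) c = 0) \<longrightarrow> (\<forall>j<p. c j = 0))"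
proof -
  let ?A = "D \<Otimes>\<^sub>M std_normal_distribution" and ?I = "{..<n}"
  interpret d: prob_space D by fact
  interpret n: prob_space std_normal_distribution by (rule prob_space_std_normal)
  interpret g: prob_space "std_gauss p" by (rule prob_space_std_gauss)
  interpret dn: pair_prob_space D std_normal_distribution ..
  interpret dng: pair_prob_space ?A "std_gauss p" ..
  interpret gd: pair_prob_space "std_gauss p" D ..
  note [measurable_cong] = sets_std_gauss A(2)
  let ?V = "\<lambda>b :: (real \<times> real) \<times> (nat \<Rightarrow> real). recombine p u (snd (fst b)) (snd b)"
  let ?f = "\<lambda>x. (?V x, fst (fst x))"
  have Vm: "?V \<in> measurable (?A \<Otimes>\<^sub>M std_gauss p) (borel_vec p)" by measurable
  have fm: "?f \<in> measurable (?A \<Otimes>\<^sub>M std_gauss p) (borel_vec p \<Otimes>\<^sub>M borel)" by measurable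
  have hyp: "AE b in ?A \<Otimes>\<^sub>M std_gauss p. dotp p c (?V b) \<noteq> 0" if "j < p" "c j \<noteq> 0" for c j
  proof -
    have "AE x in std_gauss p. AE e in D. dotp p c (fst (x, e)) \<noteq> 0"
      using AE_std_gauss_hyperplane[of j p c, OF that] by eventually_elim simp
    moreover have "{x \<in> space (std_gauss p \<Otimes>\<^sub>M D). dotp p c (fst x) \<noteq> 0} \<in> sets (std_gauss p \<Otimes>\<^sub>M D)" by measurable
    ultimately have "AE x in std_gauss p \<Otimes>\<^sub>M D. dotp p c (fst x) \<noteq> 0" by (intro gd.AE_pair_measure) auto
    hence "AE x in distr (?A \<Otimes>\<^sub>M std_gauss p) (borel_vec p \<Otimes>\<^sub>M borel) ?f. dotp p c (fst x) \<noteq> 0"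
      unfolding distr_gaussian_noise[OF A u] .
    from AE_distrD[OF fm this] show ?thesis by simp
  qed
  have "AE \<omega> in PiM ?I (\<lambda>_. ?A \<Otimes>\<^sub>M std_gauss p). \<forall>S\<subseteq>?I. p \<le> card S \<longrightarrow>
     (\<forall>c. (\<forall>i\<in>S. dotp p (?V (\<omega> i)) c = 0) \<longrightarrow> (\<forall>j<p. c j = 0))"
  proof (rule AE_rows_injective[where V = ?V])
    show "(\<lambda>b. ?V b j) \<in> borel_measurable (?A \<Otimes>\<^sub>M std_gauss p)" if "j < p" for j
      using measurable_compose[OF Vm measurable_component_singleton[of j "{..<p}"]] that by simp
    show "prob_space (?A \<Otimes>\<^sub>M std_gauss p)" by (rule dng.P.prob_space_axioms)
    show "finite ?I" by simp
  qed (rule hyp)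
  hence "AE \<omega> in distr (PiM ?I (\<lambda>_. ?A) \<Otimes>\<^sub>M PiM ?I (\<lambda>_. std_gauss p)) (PiM ?I (\<lambda>_. ?A \<Otimes>\<^sub>M std_gauss p))
        (\<lambda>\<omega>. \<lambda>i\<in>?I. (fst \<omega> i, snd \<omega> i)). \<forall>S\<subseteq>?I. p \<le> card S \<longrightarrow>
     (\<forall>c. (\<forall>i\<in>S. dotp p (?V (\<omega> i)) c = 0) \<longrightarrow> (\<forall>j<p. c j = 0))"
    by (simp only: distr_zip_PiM[OF finite_lessThan dn.P.prob_space_axioms g.prob_space_axioms])
  from AE_distrD[OF _ this]
  have "AE \<omega> in PiM ?I (\<lambda>_. ?A) \<Otimes>\<^sub>M PiM ?I (\<lambda>_. std_gauss p). \<forall>S\<subseteq>?I. p \<le> card S \<longrightarrow>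
     (\<forall>c. (\<forall>i\<in>S. dotp p (?V ((\<lambda>i\<in>?I. (fst \<omega> i, snd \<omega> i)) i)) c = 0) \<longrightarrow> (\<forall>j<p. c j = 0))"
    by measurable
  thus ?thesis
  proof eventually_elim
    case (elim \<omega>)
    show ?case
    proof (intro allI impI)
      fix S c j assume S: "S \<subseteq> ?I" "p \<le> card S" and z: "\<forall>i\<in>S. dotp p (recombine p u (snd (fst \<omega> i)) (snd \<omega> i)) c = 0" and j: "j < p"
      have "\<forall>i\<in>S. dotp p (?V ((\<lambda>i\<in>?I. (fst \<omega> i, snd \<omega> i)) i)) c = 0"
      proof
        fix i assume i: "i \<in> S"
        hence "i \<in> ?I" using S(1) by blast
        thus "dotp p (?V ((\<lambda>i\<in>?I. (fst \<omega> i, snd \<omega> i)) i)) c = 0" using z i by simp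
      qed
      thus "c j = 0" using elim S j by blast
    qed
  qed
qed

theorem theorem3p6:
  fixes N :: "'e measure" and \<epsilon> z :: "'e \<Rightarrow> real"
    and M :: "nat \<Rightarrow> 'w measure"
    and p k :: "nat \<Rightarrow> nat"
    and \<Sigma> :: "nat \<Rightarrow> real mat" and \<beta> v :: "nat \<Rightarrow> real vec"
    and x :: "nat \<Rightarrow> nat \<Rightarrow> 'w \<Rightarrow> nat \<Rightarrow> real" and y :: "nat \<Rightarrow> nat \<Rightarrow> 'w \<Rightarrow> real"
    and \<alpha> \<gamma> :: real
  assumes "prob_space N"
    and "subgaussian N \<epsilon>"
    and "integral\<^sup>L N \<epsilon> = 0"
    and "distributed N lborel z std_normal_density"
    and "prob_space.indep_var N borel \<epsilon> borel z"
    and "\<And>n. prob_space (M n)"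
    and "\<And>n. pos_def_mat (p n) (\<Sigma> n)"
    and "\<And>n. \<beta> n \<in> carrier_vec (p n)"
    and "\<And>n. v n \<in> carrier_vec (p n)"
    and "\<And>n. vec_l2norm (v n) = 1"
    and "\<And>n. iid_samples (M n) n
            (linear_model_law (p n) (\<Sigma> n) (\<beta> n) (distr N borel \<epsilon>))
            (\<lambda>i \<omega>. (x n i \<omega>, y n i \<omega>))"
    and "0 < \<alpha>" and "\<alpha> < 1 / 2"
    and "0 \<le> \<gamma>" and "\<gamma> < 1"
    and "(\<lambda>n. real (k n) / real n) \<longlonglongrightarrow> \<alpha>"
    and "(\<lambda>n. real (p n) / (real n - real (k n))) \<longlonglongrightarrow> \<gamma>"
  shows "(\<lambda>n. measure (M n) {\<omega> \<in> space (M n).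
            max_deletion_effect (k n) (design_mat n (p n) (\<lambda>i. x n i \<omega>)) (vec n (\<lambda>i. y n i \<omega>)) (v n)
            \<ge> 1 / (1 - \<alpha>) * vec_l2norm (mat_inv_sqrt (\<Sigma> n) *\<^sub>v v n) *
              integral\<^sup>L N (\<lambda>\<omega>. \<epsilon> \<omega> * z \<omega> *
                indicator {quantile (distr N borel (\<lambda>\<omega>. \<epsilon> \<omega> * z \<omega>)) (1 - \<alpha>) <..} (\<epsilon> \<omega> * z \<omega>))})
         \<longlonglongrightarrow> 1"
proof -
  interpret N: prob_space N by fact
  note \<alpha> = \<open>0 < \<alpha>\<close> \<open>\<alpha> < 1/2\<close>
  define D where "D = distr N borel \<epsilon>"
  have \<epsilon>m[measurable]: "\<epsilon> \<in> borel_measurable N" using assms(2) by (simp add: subgaussian_def)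
  have zm[measurable]: "z \<in> borel_measurable N" using distributed_measurable[OF assms(4)] by simp
  have D: "prob_space D" "sets D = sets borel" by (simp_all add: D_def N.prob_space_distr)
  interpret noise D
  proof (rule noise.intro)
    show "prob_space D" by (rule D)
    show "sets D = sets borel" by (rule D)
    show "integrable D (\<lambda>e. e ^ j)" for j
      using subgaussian_moments[OF assms(1,2), of j] by (simp add: D_def integrable_distr_eq)
    show "(\<integral>e. e \<partial>D) = 0" using assms(3) by (simp add: D_def integral_distr)
  qed
  have zlaw: "distr N borel z = std_normal_distribution"
  proof -
    have "distr N borel z = distr N lborel z" by (rule distr_cong) auto
    thus ?thesis using distributed_distr_eq_density[OF assms(4)] by simp
  qed
  have joint: "distr N (borel \<Otimes>\<^sub>M borel) (\<lambda>\<omega>. (\<epsilon> \<omega>, z \<omega>)) = A"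
    using assms(5) N.indep_var_distribution_eq[of borel \<epsilon> borel z] by (simp add: zlaw D_def)
  have prod_law: "distr N borel (\<lambda>\<omega>. \<epsilon> \<omega> * z \<omega>) = prod_law"
  proof -
    have "prod_law = distr (distr N (borel \<Otimes>\<^sub>M borel) (\<lambda>\<omega>. (\<epsilon> \<omega>, z \<omega>))) borel (\<lambda>x. fst x * snd x)"
      unfolding prod_law_def joint ..
    also have "\<dots> = distr N borel ((\<lambda>x. fst x * snd x) \<circ> (\<lambda>\<omega>. (\<epsilon> \<omega>, z \<omega>)))"
      by (rule distr_distr) measurable
    finally show ?thesis by (simp add: comp_def)
  qed
  define q where "q = quantile prod_law (1 - \<alpha>)"
  define L where "L = 1 / (1 - \<alpha>) * (\<integral>x. fst x * snd x * indicator {q<..} (fst x * snd x) \<partial>A)"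
  have L: "1 / (1 - \<alpha>) * t * integral\<^sup>L N (\<lambda>\<omega>. \<epsilon> \<omega> * z \<omega> * indicator {q<..} (\<epsilon> \<omega> * z \<omega>)) = t * L" for t
  proof -
    have "(\<integral>x. fst x * snd x * indicator {q<..} (fst x * snd x) \<partial>A) =
        (\<integral>x. fst x * snd x * indicator {q<..} (fst x * snd x) \<partial>distr N (borel \<Otimes>\<^sub>M borel) (\<lambda>\<omega>. (\<epsilon> \<omega>, z \<omega>)))"
      by (simp only: joint)
    also have "\<dots> = integral\<^sup>L N (\<lambda>\<omega>. \<epsilon> \<omega> * z \<omega> * indicator {q<..} (\<epsilon> \<omega> * z \<omega>))"
      by (subst integral_distr) auto
    finally show ?thesis by (simp add: L_def)
  qed
  define B where "B = (\<lambda>n. mat_sqrt (\<Sigma> n))"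
  have B: "pos_def_mat (p n) (B n)" for n unfolding B_def by (rule mat_sqrt_pos_def[OF assms(7)])
  have Bc: "B n \<in> carrier_mat (p n) (p n)" for n using B by (simp add: pos_def_mat_def)
  define s where "s = (\<lambda>n. vec_l2norm (mat_inv (B n) *\<^sub>v v n))"
  define u where "u = (\<lambda>n j. (mat_inv (B n) *\<^sub>v v n) $ j / s n)"
  have s: "0 < s n" and u: "dotp (p n) (u n) (u n) = 1" and p1: "1 \<le> p n" for n
    using unit_direction[OF B[of n] assms(9,10)[of n]] by (simp_all add: s_def u_def)
  \<comment> \<open>the sample is realised on a product space whose second factor carries the nuisance directions\<close>
  define T where "T = (\<lambda>n. row_map (p n) (B n) (\<beta> n) (u n))"
  define P where "P = (\<lambda>n. PiM {..<n} (\<lambda>_. A) \<Otimes>\<^sub>M PiM {..<n} (\<lambda>_. std_gauss (p n)))"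
  define R where "R = (\<lambda>n. borel_vec (p n) \<Otimes>\<^sub>M borel :: ((nat \<Rightarrow> real) \<times> real) measure)"
  define eff where "eff = (\<lambda>n (\<xi> :: nat \<Rightarrow> (nat \<Rightarrow> real) \<times> real).
      max_deletion_effect (k n) (design_mat n (p n) (\<lambda>i. fst (\<xi> i))) (Matrix.vec n (\<lambda>i. snd (\<xi> i))) (v n))"
  have eff_cong: "eff n \<xi> = eff n \<xi>'" if "\<And>i. i < n \<Longrightarrow> \<xi> i = \<xi>' i" for n \<xi> \<xi>'
  proof -
    have "design_mat n (p n) (\<lambda>i. fst (\<xi> i)) = design_mat n (p n) (\<lambda>i. fst (\<xi>' i))"
      "Matrix.vec n (\<lambda>i. snd (\<xi> i)) = Matrix.vec n (\<lambda>i. snd (\<xi>' i))"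
      using that by (auto simp: design_mat_def intro!: eq_matI eq_vecI)
    thus ?thesis by (simp add: eff_def)
  qed
  define Ev where "Ev = (\<lambda>n. {\<xi> \<in> space (PiM {..<n} (\<lambda>_. R n)). s n * L \<le> eff n \<xi>})"
  have Ev: "Ev n \<in> sets (PiM {..<n} (\<lambda>_. R n))" for n
  proof -
    have c: "(\<lambda>\<xi>. \<xi> i) \<in> measurable (PiM {..<n} (\<lambda>_. R n)) (borel_vec (p n) \<Otimes>\<^sub>M borel)" if "i < n" for i
      using measurable_component_singleton[of i "{..<n}" "\<lambda>_. R n"] that by (simp add: R_def)
    have "eff n \<in> borel_measurable (PiM {..<n} (\<lambda>_. R n))"
      unfolding eff_def
    proof (rule measurable_deletion_effect[OF _ _ assms(9)])
      fix i j assume "i < n" "j < p n"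
      from measurable_compose[OF measurable_compose[OF c[OF this(1)] measurable_fst] measurable_component_singleton[of j "{..<p n}"]] this(2)
      show "(\<lambda>\<xi>. fst (\<xi> i) j) \<in> borel_measurable (PiM {..<n} (\<lambda>_. R n))" by simp
    next
      fix i assume "i < n"
      from measurable_compose[OF c[OF this] measurable_snd]
      show "(\<lambda>\<xi>. snd (\<xi> i)) \<in> borel_measurable (PiM {..<n} (\<lambda>_. R n))" .
    qed
    thus ?thesis unfolding Ev_def by measurable
  qed
  define E where "E = (\<lambda>n. {\<omega> \<in> space (P n). (\<lambda>i\<in>{..<n}. T n (fst \<omega> i, snd \<omega> i)) \<in> Ev n})"
  have Tm: "T n \<in> measurable (A \<Otimes>\<^sub>M std_gauss (p n)) (R n)" for n
    unfolding T_def R_def by (rule linear_model_law_row_map(1)[OF D u B_def[THEN fun_cong] Bc assms(8)])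
  have law: "linear_model_law (p n) (\<Sigma> n) (\<beta> n) D = distr (A \<Otimes>\<^sub>M std_gauss (p n)) (R n) (T n)" for n
    unfolding T_def R_def by (rule linear_model_law_row_map(2)[OF D u B_def[THEN fun_cong] Bc assms(8)])
  have zipm: "(\<lambda>\<omega>. \<lambda>i\<in>{..<n}. T n (fst \<omega> i, snd \<omega> i)) \<in> measurable (P n) (PiM {..<n} (\<lambda>_. R n))" for n
  proof (rule measurable_restrict)
    fix i assume i: "i \<in> {..<n}"
    have "(\<lambda>\<omega>. (fst \<omega> i, snd \<omega> i)) \<in> measurable (P n) (A \<Otimes>\<^sub>M std_gauss (p n))"
      unfolding P_def using i by measurable
    from measurable_compose[OF this Tm] show "(\<lambda>\<omega>. T n (fst \<omega> i, snd \<omega> i)) \<in> measurable (P n) (R n)" .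
  qed
  have E: "E n \<in> sets (P n)" for n
    unfolding E_def using measurable_sets[OF zipm Ev, of n] by (simp add: vimage_def Int_def conj_commute)
  have memE: "\<omega> \<in> E n" if "\<omega> \<in> space (P n)" "s n * L \<le> eff n (\<lambda>i. T n (fst \<omega> i, snd \<omega> i))" for n \<omega>
  proof -
    have "eff n (\<lambda>i\<in>{..<n}. T n (fst \<omega> i, snd \<omega> i)) = eff n (\<lambda>i. T n (fst \<omega> i, snd \<omega> i))"
      by (rule eff_cong) simp
    thus ?thesis using that measurable_space[OF zipm that(1)] by (simp add: E_def Ev_def)
  qed
  have transfer: "measure (M n) {\<omega> \<in> space (M n).
      1 / (1 - \<alpha>) * vec_l2norm (mat_inv_sqrt (\<Sigma> n) *\<^sub>v v n) *
        integral\<^sup>L N (\<lambda>\<omega>. \<epsilon> \<omega> * z \<omega> * indicator {quantile (distr N borel (\<lambda>\<omega>. \<epsilon> \<omega> * z \<omega>)) (1 - \<alpha>) <..} (\<epsilon> \<omega> * z \<omega>))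
      \<le> max_deletion_effect (k n) (design_mat n (p n) (\<lambda>i. x n i \<omega>)) (vec n (\<lambda>i. y n i \<omega>)) (v n)} = measure (P n) (E n)"
    if n: "0 < n" for n
  proof -
    have sv: "vec_l2norm (mat_inv_sqrt (\<Sigma> n) *\<^sub>v v n) = s n" by (simp add: s_def B_def mat_inv_sqrt_def)
    have iid: "iid_samples (M n) n (linear_model_law (p n) (\<Sigma> n) (\<beta> n) D) (\<lambda>i \<omega>. (x n i \<omega>, y n i \<omega>))"
      using assms(11)[of n] by (simp add: D_def)
    have rv: "(\<lambda>\<omega>. \<lambda>i\<in>{..<n}. (x n i \<omega>, y n i \<omega>)) \<in> measurable (M n) (PiM {..<n} (\<lambda>_. R n))"
    proof (rule measurable_restrict)
      fix i assume i: "i \<in> {..<n}"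
      have "prob_space.indep_vars (M n) (\<lambda>_. distr (A \<Otimes>\<^sub>M std_gauss (p n)) (R n) (T n)) (\<lambda>i \<omega>. (x n i \<omega>, y n i \<omega>)) {..<n}"
        using iid unfolding iid_samples_def law by blast
      hence "(\<lambda>\<omega>. (x n i \<omega>, y n i \<omega>)) \<in> measurable (M n) (distr (A \<Otimes>\<^sub>M std_gauss (p n)) (R n) (T n))"
        using i unfolding prob_space.indep_vars_def2[OF assms(6)[of n]] by blast
      thus "(\<lambda>\<omega>. (x n i \<omega>, y n i \<omega>)) \<in> measurable (M n) (R n)" by (simp only: measurable_distr_eq2)
    qed
    have "{\<omega> \<in> space (M n). s n * L \<le> max_deletion_effect (k n) (design_mat n (p n) (\<lambda>i. x n i \<omega>)) (vec n (\<lambda>i. y n i \<omega>)) (v n)}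
        = {\<omega> \<in> space (M n). (\<lambda>i\<in>{..<n}. (x n i \<omega>, y n i \<omega>)) \<in> Ev n}"
    proof (rule Collect_cong, rule conj_cong[OF refl])
      fix \<omega> assume "\<omega> \<in> space (M n)"
      hence "(\<lambda>i\<in>{..<n}. (x n i \<omega>, y n i \<omega>)) \<in> space (PiM {..<n} (\<lambda>_. R n))" using measurable_space[OF rv] by blast
      moreover have "eff n (\<lambda>i\<in>{..<n}. (x n i \<omega>, y n i \<omega>)) = eff n (\<lambda>i. (x n i \<omega>, y n i \<omega>))" by (rule eff_cong) simp
      ultimately show "(s n * L \<le> max_deletion_effect (k n) (design_mat n (p n) (\<lambda>i. x n i \<omega>)) (vec n (\<lambda>i. y n i \<omega>)) (v n)) =
          ((\<lambda>i\<in>{..<n}. (x n i \<omega>, y n i \<omega>)) \<in> Ev n)"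
        by (simp add: Ev_def eff_def)
    qed
    thus ?thesis
      unfolding prod_law q_def[symmetric] sv L E_def P_def
      using iid_samples_measure[OF assms(6) DZ.P.prob_space_axioms prob_space_std_gauss Tm law iid n Ev] by simp
  qed
  have inj: "AE \<omega> in P n. \<forall>S\<subseteq>{..<n}. p n \<le> card S \<longrightarrow>
       (\<forall>c. (\<forall>i\<in>S. dotp (p n) (recombine (p n) (u n) (snd (fst \<omega> i)) (snd \<omega> i)) c = 0) \<longrightarrow> (\<forall>j<p n. c j = 0))" for n
    unfolding P_def by (rule AE_recombined_rows_injective[OF D u])
  have Tx: "fst (T n ((e, t), h)) j = (B n *\<^sub>v Matrix.vec (p n) (recombine (p n) (u n) t h)) $ j" if "j < p n" for n e t h j
    using that by (simp add: T_def row_map_def Let_def)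
  have Ty: "snd (T n ((e, t), h)) = dotp (p n) (($) (\<beta> n)) (fst (T n ((e, t), h))) + e" for n e t h
    using assms(8)[of n] by (auto simp: T_def row_map_def Let_def dotp_scalar_prod[of _ "p n"] intro!: dotp_cong)
  have "(\<lambda>n. measure (P n) (E n)) \<longlonglongrightarrow> 1"
  proof (cases "AE e in D. e = 0")
    case True
    \<comment> \<open>without noise the bound is \<open>0\<close> and every estimate is exact\<close>
    have "AE x in A. fst x = 0"
    proof -
      have "{x \<in> space A. fst x = 0} \<in> sets A" by measurable
      thus ?thesis using True by (intro DZ.AE_pair_measure) auto
    qed
    hence "(\<integral>x. fst x * snd x * indicator {q<..} (fst x * snd x) \<partial>A) = (\<integral>x. 0 \<partial>A)"
      by (intro integral_cong_AE) auto
    hence L0: "L = 0" by (simp add: L_def)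
    have "measure (P n) (E n) = 1" if n: "0 < n" "p n \<le> n - k n" for n
    proof -
      interpret X: prob_space "PiM {..<n} (\<lambda>_. A)" by (intro prob_space_PiM DZ.P.prob_space_axioms)
      interpret Y: prob_space "PiM {..<n} (\<lambda>_. std_gauss (p n))" by (intro prob_space_PiM prob_space_std_gauss)
      interpret XY: pair_prob_space "PiM {..<n} (\<lambda>_. A)" "PiM {..<n} (\<lambda>_. std_gauss (p n))" ..
      have "AE a in PiM {..<n} (\<lambda>_. A). \<forall>i\<in>{..<n}. fst (a i) = 0"
        using \<open>AE x in A. fst x = 0\<close> by (intro AE_finite_allI AE_PiM_component) (auto intro: DZ.P.prob_space_axioms)
      hence "AE \<omega> in P n. \<forall>i\<in>{..<n}. fst (fst \<omega> i) = 0"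
      proof -
        assume ae: "AE a in PiM {..<n} (\<lambda>_. A). \<forall>i\<in>{..<n}. fst (a i) = 0"
        have "{\<omega> \<in> space (P n). \<forall>i\<in>{..<n}. fst (fst \<omega> i) = 0} \<in> sets (P n)"
          unfolding P_def by measurable
        thus ?thesis using ae unfolding P_def by (intro XY.AE_pair_measure) auto
      qed
      with inj[of n] AE_space have "AE \<omega> in P n. \<omega> \<in> E n"
      proof eventually_elim
        fix \<omega> assume inj_\<omega>: "\<forall>S\<subseteq>{..<n}. p n \<le> card S \<longrightarrow>
           (\<forall>c. (\<forall>i\<in>S. dotp (p n) (recombine (p n) (u n) (snd (fst \<omega> i)) (snd \<omega> i)) c = 0) \<longrightarrow> (\<forall>j<p n. c j = 0))"
          and sp: "\<omega> \<in> space (P n)" and z0: "\<forall>i\<in>{..<n}. fst (fst \<omega> i) = 0"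
        define S where "S = {..<n - k n}"
        have S: "S \<subseteq> {..<n}" "card S = n - k n" by (auto simp: S_def)
        have injS: "\<forall>c. (\<forall>i\<in>S. dotp (p n) (recombine (p n) (u n) (snd (fst \<omega> i)) (snd \<omega> i)) c = 0) \<longrightarrow> (\<forall>j<p n. c j = 0)"
          using inj_\<omega> S n(2) by metis
        have "0 \<le> eff n (\<lambda>i. T n (fst \<omega> i, snd \<omega> i))"
          unfolding eff_def
        proof (rule deletion_effect_nonneg_noiseless[OF B assms(8,9) s_def[THEN fun_cong] s, where u = "u n"
              and g = "\<lambda>i. recombine (p n) (u n) (snd (fst \<omega> i)) (snd \<omega> i)" and e = "\<lambda>i. fst (fst \<omega> i)", OF _ _ _ _ S injS])
          show "u n j = (mat_inv (B n) *\<^sub>v v n) $ j / s n" for j by (simp add: u_def)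
          show "fst (T n (fst \<omega> i, snd \<omega> i)) j = (B n *\<^sub>v Matrix.vec (p n) (recombine (p n) (u n) (snd (fst \<omega> i)) (snd \<omega> i))) $ j"
            if "j < p n" for i j using Tx[OF that, of "fst (fst \<omega> i)" "snd (fst \<omega> i)" "snd \<omega> i"] by simp
          show "snd (T n (fst \<omega> i, snd \<omega> i)) = dotp (p n) (($) (\<beta> n)) (fst (T n (fst \<omega> i, snd \<omega> i))) + fst (fst \<omega> i)" for i
            using Ty[of n "fst (fst \<omega> i)" "snd (fst \<omega> i)" "snd \<omega> i"] by simp
          show "fst (fst \<omega> i) = 0" if "i < n" for i using z0 that by simp
        qed
        thus "\<omega> \<in> E n" using sp by (intro memE) (auto simp: L0)
      qed
      thus ?thesis
        unfolding P_def using XY.P.prob_eq_1[of "E n"] E[of n] by (simp add: P_def)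
    qed
    moreover have "\<forall>\<^sub>F n in sequentially. 0 < n \<and> p n \<le> n - k n"
    proof -
      have "\<forall>\<^sub>F n in sequentially. real (k n) / real n < 1/2" using order_tendstoD(2)[OF assms(16), of "1/2"] \<alpha> by simp
      moreover have "\<forall>\<^sub>F n in sequentially. real (p n) / (real n - real (k n)) < 1" using order_tendstoD(2)[OF assms(17) assms(15)] .
      ultimately show ?thesis using eventually_gt_at_top[of "0::nat"]
      proof eventually_elim
        case (elim n)
        have "real (k n) < real n" using elim(1,3) by (simp add: field_simps)
        thus ?case using elim(2,3) by (simp add: field_simps)
      qed
    qed
    ultimately show ?thesis by (intro tendsto_eventually) (auto elim: eventually_mono)
  next
    case False
    have "\<exists>\<phi>. \<phi> \<in> borel_measurable A \<and> (\<forall>x. 0 \<le> \<phi> x \<and> \<phi> x \<le> 1) \<and> 1 - \<alpha> < (\<integral>x. \<phi> x \<partial>A) \<and>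
        (\<integral>x. \<phi> x * (snd x * (fst x + L * snd x)) \<partial>A) < 0"
      unfolding L_def q_def by (rule population_weights[OF \<alpha> False])
    then obtain \<phi> where \<phi>: "\<phi> \<in> borel_measurable A" "\<And>x. 0 \<le> \<phi> x \<and> \<phi> x \<le> 1" "1 - \<alpha> < (\<integral>x. \<phi> x \<partial>A)"
        "(\<integral>x. \<phi> x * (snd x * (fst x + L * snd x)) \<partial>A) < 0" by blast
    show ?thesis
      unfolding P_def
    proof (rule selection_probability_tendsto_1[OF \<alpha> assms(14,15,16,17) \<phi> u])
      show "E n \<in> sets (PiM {..<n} (\<lambda>_. A) \<Otimes>\<^sub>M PiM {..<n} (\<lambda>_. std_gauss (p n)))" for n
        using E[of n] by (simp only: P_def)
      show "AE \<omega> in PiM {..<n} (\<lambda>_. A) \<Otimes>\<^sub>M PiM {..<n} (\<lambda>_. std_gauss (p n)). \<forall>S\<subseteq>{..<n}. p n \<le> card S \<longrightarrow>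
         (\<forall>c. (\<forall>i\<in>S. dotp (p n) (recombine (p n) (u n) (snd (fst \<omega> i)) (snd \<omega> i)) c = 0) \<longrightarrow> (\<forall>j<p n. c j = 0))" for n
        using inj[of n] by (simp only: P_def)
      fix n a h S and c C \<delta> g :: real
      assume sp: "(a, h) \<in> space (PiM {..<n} (\<lambda>_. A) \<Otimes>\<^sub>M PiM {..<n} (\<lambda>_. std_gauss (p n)))"
        and n: "0 < n" and S: "S \<subseteq> {..<n}" "card S = n - k n" "real n \<le> 2 * card S"
        and injS: "\<forall>c. (\<forall>i\<in>S. dotp (p n) (recombine (p n) (u n) (snd (a i)) (h i)) c = 0) \<longrightarrow> (\<forall>j<p n. c j = 0)"
        and g: "real (p n) \<le> g * card S" "0 \<le> g" "g < 1" and c: "0 < c" "0 < C" "0 < \<delta>" "\<delta> * C \<le> (1 - g) * c / 4"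
        and zz: "(\<Sum>i<n. (snd (a i))\<^sup>2) \<le> C * n"
        and sS: "(\<Sum>i\<in>S. snd (a i) * (fst (a i) + L * snd (a i))) \<le> - c * card S"
        and sn: "\<delta> / 2 * n \<le> (\<Sum>i<n. snd (a i) * (fst (a i) + \<delta> * snd (a i)))"
        and dn: "gaussian_rows.form_deviation (p n) {..<n} (u n) (\<lambda>i. snd (a i)) (\<lambda>i. fst (a i) + \<delta> * snd (a i)) h \<le> (1 - g) * \<delta> / 2 * n"
        and dS: "- ((1 - g) * c / 4 * n) \<le> gaussian_rows.form_deviation (p n) S (u n) (\<lambda>i. snd (a i)) (\<lambda>i. fst (a i) + L * snd (a i)) h"
      have "s n * L \<le> eff n (\<lambda>i. T n (a i, h i))"
        unfolding eff_def
      proof (rule deletion_effect_ge[OF B assms(8,9) s_def[THEN fun_cong] s _ u _ _ S(1,2) n S(3) injS p1 g(1,2,3) c zz sS sn dn dS])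
        show "u n j = (mat_inv (B n) *\<^sub>v v n) $ j / s n" for j by (simp add: u_def)
        show "fst (T n (a i, h i)) j = (B n *\<^sub>v Matrix.vec (p n) (recombine (p n) (u n) (snd (a i)) (h i))) $ j"
          if "j < p n" for i j using Tx[OF that, of "fst (a i)" "snd (a i)" "h i"] by simp
        show "snd (T n (a i, h i)) = dotp (p n) (($) (\<beta> n)) (fst (T n (a i, h i))) + fst (a i)" for i
          using Ty[of n "fst (a i)" "snd (a i)" "h i"] by simp
      qed
      thus "(a, h) \<in> E n" using sp by (intro memE) (auto simp: P_def)
    qed
  qed
  moreover have "\<forall>\<^sub>F n in sequentially. measure (P n) (E n) = measure (M n) {\<omega> \<in> space (M n).
            max_deletion_effect (k n) (design_mat n (p n) (\<lambda>i. x n i \<omega>)) (vec n (\<lambda>i. y n i \<omega>)) (v n)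
            \<ge> 1 / (1 - \<alpha>) * vec_l2norm (mat_inv_sqrt (\<Sigma> n) *\<^sub>v v n) *
              integral\<^sup>L N (\<lambda>\<omega>. \<epsilon> \<omega> * z \<omega> *
                indicator {quantile (distr N borel (\<lambda>\<omega>. \<epsilon> \<omega> * z \<omega>)) (1 - \<alpha>) <..} (\<epsilon> \<omega> * z \<omega>))}"
    using eventually_gt_at_top[of "0::nat"] by eventually_elim (simp only: transfer)
  ultimately show ?thesis by (rule Lim_transform_eventually)
qed

end
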